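(* In the orthogonal case: 1. The space $SX^\jmath$ is a unique $SG^\jmath(E)$-orbit if and only if there is a unique $\mathrm{GL}_n(F)$-orbit in $Y_n(F)$ with discriminant $\det\jmath\,F^{*2}$. That is, if and only if either $n=1$, or $n=2$ and $\det\jmath\in-F^{*2}$. 2. The space $X^\jmath\setminus SX^\jmath$ is a unique $SG^\jmath(E)$-orbit if and only if there is a unique $\mathrm{GL}_n(F)$-orbit in $Y_n(F)$ with discriminant $\imath^2\det\jmath\,F^{*2}$. That is, if and only if either $n=1$, or $n=2$ and $\det\jmath\in-\imath^2F^{*2}$. 3. If either $n\ge3$, or $n=2$ and $\det\jmath\notin-F^{*2}$ (resp. $n\ge3$, or $n=2$ and $\det\jmath\notin-\imath^2F^{*2}$), then $SX^\jmath$ (resp. $X^\jmath\setminus SX^\jmath$) consists of exactly two $SG^\jmath(E)$-orbits.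
   Context: $E/F$ is a quadratic extension of non-archimedean local fields of characteristic zero with Galois involution $x\mapsto\bar x$, and $E=F[\imath]$ with $\imath\in E\setminus F$, $\imath^2\in F$. Orthogonal case: $n\ge1$, $Y_n(F)$ is the set of symmetric matrices in $\mathrm{GL}_n(F)$, with right $\mathrm{GL}_n(F)$-action $y\star g={}^tgyg$; the discriminant of $y$ is the square class $\det y\,F^{*2}$. $\jmath\in Y_n(F)$ is fixed, $G^\jmath(E)=\{g\in\mathrm{GL}_n(E):{}^tg\jmath g=\jmath\}$, $SG^\jmath(E)=G^\jmath(E)\cap\mathrm{SL}_n(E)$, $X^\jmath=\{x\in G^\jmath(E):x\bar x=I_n\}$ with action $g\cdot x=gx\bar g^{-1}$, and $SX^\jmath=X^\jmath\cap SG^\jmath(E)$; both $SX^\jmath$ and $X^\jmath\setminus SX^\jmath$ are stable under $G^\jmath(E)$. *)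

theory Defs
  imports
    "HOL-Algebra.Group_Action"
    "Jordan_Normal_Form.Determinant"
begin

text \<open>
  A non-archimedean local field of characteristic zero: a field that is complete with respect to a
  normalized discrete valuation and has finite residue field.  The valuation is integer-valued and
  only meaningful on nonzero elements; no axiom constrains \<open>v 0\<close>, and \<open>frac_ideal\<close> treats \<open>0\<close>
  as having valuation \<open>\<infinity>\<close>.
\<close>

definition frac_ideal :: "('a::zero \<Rightarrow> int) \<Rightarrow> int \<Rightarrow> 'a set" where
  "frac_ideal v k = {x. x = 0 \<or> k \<le> v x}"

locale nonarch_local_field =
  fixes v :: "'a::field_char_0 \<Rightarrow> int"
  assumes val_mult: "\<And>x y. x \<noteq> 0 \<Longrightarrow> y \<noteq> 0 \<Longrightarrow> v (x * y) = v x + v y"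
    and val_add: "\<And>x y. x \<noteq> 0 \<Longrightarrow> y \<noteq> 0 \<Longrightarrow> x + y \<noteq> 0 \<Longrightarrow> min (v x) (v y) \<le> v (x + y)"
    and uniformizer: "\<exists>x. x \<noteq> 0 \<and> v x = 1"
    and complete: "\<And>X :: nat \<Rightarrow> 'a.
          (\<And>k. \<exists>N. \<forall>m\<ge>N. \<forall>n\<ge>N. X m - X n \<in> frac_ideal v k) \<Longrightarrow>
          \<exists>L. \<forall>k. \<exists>N. \<forall>n\<ge>N. X n - L \<in> frac_ideal v k"
    and finite_residue_field:
          "finite (frac_ideal v 0 //
             {(x, y). x \<in> frac_ideal v 0 \<and> y \<in> frac_ideal v 0 \<and> x - y \<in> frac_ideal v 1})"

text \<open>
  The extension is given by a field embedding \<open>emb\<close> of the base field \<open>'f\<close> into \<open>'e\<close>; its degree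
  is the dimension of \<open>'e\<close> as a vector space over \<open>'f\<close>.  The Galois involution \<open>gal\<close> is the
  nontrivial automorphism fixing the base field (an endomorphism suffices, as the degree is finite).
\<close>

locale quadratic_extension =
  emb: field_hom emb + gal: field_hom gal
  for emb :: "'f::field_char_0 \<Rightarrow> 'e::field_char_0" and gal :: "'e \<Rightarrow> 'e" +
  assumes degree: "vector_space.dim (\<lambda>a x. emb a * x) (UNIV :: 'e set) = 2"
    and gal_emb: "\<And>a. gal (emb a) = emb a"
    and gal_nontrivial: "gal \<noteq> id"

definition GL :: "nat \<Rightarrow> 'a::field mat monoid" where
  "GL n = units_of (ring_mat TYPE('a) n ())"

definition sq_class :: "'a::field \<Rightarrow> 'a set" where
  "sq_class a = {a * c\<^sup>2 | c. c \<noteq> 0}"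

definition disc :: "'a::field mat \<Rightarrow> 'a set" where
  "disc y = sq_class (det y)"

definition sym_space :: "nat \<Rightarrow> 'a::field mat set" where
  "sym_space n = {y \<in> carrier (GL n). transpose_mat y = y}"

text \<open>
  \<open>star\<close> is the right action, with the group element as first argument as expected
  by \<^const>\<open>orbits\<close>; the orbit of \<open>y\<close> is the set of all \<open>\<^sup>tg y g\<close>, regardless of the side.
\<close>

definition star :: "'a::field mat \<Rightarrow> 'a mat \<Rightarrow> 'a mat" where
  "star g y = transpose_mat g * y * g"

definition sym_orbits :: "nat \<Rightarrow> 'a::field mat set set" where
  "sym_orbits n = orbits (GL n) (sym_space n) star"

definition sym_orbits_disc :: "nat \<Rightarrow> 'a::field set \<Rightarrow> 'a mat set set" where
  "sym_orbits_disc n D = {Y \<in> sym_orbits n. \<forall>y\<in>Y. disc y = D}"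

text \<open>
  In the following, \<open>J\<close> is a matrix over \<open>'e\<close>; it is to be instantiated with the image of
  a symmetric matrix over the base field.
\<close>

definition ortho :: "nat \<Rightarrow> 'e::field mat \<Rightarrow> 'e mat set" where
  "ortho n J = {g \<in> carrier (GL n). transpose_mat g * J * g = J}"

definition sortho :: "nat \<Rightarrow> 'e::field mat \<Rightarrow> 'e mat set" where
  "sortho n J = {g \<in> ortho n J. det g = 1}"

definition Xsp :: "('e::field \<Rightarrow> 'e) \<Rightarrow> nat \<Rightarrow> 'e mat \<Rightarrow> 'e mat set" where
  "Xsp gal n J = {x \<in> ortho n J. x * map_mat gal x = 1\<^sub>m n}"

definition SXsp :: "('e::field \<Rightarrow> 'e) \<Rightarrow> nat \<Rightarrow> 'e mat \<Rightarrow> 'e mat set" where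
  "SXsp gal n J = Xsp gal n J \<inter> sortho n J"

definition twisted_conj :: "('e::field \<Rightarrow> 'e) \<Rightarrow> nat \<Rightarrow> 'e mat \<Rightarrow> 'e mat \<Rightarrow> 'e mat" where
  "twisted_conj gal n g x = g * x * inv\<^bsub>GL n\<^esub> (map_mat gal g)"

definition sortho_orbits ::
  "('e::field \<Rightarrow> 'e) \<Rightarrow> nat \<Rightarrow> 'e mat \<Rightarrow> 'e mat set \<Rightarrow> 'e mat set set" where
  "sortho_orbits gal n J S =
     orbits (GL n\<lparr>carrier := sortho n J\<rparr>) S (twisted_conj gal n)"

end

theory Submission
  imports Defs "Jordan_Normal_Form.Char_Poly"
begin

text \<open>
  By Hilbert 90, an element \<open>x\<close> of the symmetric space is of the form \<open>h (gal h)\<^sup>-\<^sup>1\<close> with \<open>h\<close> invertible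
  over the extension.  The matrix \<open>y = \<^sup>th j h\<close> is then invariant under the Galois involution and
  symmetric, its discriminant is the class of \<open>det j\<close> or \<open>\<iota>\<^sup>2 det j\<close> according to \<open>det x = 1\<close> or \<open>det x = - 1\<close>,
  and its congruence class over the base field determines the orbit of \<open>x\<close>; since the stabilizer of
  \<open>x\<close> contains a reflection, it makes no difference whether the orbits are taken under the orthogonal
  or the special orthogonal group.  Conversely, all quaternion algebras over the base field split over
  the extension, so symmetric matrices over the base field with equal discriminants over the extension
  are congruent there, and every \<open>y\<close> with one of the two discriminants occurs.

  It remains to count the classes of symmetric matrices with given rank and discriminant.
  The key input is that the norm group of a quadratic extension of a local field has index two,
  which is proved by climbing the unit filtration, uniformly in the residue characteristic.
  It makes the Hilbert symbol bilinear and nondegenerate.  Hence matrices of rank at least three and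
  discriminant \<open>D\<close> represent every \<open>t\<close> with \<open>- D t\<close> not a square; splitting off a common value and
  Witt cancellation reduce the count to rank two, where the classes are the cosets of a norm group.
\<close>

section \<open>Norm forms\<close>

text \<open>The obstacle is residue characteristic two, where a unit congruent to a square need not
  be a square. Writing \<open>u = 1 + 4 c\<close> and \<open>z = 1 + 2 x\<close> turns
  \<open>u = z^2\<close> into \<open>x^2 + x = c\<close>, which is solved by iteration as soon as
  \<open>c\<close> has positive valuation; this is the origin of the bound \<open>2 e + 1\<close>
  with \<open>e = v 2\<close> and lets one method serve every residue characteristic. The same
  polynomial supplies the non-norms: \<open>x^2 + x\<close> takes equal values at \<open>0\<close>
  and \<open>- 1\<close>, so modulo the maximal ideal it misses a class \<open>rho\<close>, and
  nonzero values of the norm form attached to \<open>Delta = 1 + 4 rho\<close> have even valuation.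
  All other non-norms are reduced to this parity through symmetry and multiplicativity of
  \<open>hil\<close>. The index is at most two because only one stage of each climb leaves a factor
  of two: the layer \<open>2 e\<close>, the ramification break, or the parity of the valuation.
  Descent is kept as a relation between \<open>x\<close> and \<open>y\<close>, since
  \<open>h\<close> in Hilbert 90 is only determined up to right multiplication by matrices over the
  base field.\<close>

text \<open>For nonzero \<open>a\<close> and \<open>b\<close>, this says that the Hilbert symbol \<open>(a, b)\<close> is trivial.\<close>

definition hil :: "'a::field \<Rightarrow> 'a \<Rightarrow> bool" where
  "hil a b \<longleftrightarrow> (\<exists>x y. b = x\<^sup>2 - a * y\<^sup>2)"

lemma hilI: "b = x\<^sup>2 - a * y\<^sup>2 \<Longrightarrow> hil a b"
  unfolding hil_def by blast

lemma hil_one: "hil a 1"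
  by (rule hilI[of _ 1 _ 0]) simp

lemma hil_square: "hil a (z\<^sup>2)"
  by (rule hilI[of _ z _ 0]) simp

lemma hil_neg: "hil a (- a)"
  by (rule hilI[of _ 0 _ 1]) simp

text \<open>Brahmagupta's identity, that is, multiplicativity of the norm of
  \<open>x + y sqrt a\<close>.\<close>

lemma hil_mult: "hil a b \<Longrightarrow> hil a c \<Longrightarrow> hil a (b * c)"
proof -
  assume "hil a b" "hil a c"
  then obtain x y x' y' where "b = x\<^sup>2 - a * y\<^sup>2" "c = x'\<^sup>2 - a * y'\<^sup>2"
    unfolding hil_def by blast
  then have "b * c = (x * x' + a * y * y')\<^sup>2 - a * (x * y' + y * x')\<^sup>2"
    by (simp only: power2_eq_square) (simp add: algebra_simps)
  then show ?thesis by (rule hilI)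
qed

lemma hil_inverse: "hil a b \<Longrightarrow> hil a (inverse b)"
proof (cases "b = 0")
  case False
  assume "hil a b"
  then have "hil a (b * (inverse b)\<^sup>2)" by (rule hil_mult[OF _ hil_square])
  also have "b * (inverse b)\<^sup>2 = inverse b" using False by (simp add: power2_eq_square)
  finally show ?thesis .
qed simp

lemma hil_mult_iff: "hil a b \<Longrightarrow> b \<noteq> 0 \<Longrightarrow> hil a (b * c) \<longleftrightarrow> hil a c"
  using hil_mult[of a "inverse b" "b * c"] hil_inverse[of a b] hil_mult[of a b c]
  by (auto simp: mult.assoc[symmetric])

lemma hil_mult_square: "z \<noteq> 0 \<Longrightarrow> hil a (b * z\<^sup>2) \<longleftrightarrow> hil a b"
  using hil_mult_iff[OF hil_square[of a z], of b] by (simp add: mult.commute)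

lemma hil_square_mult_left:
  assumes "z \<noteq> 0" shows "hil (a * z\<^sup>2) b \<longleftrightarrow> hil a b"
proof
  assume "hil (a * z\<^sup>2) b"
  then obtain x y where "b = x\<^sup>2 - a * (z * y)\<^sup>2"
    unfolding hil_def by (auto simp: power_mult_distrib mult.assoc)
  then show "hil a b" by (rule hilI)
next
  assume "hil a b"
  then obtain x y where "b = x\<^sup>2 - a * y\<^sup>2" unfolding hil_def by blast
  then have "b = x\<^sup>2 - a * z\<^sup>2 * (y / z)\<^sup>2"
    using assms by (simp add: power_divide)
  then show "hil (a * z\<^sup>2) b" by (rule hilI)
qed

text \<open>The norm form splits as \<open>(x - z y) (x + z y)\<close>; the witnesses give these
  factors the values \<open>1\<close> and \<open>b\<close>.\<close>

lemma hil_of_square: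
  fixes z :: "'a::field_char_0"
  assumes "z \<noteq> 0" shows "hil (z\<^sup>2) b"
proof (rule hilI[of _ "(b + 1) / 2" _ "(b - 1) / (2 * z)"])
  have "z\<^sup>2 * ((b - 1) / (2 * z))\<^sup>2 = ((b - 1) / 2)\<^sup>2"
    using assms by (simp add: power_divide power_mult_distrib)
  also have "((b + 1) / 2)\<^sup>2 - \<dots> = b" by (simp add: power2_eq_square field_simps)
  finally show "b = ((b + 1) / 2)\<^sup>2 - z\<^sup>2 * ((b - 1) / (2 * z))\<^sup>2" by simp
qed

text \<open>For \<open>y \<noteq> 0\<close> the equation can be solved for \<open>a\<close>; for
  \<open>y = 0\<close> the element \<open>b\<close> is a nonzero square, whose norm form takes every
  value.\<close>

lemma hil_commute:
  fixes a b :: "'a::field_char_0"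
  assumes "b \<noteq> 0" "hil a b" shows "hil b a"
proof -
  obtain x y where *: "b = x\<^sup>2 - a * y\<^sup>2" using assms unfolding hil_def by blast
  show ?thesis
  proof (cases "y = 0")
    case True
    then show ?thesis using * assms(1) hil_of_square[of x a] by auto
  next
    case False
    then have "a = (x / y)\<^sup>2 - b * (1 / y)\<^sup>2"
      by (simp add: * power_divide field_simps)
    then show ?thesis by (rule hilI)
  qed
qed

section \<open>Valuation and residue field\<close>

context nonarch_local_field
begin

abbreviation "I \<equiv> frac_ideal v"

lemma val_one: "v 1 = 0"
  using val_mult[of 1 1] by simp

lemma val_minus: "v (- x) = v x"
proof (cases "x = 0")
  case False
  have "2 * v (- 1) = 0" using val_mult[of "-1" "-1"] val_one by simp
  then show ?thesis using val_mult[of "-1" x] False by simp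
qed simp

lemma val_power: "x \<noteq> 0 \<Longrightarrow> v (x ^ n) = int n * v x"
  by (induction n) (simp_all add: val_one val_mult algebra_simps)

lemma val_square: "x \<noteq> 0 \<Longrightarrow> v (x\<^sup>2) = 2 * v x"
  by (simp add: val_power)

lemma val_divide: "x \<noteq> 0 \<Longrightarrow> y \<noteq> 0 \<Longrightarrow> v (x / y) = v x - v y"
  using val_mult[of "x / y" y] by simp

lemma ex_val: "\<exists>c. c \<noteq> 0 \<and> v c = i"
proof -
  obtain p where p: "p \<noteq> 0" "v p = 1" using uniformizer by blast
  show ?thesis
  proof (cases "i \<ge> 0")
    case True
    then show ?thesis using p by (intro exI[of _ "p ^ nat i"]) (simp add: val_power)
  next
    case False
    then show ?thesis using p
      by (intro exI[of _ "1 / p ^ nat (- i)"]) (simp add: val_power val_divide val_one)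
  qed
qed

section \<open>Fractional ideals as congruence moduli\<close>

lemma zero_in_ideal [simp]: "0 \<in> I k"
  by (simp add: frac_ideal_def)

lemma ideal_iff: "x \<noteq> 0 \<Longrightarrow> x \<in> I k \<longleftrightarrow> k \<le> v x"
  by (simp add: frac_ideal_def)

lemma ideal_add: "x \<in> I k \<Longrightarrow> y \<in> I k \<Longrightarrow> x + y \<in> I k"
  using val_add[of x y] by (fastforce simp: frac_ideal_def)

lemma ideal_minus: "x \<in> I k \<Longrightarrow> - x \<in> I k"
  by (auto simp: frac_ideal_def val_minus)

lemma ideal_minus_iff: "- x \<in> I k \<longleftrightarrow> x \<in> I k"
  using ideal_minus by fastforce

lemma ideal_diff: "x \<in> I k \<Longrightarrow> y \<in> I k \<Longrightarrow> x - y \<in> I k"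
  using ideal_add[of x k "- y"] ideal_minus by simp

lemma ideal_diff_commute: "x - y \<in> I k \<longleftrightarrow> y - x \<in> I k"
  using ideal_minus by fastforce

lemma ideal_diff_trans: "x - y \<in> I k \<Longrightarrow> y - z \<in> I k \<Longrightarrow> x - z \<in> I k"
  using ideal_add[of "x - y" k "y - z"] by simp

lemma ideal_mult: "x \<in> I k \<Longrightarrow> y \<in> I l \<Longrightarrow> x * y \<in> I (k + l)"
  by (cases "x = 0 \<or> y = 0") (auto simp: frac_ideal_def val_mult)

lemma ideal_mult_left: "x \<in> I 0 \<Longrightarrow> y \<in> I l \<Longrightarrow> x * y \<in> I l"
  using ideal_mult[of x 0 y l] by simp

lemma ideal_mono: "x \<in> I k \<Longrightarrow> l \<le> k \<Longrightarrow> x \<in> I l"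
  by (auto simp: frac_ideal_def)

lemma ideal_square: "x \<in> I k \<Longrightarrow> x\<^sup>2 \<in> I (2 * k)"
  by (cases "x = 0") (auto simp: frac_ideal_def val_square)

lemma ideal_mult_iff: "c \<noteq> 0 \<Longrightarrow> c * x \<in> I k \<longleftrightarrow> x \<in> I (k - v c)"
  by (cases "x = 0") (auto simp: frac_ideal_def val_mult)

lemma ideal_divide_iff: "c \<noteq> 0 \<Longrightarrow> x / c \<in> I k \<longleftrightarrow> x \<in> I (k + v c)"
  using ideal_mult_iff[of c "x / c" "k + v c"] by simp

lemma one_in_ideal: "1 \<in> I 0"
  by (simp add: frac_ideal_def val_one)

lemma of_nat_in_ideal: "of_nat n \<in> I 0"
  by (induction n) (auto intro: ideal_add one_in_ideal)

lemma numeral_in_ideal: "numeral n \<in> I 0"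
  using of_nat_in_ideal[of "numeral n"] by simp

lemma ideal_eq_zero: "(\<And>k. x \<in> I k) \<Longrightarrow> x = 0"
  using ideal_iff[of x "v x + 1"] by fastforce

text \<open>The strict ultrametric inequality: the term of smaller valuation dominates a
  sum.\<close>

lemma val_close:
  assumes "w \<noteq> 0" "u - w \<in> I (v w + 1)"
  shows "u \<noteq> 0" "v u = v w"
proof -
  show u: "u \<noteq> 0"
  proof
    assume "u = 0"
    then have "w \<in> I (v w + 1)" using assms(2) ideal_minus[of "- w"] by simp
    then show False using assms(1) by (simp add: ideal_iff)
  qed
  have "v w + 1 \<le> v (u - w)" if "u \<noteq> w" using that assms(2) by (simp add: ideal_iff)
  moreover have "min (v w) (v (u - w)) \<le> v u" if "u \<noteq> w"
    using val_add[of w "u - w"] that assms(1) u by simp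
  moreover have "min (v u) (v (u - w)) \<le> v w" if "u \<noteq> w"
    using val_add[of u "w - u"] that assms(1) u val_minus[of "u - w"] by simp
  ultimately show "v u = v w" by (cases "u = w") auto
qed

lemma val_close_unit:
  assumes "w \<noteq> 0" "v w = 0" "u - w \<in> I k" "k \<ge> 1"
  shows "u \<noteq> 0" "v u = 0"
  using val_close[of w u] ideal_mono[OF assms(3)] assms by auto

lemma close_one:
  assumes "u - 1 \<in> I k" "k \<ge> 1" shows "u \<noteq> 0" "v u = 0"
  using val_close_unit[of 1 u k] assms by (auto simp: val_one)

text \<open>The absolute ramification index at \<open>2\<close>. It vanishes exactly when the
  residue characteristic is odd, so the case splits \<open>e = 0\<close> and
  \<open>e \<ge> 1\<close> below separate odd from even residue characteristic.\<close>

definition "e \<equiv> v 2"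

lemma e_nonneg: "e \<ge> 0"
  using numeral_in_ideal[of "Num.Bit0 Num.One"] by (simp add: ideal_iff e_def)

lemma two_ideal: "2 * x \<in> I k \<longleftrightarrow> x \<in> I (k - e)"
  by (simp add: ideal_mult_iff e_def)

lemma val_four: "v 4 = 2 * e"
  using val_mult[of 2 2] by (simp add: e_def)

lemma four_ideal: "4 * x \<in> I k \<longleftrightarrow> x \<in> I (k - 2 * e)"
  by (simp add: ideal_mult_iff val_four)

section \<open>The residue domain and Artin-Schreier equations\<close>

lemma ideal_one_product:
  assumes "x * y \<in> I 1" "x \<in> I 0" "y \<in> I 0"
  shows "x \<in> I 1 \<or> y \<in> I 1"
  using assms by (cases "x = 0 \<or> y = 0") (auto simp: frac_ideal_def val_mult)

text \<open>Fixed point of \<open>x \<mapsto> c - x^2\<close>: two values differ by the difference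
  of the arguments times their sum, up to sign, and the sum lies in \<open>I 1\<close>, so each
  iteration gains one unit of valuation.\<close>

lemma artin_schreier_root:
  assumes c: "c \<in> I 1"
  shows "\<exists>x\<in>I 1. x\<^sup>2 + x = c"
proof -
  define X where "X = rec_nat 0 (\<lambda>n x. c - x\<^sup>2)"
  have X0: "X 0 = 0" and XS: "X (Suc n) = c - (X n)\<^sup>2" for n
    by (simp_all add: X_def)
  have X1: "X n \<in> I 1" for n
  proof (induction n)
    case (Suc n)
    show ?case unfolding XS
      by (rule ideal_diff[OF c ideal_mono[OF ideal_square[OF Suc]]]) simp
  qed (simp add: X0)
  have step: "X (Suc n) - X n \<in> I (int n + 1)" for n
  proof (induction n)
    case 0
    then show ?case using c by (simp add: X0 XS)
  next
    case (Suc n)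
    have "X (Suc (Suc n)) - X (Suc n) = - ((X (Suc n) - X n) * (X (Suc n) + X n))"
      unfolding XS[of "Suc n"] XS[of n] by (simp add: power2_eq_square algebra_simps)
    also have "\<dots> \<in> I (int n + 1 + 1)"
      by (intro ideal_minus ideal_mult Suc ideal_add X1)
    finally show ?case by (simp add: add_ac)
  qed
  have tail: "X (N + i) - X N \<in> I (int N)" for N i
  proof (induction i)
    case (Suc i)
    have "X (Suc (N + i)) - X (N + i) \<in> I (int N)"
      by (rule ideal_mono[OF step]) simp
    from ideal_diff_trans[OF this Suc] show ?case by simp
  qed simp
  have "\<exists>N. \<forall>m\<ge>N. \<forall>n\<ge>N. X m - X n \<in> I k" for k
  proof (intro exI allI impI)
    fix m n assume mn: "nat k \<le> m" "nat k \<le> n"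
    have "X m - X (nat k) \<in> I k" "X n - X (nat k) \<in> I k"
      using tail[of "nat k" "m - nat k"] tail[of "nat k" "n - nat k"] mn
      by (auto intro: ideal_mono)
    then show "X m - X n \<in> I k" using ideal_diff by fastforce
  qed
  from complete[OF this] obtain L where
    L: "\<And>k. \<exists>N. \<forall>n\<ge>N. X n - L \<in> I k" by blast
  obtain N where "X N - L \<in> I 1" using L[of 1] by blast
  then have L1: "L \<in> I 1" using ideal_diff[OF X1[of N]] by fastforce
  have "L\<^sup>2 + L - c \<in> I k" for k
  proof -
    obtain N where N: "\<And>n. n \<ge> N \<Longrightarrow> X n - L \<in> I k" using L[of k] by blast
    \<comment> \<open>Through the recursion the defect of \<open>L\<close> becomes two terms
      containing \<open>X N - L\<close> or \<open>X (Suc N) - L\<close>, both small.\<close>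
    have "(X N - L) * (X N + L) \<in> I (k + 0)"
      by (intro ideal_mult N ideal_mono[OF ideal_add[OF X1 L1]]) simp_all
    then have "- (X (Suc N) - L) - (X N - L) * (X N + L) \<in> I k"
      using ideal_diff[OF ideal_minus[OF N[of "Suc N"]]] by simp
    also have "- (X (Suc N) - L) - (X N - L) * (X N + L) = L\<^sup>2 + L - c"
      unfolding XS by (simp add: power2_eq_square algebra_simps)
    finally show ?thesis .
  qed
  then have "L\<^sup>2 + L - c = 0" by (rule ideal_eq_zero)
  then show ?thesis using L1 by auto
qed

text \<open>Division by \<open>4\<close> costs \<open>2 e\<close>, and the remaining
  \<open>1\<close> is what the Artin-Schreier iteration requires.\<close>

lemma local_square:
  assumes "u - 1 \<in> I (2 * e + 1)" shows "\<exists>z. u = z\<^sup>2"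
proof -
  have "(u - 1) / 4 \<in> I 1" using assms by (subst ideal_divide_iff) (simp_all add: val_four add.commute)
  then obtain x where "x\<^sup>2 + x = (u - 1) / 4" using artin_schreier_root by blast
  then have "u = (1 + 2 * x)\<^sup>2" by (simp add: power2_eq_square field_simps)
  then show ?thesis ..
qed

section \<open>Counting residue classes\<close>

lemma representatives:
  "\<exists>rep. finite (rep ` I 0) \<and> (\<forall>x\<in>I 0. rep x \<in> I 0 \<and> rep x - x \<in> I 1) \<and>
     (\<forall>x\<in>I 0. \<forall>y\<in>I 0. rep x = rep y \<longleftrightarrow> x - y \<in> I 1)"
proof -
  define r where "r = {(x, y). x \<in> I 0 \<and> y \<in> I 0 \<and> x - y \<in> I 1}"
  \<comment> \<open>One chosen element per class lets the counting below take place on a finite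
    subset of the ring instead of the quotient.\<close>
  define rep where "rep x = (SOME y. y \<in> r `` {x})" for x
  have cls: "r `` {x} = {y \<in> I 0. x - y \<in> I 1}" if "x \<in> I 0" for x
    using that by (auto simp: r_def)
  have rep: "rep x \<in> I 0 \<and> x - rep x \<in> I 1" if "x \<in> I 0" for x
    using someI[of "\<lambda>y. y \<in> r `` {x}" x] that unfolding rep_def by (simp add: cls)
  have "rep ` I 0 = (\<lambda>C. SOME y. y \<in> C) ` (I 0 // r)"
    unfolding rep_def quotient_def image_UN by (auto simp del: Image_singleton_iff)
  then have "finite (rep ` I 0)" using finite_residue_field by (simp add: r_def)
  moreover have "rep x = rep y" if "x \<in> I 0" "y \<in> I 0" "x - y \<in> I 1" for x y
  proof -
    have "r `` {x} = r `` {y}"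
      using that ideal_diff_trans[of x y 1] ideal_diff_trans[of y x 1] ideal_diff_commute[of x y 1]
      unfolding cls[OF that(1)] cls[OF that(2)] by blast
    then show ?thesis by (simp add: rep_def)
  qed
  moreover have "x - y \<in> I 1" if "x \<in> I 0" "y \<in> I 0" "rep x = rep y" for x y
    using rep[OF that(1)] rep[OF that(2)] that(3) ideal_diff_trans[of x "rep x" 1 y]
      ideal_diff_commute[of y "rep y" 1] by simp
  moreover have "rep x \<in> I 0 \<and> rep x - x \<in> I 1" if "x \<in> I 0" for x
    using rep[OF that] ideal_diff_commute[of x "rep x"] by simp
  ultimately show ?thesis by (intro exI[of _ rep]) blast
qed

text \<open>Finiteness of the residue field. Injectivity of squaring in even residue characteristic
  will give surjectivity, and non-injectivity of \<open>x^2 + x\<close> will give a missed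
  value.\<close>

lemma residue_injective_iff_surjective:
  assumes f: "\<And>x. x \<in> I 0 \<Longrightarrow> f x \<in> I 0"
    and cong: "\<And>x y. x \<in> I 0 \<Longrightarrow> y \<in> I 0 \<Longrightarrow> x - y \<in> I 1 \<Longrightarrow> f x - f y \<in> I 1"
  shows "(\<forall>x\<in>I 0. \<forall>y\<in>I 0. f x - f y \<in> I 1 \<longrightarrow> x - y \<in> I 1) \<longleftrightarrow>
         (\<forall>a\<in>I 0. \<exists>x\<in>I 0. f x - a \<in> I 1)"
proof -
  obtain rep where fin: "finite (rep ` I 0)"
    and r1: "\<forall>x\<in>I 0. rep x \<in> I 0 \<and> rep x - x \<in> I 1"
    and r2: "\<forall>x\<in>I 0. \<forall>y\<in>I 0. rep x = rep y \<longleftrightarrow> x - y \<in> I 1"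
    using representatives by blast
  have rep: "rep x \<in> I 0" "rep x - x \<in> I 1" if "x \<in> I 0" for x using r1 that by auto
  have rep_iff: "rep x = rep y \<longleftrightarrow> x - y \<in> I 1" if "x \<in> I 0" "y \<in> I 0" for x y
    using r2 that by auto
  define R where "R = rep ` I 0"
  define g where "g x = rep (f x)" for x
  have R: "finite R" "R \<subseteq> I 0" using fin rep by (auto simp: R_def)
  have gR: "g ` R \<subseteq> R" using f R(2) unfolding g_def R_def by blast
  have g_rep: "g (rep x) = g x" if "x \<in> I 0" for x
    unfolding g_def using rep_iff[OF f[OF rep(1)] f] cong[OF rep(1) _ rep(2)] that by blast
  have "inj_on g R \<longleftrightarrow> (\<forall>x\<in>I 0. \<forall>y\<in>I 0. f x - f y \<in> I 1 \<longrightarrow> x - y \<in> I 1)"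
  proof -
    have "inj_on g R \<longleftrightarrow> (\<forall>x\<in>I 0. \<forall>y\<in>I 0. g (rep x) = g (rep y) \<longrightarrow> rep x = rep y)"
      unfolding inj_on_def R_def by (simp only: ball_simps)
    also have "\<dots> \<longleftrightarrow> (\<forall>x\<in>I 0. \<forall>y\<in>I 0. f x - f y \<in> I 1 \<longrightarrow> x - y \<in> I 1)"
    proof (intro ball_cong refl)
      fix x y assume "x \<in> I 0" "y \<in> I 0"
      then show "(g (rep x) = g (rep y) \<longrightarrow> rep x = rep y) \<longleftrightarrow> (f x - f y \<in> I 1 \<longrightarrow> x - y \<in> I 1)"
        using g_rep[of x] g_rep[of y] rep_iff[of x y] rep_iff[OF f f, of x y]
        by (simp add: g_def)
    qed
    finally show ?thesis .
  qed
  moreover have "R \<subseteq> g ` R \<longleftrightarrow> (\<forall>a\<in>I 0. \<exists>x\<in>I 0. f x - a \<in> I 1)"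
  proof -
    have "R \<subseteq> g ` R \<longleftrightarrow> (\<forall>a\<in>I 0. \<exists>x\<in>I 0. rep a = g (rep x))"
      unfolding R_def image_image by (simp add: image_subset_iff image_iff)
    also have "\<dots> \<longleftrightarrow> (\<forall>a\<in>I 0. \<exists>x\<in>I 0. f x - a \<in> I 1)"
    proof (intro ball_cong bex_cong refl)
      fix a x assume "a \<in> I 0" "x \<in> I 0"
      then show "rep a = g (rep x) \<longleftrightarrow> f x - a \<in> I 1"
        using g_rep[of x] rep_iff[OF f, of x a] by (auto simp: g_def)
    qed
    finally show ?thesis .
  qed
  moreover have "inj_on g R \<longleftrightarrow> R \<subseteq> g ` R"
    using endo_inj_surj[OF R(1) gR] finite_surj_inj[OF R(1)] by blast
  ultimately show ?thesis by blast
qed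

text \<open>
  As \<open>f\<close> is at most two-to-one on residue classes, its image and the disjoint copy of the image
  under \<open>t\<close> fill up \<open>S\<close>.
\<close>

lemma residue_two_to_one:
  assumes S: "S \<subseteq> I 0" "\<And>x y. x \<in> S \<Longrightarrow> y \<in> I 0 \<Longrightarrow> x - y \<in> I 1 \<Longrightarrow> y \<in> S"
    and f: "\<And>x. x \<in> S \<Longrightarrow> f x \<in> S" and t: "\<And>x. x \<in> S \<Longrightarrow> t (f x) \<in> S"
    and t_cong: "\<And>x y. x \<in> I 0 \<Longrightarrow> y \<in> I 0 \<Longrightarrow> t x - t y \<in> I 1 \<longleftrightarrow> x - y \<in> I 1"
    and g: "\<And>x. x \<in> S \<Longrightarrow> g x \<in> S"
    and fibre: "\<And>x y. x \<in> S \<Longrightarrow> y \<in> S \<Longrightarrow> f x - f y \<in> I 1 \<Longrightarrow> x - y \<in> I 1 \<or> x - g y \<in> I 1"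
    and disjoint: "\<And>x y. x \<in> S \<Longrightarrow> y \<in> S \<Longrightarrow> f x - t (f y) \<notin> I 1"
    and a: "a \<in> S"
  shows "\<exists>x\<in>S. a - f x \<in> I 1 \<or> a - t (f x) \<in> I 1"
proof -
  obtain rep where fin: "finite (rep ` I 0)"
    and r1: "\<forall>x\<in>I 0. rep x \<in> I 0 \<and> rep x - x \<in> I 1"
    and r2: "\<forall>x\<in>I 0. \<forall>y\<in>I 0. rep x = rep y \<longleftrightarrow> x - y \<in> I 1"
    using representatives by blast
  have rep: "rep x \<in> I 0" "rep x - x \<in> I 1" if "x \<in> I 0" for x using r1 that by auto
  have rep_iff: "rep x = rep y \<longleftrightarrow> x - y \<in> I 1" if "x \<in> I 0" "y \<in> I 0" for x y
    using r2 that by auto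
  have SI: "x \<in> I 0" if "x \<in> S" for x using S(1) that by blast
  have repS: "rep x \<in> S" if "x \<in> S" for x
    using S(2)[OF that rep(1)] rep(2)[OF SI[OF that]] SI[OF that] ideal_diff_commute[of x "rep x"]
    by simp
  define R where "R = rep ` S"
  have R: "finite R" using fin S(1) by (auto simp: R_def intro: finite_subset)
  define H where "H = (\<lambda>x. rep (f x)) ` R"
  define T where "T = (\<lambda>x. rep (t (f x))) ` R"
  have HR: "H \<subseteq> R" "T \<subseteq> R" using repS f t by (auto simp: H_def T_def R_def)
  \<comment> \<open>Each fibre of \<open>f\<close> on classes lies in the classes of
    \<open>y\<close> and \<open>g y\<close>, so the image takes up at least half of
    \<open>R\<close>.\<close>
  have "card R \<le> 2 * card H"
  proof -
    have "R \<subseteq> (\<Union>h\<in>H. {x\<in>R. rep (f x) = h})" by (auto simp: H_def)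
    then have "card R \<le> card (\<Union>h\<in>H. {x\<in>R. rep (f x) = h})"
      using R HR by (intro card_mono) (auto intro: finite_subset)
    also have "\<dots> \<le> (\<Sum>h\<in>H. card {x\<in>R. rep (f x) = h})"
      by (rule card_UN_le) (use R HR finite_subset in blast)
    also have "\<dots> \<le> (\<Sum>h\<in>H. 2)"
    proof (rule sum_mono)
      fix h assume "h \<in> H"
      then obtain y where y: "y \<in> R" "h = rep (f y)" by (auto simp: H_def)
      have yS: "y \<in> S" using y repS by (auto simp: R_def)
      have "{x\<in>R. rep (f x) = h} \<subseteq> {rep y, rep (g y)}"
      proof
        fix x assume "x \<in> {x\<in>R. rep (f x) = h}"
        then obtain x' where x': "x' \<in> S" "x = rep x'" "rep (f x) = rep (f y)"
          using y by (auto simp: R_def)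
        have xS: "x \<in> S" using x' repS by simp
        have "f x - f y \<in> I 1" using x'(3) rep_iff[OF SI SI, OF f f, OF xS yS] by blast
        from fibre[OF xS yS this] have "rep x = rep y \<or> rep x = rep (g y)"
          using rep_iff[OF SI SI, OF xS yS] rep_iff[OF SI SI, OF xS g[OF yS]] by blast
        moreover have "rep x = x"
          using x'(2) rep_iff[OF SI[OF xS] SI[OF x'(1)]] rep(2)[OF SI[OF x'(1)]] by simp
        ultimately show "x \<in> {rep y, rep (g y)}" by auto
      qed
      then have "card {x\<in>R. rep (f x) = h} \<le> card {rep y, rep (g y)}"
        by (intro card_mono) auto
      also have "\<dots> \<le> 2" by (simp add: card_insert_if)
      finally show "card {x\<in>R. rep (f x) = h} \<le> 2" .
    qed
    finally show ?thesis by simp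
  qed
  moreover have "card T = card H"
  proof -
    have eq: "rep (f x) = rep (f y) \<longleftrightarrow> rep (t (f x)) = rep (t (f y))" if "x \<in> R" "y \<in> R" for x y
    proof -
      have "x \<in> S" "y \<in> S" using that repS by (auto simp: R_def)
      then show ?thesis
        using rep_iff[OF SI SI, OF f f, of x y] rep_iff[OF SI SI, OF t t, of x y]
          t_cong[OF SI SI, OF f f, of x y] by simp
    qed
    \<comment> \<open>The translation \<open>t\<close> is injective on classes, so it carries the
      image \<open>H\<close> bijectively to \<open>T\<close>.\<close>
    define k where "k h = rep (t h)" for h
    have "rep (t (rep (f x))) = rep (t (f x))" if "x \<in> R" for x
    proof -
      have "x \<in> S" using that repS by (auto simp: R_def)
      then have *: "f x \<in> I 0" "rep (f x) \<in> S" "t (f x) \<in> I 0" using repS f t SI by auto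
      have "t (rep (f x)) - t (f x) \<in> I 1" using t_cong[of "rep (f x)" "f x"] * SI rep(2) by blast
      moreover have "t (rep (f x)) \<in> I 0"
        using ideal_add[OF ideal_mono[OF calculation, of 0] *(3)] by simp
      ultimately show ?thesis using rep_iff[of "t (rep (f x))" "t (f x)"] * by simp
    qed
    then have "T = k ` H" by (force simp: T_def H_def k_def image_image)
    moreover have "inj_on k H"
      unfolding inj_on_def H_def k_def
      using eq \<open>\<And>x. x \<in> R \<Longrightarrow> rep (t (rep (f x))) = rep (t (f x))\<close> by simp
    ultimately show ?thesis by (simp add: card_image)
  qed
  moreover have "H \<inter> T = {}"
  proof -
    have "rep (f x) \<noteq> rep (t (f y))" if "x \<in> R" "y \<in> R" for x y
    proof -
      have "x \<in> S" "y \<in> S" using that repS by (auto simp: R_def)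
      then show ?thesis
        using disjoint[of x y] rep_iff[OF SI SI, OF f t, of x y] by simp
    qed
    then show ?thesis by (auto simp: H_def T_def)
  qed
  ultimately have "card R \<le> card (H \<union> T)"
    using HR R by (subst card_Un_disjoint) (auto intro: finite_subset)
  then have "H \<union> T = R" using HR R by (intro card_seteq) auto
  moreover have "rep a \<in> R" using a by (simp add: R_def)
  ultimately obtain x where x: "x \<in> R" "rep a = rep (f x) \<or> rep a = rep (t (f x))"
    by (auto simp: H_def T_def)
  have "x \<in> S" using x repS by (auto simp: R_def)
  then show ?thesis
    using x rep_iff[OF SI SI, OF a f, of x] rep_iff[OF SI SI, OF a t, of x] by blast
qed


section \<open>Climbing the unit filtration\<close>

lemma filtration:
  assumes m: "k \<le> l" "0 \<le> k"
    and P: "\<And>x y. P x \<Longrightarrow> P y \<Longrightarrow> P (x * y)" "P 1"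
    and step: "\<And>m u. k \<le> m \<Longrightarrow> m < l \<Longrightarrow> u \<noteq> 0 \<Longrightarrow> v u = 0 \<Longrightarrow> u - 1 \<in> I m \<Longrightarrow>
      \<exists>n. P n \<and> u - n \<in> I (m + 1)"
    and u: "u \<noteq> 0" "v u = 0" "u - 1 \<in> I k"
  shows "\<exists>n w. P n \<and> n \<noteq> 0 \<and> v n = 0 \<and> u = n * w \<and> w \<noteq> 0 \<and> v w = 0 \<and> w - 1 \<in> I l"
  using m(1) step
proof (induction l rule: int_ge_induct)
  case base
  show ?case using u P(2) by (intro exI[of _ 1] exI[of _ u]) (simp add: val_one)
next
  case (step m)
  from step.IH step.prems obtain n w where
    nw: "P n" "n \<noteq> 0" "v n = 0" "u = n * w" "w \<noteq> 0" "v w = 0" "w - 1 \<in> I m"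
    by fastforce
  obtain n' where n': "P n'" "w - n' \<in> I (m + 1)"
    using step.prems[OF step.hyps _ nw(5-7)] by auto
  have n'0: "n' \<noteq> 0" "v n' = 0"
    using val_close_unit[OF nw(5,6), of n' "m + 1"] n'(2) m(2) step.hyps
    by (auto simp: ideal_diff_commute)
  \<comment> \<open>Dividing by the approximation \<open>n'\<close> moves the cofactor one layer
    closer to \<open>1\<close>, while \<open>n'\<close> is absorbed into the factor satisfying
    \<open>P\<close>.\<close>
  have "w / n' - 1 = (1 / n') * (w - n')" using n'0 by (simp add: field_simps)
  also have "\<dots> \<in> I (m + 1)"
    using n' n'0 by (intro ideal_mult_left) (auto simp: ideal_iff val_divide val_one)
  finally show ?case using nw n' n'0 P(1)
    by (intro exI[of _ "n * n'"] exI[of _ "w / n'"]) (simp add: val_mult val_divide)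
qed

text \<open>In even residue characteristic \<open>x - y\<close> and \<open>x + y\<close> agree
  modulo \<open>I 1\<close>, so squaring is injective on classes, hence surjective.\<close>

lemma residue_square:
  assumes "e \<ge> 1" "a \<in> I 0" shows "\<exists>s\<in>I 0. s\<^sup>2 - a \<in> I 1"
proof -
  have "x - y \<in> I 1" if "x \<in> I 0" "y \<in> I 0" "x\<^sup>2 - y\<^sup>2 \<in> I 1" for x y
  proof -
    have "(x - y) * (x + y) \<in> I 1" using that(3) by (simp add: power2_eq_square algebra_simps)
    then have "x - y \<in> I 1 \<or> x + y \<in> I 1"
      by (rule ideal_one_product[OF _ ideal_diff[OF that(1,2)] ideal_add[OF that(1,2)]])
    moreover have "2 * y \<in> I 1" using that assms(1) ideal_mono[OF that(2)] by (simp add: two_ideal)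
    ultimately show ?thesis using ideal_diff[of "x + y" 1 "2 * y"] by auto
  qed
  moreover have "x\<^sup>2 - y\<^sup>2 \<in> I 1" if "x \<in> I 0" "y \<in> I 0" "x - y \<in> I 1" for x y
  proof -
    have "(x + y) * (x - y) \<in> I 1" by (intro ideal_mult_left ideal_add that)
    then show ?thesis by (simp add: power2_eq_square algebra_simps)
  qed
  moreover have "x\<^sup>2 \<in> I 0" if "x \<in> I 0" for x using ideal_square[OF that] by simp
  ultimately have "\<forall>a\<in>I 0. \<exists>x\<in>I 0. x\<^sup>2 - a \<in> I 1"
    using residue_injective_iff_surjective[of "\<lambda>x. x\<^sup>2"] by blast
  then show ?thesis using assms by blast
qed


text \<open>Scaling by \<open>c * b^2\<close> with \<open>v b = i\<close> reduces the layer to the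
  residue field, where for \<open>e \<ge> 1\<close> every element is a square.\<close>

lemma square_approx:
  assumes e: "e \<ge> 1" and c: "c \<noteq> 0" and x: "x \<in> I (v c + 2 * i)"
  shows "\<exists>s\<in>I i. x - c * s\<^sup>2 \<in> I (v c + 2 * i + 1)"
proof -
  obtain b where b: "b \<noteq> 0" "v b = i" using ex_val by blast
  have "c * b\<^sup>2 * (x / (c * b\<^sup>2)) \<in> I (v c + 2 * i)" using b c x by simp
  then have "x / (c * b\<^sup>2) \<in> I 0"
    using b c by (subst (asm) ideal_mult_iff) (simp_all add: val_mult val_square)
  then obtain s where s: "s \<in> I 0" "s\<^sup>2 - x / (c * b\<^sup>2) \<in> I 1" using residue_square[OF e] by blast
  have "c * b\<^sup>2 * (s\<^sup>2 - x / (c * b\<^sup>2)) \<in> I (v c + 2 * i + 1)"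
    using b c s by (subst ideal_mult_iff) (simp_all add: val_mult val_square)
  also have "c * b\<^sup>2 * (s\<^sup>2 - x / (c * b\<^sup>2)) = - (x - c * (b * s)\<^sup>2)"
    using b c by (simp add: field_simps power_mult_distrib)
  finally have "x - c * (b * s)\<^sup>2 \<in> I (v c + 2 * i + 1)" by (simp only: ideal_minus_iff)
  moreover have "b * s \<in> I i" using b s by (subst ideal_mult_iff) auto
  ultimately show ?thesis by blast
qed

text \<open>In \<open>(1 + s)^2\<close> with \<open>s\<close> of valuation at least
  \<open>m div 2\<close>, the term \<open>2 s\<close> lies one layer deeper because
  \<open>m < 2 e\<close>, so squares fill the even layers.\<close>

lemma even_step:
  assumes "even m" "0 \<le> m" "m < 2 * e" "u - 1 \<in> I m"
  shows "\<exists>z. u - z\<^sup>2 \<in> I (m + 1)"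
proof -
  define i where "i = m div 2"
  have i: "m = 2 * i" using assms by (simp add: i_def)
  obtain s where s: "s \<in> I i" "u - 1 - s\<^sup>2 \<in> I (m + 1)"
    using square_approx[of 1 "u - 1" i] assms by (auto simp: val_one i)
  have "2 * s \<in> I (m + 1)"
    using ideal_mono[OF s(1)] assms by (simp add: two_ideal i)
  from ideal_diff[OF s(2) this] have "u - (1 + s)\<^sup>2 \<in> I (m + 1)"
    by (simp add: power2_eq_square algebra_simps)
  then show ?thesis ..
qed

section \<open>The unramified discriminant\<close>

lemma ex_rho: "\<exists>\<rho>\<in>I 0. \<forall>x\<in>I 0. x\<^sup>2 + x - \<rho> \<notin> I 1"
proof -
  have "x\<^sup>2 + x \<in> I 0" if "x \<in> I 0" for x
    using ideal_add[OF ideal_mono[OF ideal_square[OF that]] that] by simp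
  moreover have "(x\<^sup>2 + x) - (y\<^sup>2 + y) \<in> I 1" if "x \<in> I 0" "y \<in> I 0" "x - y \<in> I 1" for x y
  proof -
    have "(x + y + 1) * (x - y) \<in> I 1" by (intro ideal_mult_left ideal_add that one_in_ideal)
    then show ?thesis by (simp add: power2_eq_square algebra_simps)
  qed
  \<comment> \<open>The incongruent elements \<open>0\<close> and \<open>- 1\<close> have the same
    image, so \<open>x^2 + x\<close> is not injective and therefore not surjective on
    classes.\<close>
  moreover have "0 \<in> I 0" "- 1 \<in> I 0" "0 - (- 1) \<notin> I 1"
    using ideal_minus[OF one_in_ideal] by (simp_all add: ideal_iff val_one)
  moreover have "(0\<^sup>2 + 0) - ((- 1)\<^sup>2 + (- 1)) \<in> I 1" by simp
  ultimately show ?thesis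
    using residue_injective_iff_surjective[of "\<lambda>x. x\<^sup>2 + x"] by blast
qed

text \<open>
  The element \<open>Delta = 1 + 4 rho\<close> is the discriminant of the polynomial \<open>X\<^sup>2 + X - rho\<close>, which is
  irreducible over the residue field, so it generates the unramified quadratic extension; this works
  in every residue characteristic.
\<close>

definition "rho = (SOME \<rho>. \<rho> \<in> I 0 \<and> (\<forall>x\<in>I 0. x\<^sup>2 + x - \<rho> \<notin> I 1))"

definition "Delta = 1 + 4 * rho"

lemma rho: "rho \<in> I 0" "x \<in> I 0 \<Longrightarrow> x\<^sup>2 + x - rho \<notin> I 1"
  using someI_ex[OF ex_rho[unfolded Bex_def]] unfolding rho_def by auto

lemma Delta_unit: "Delta \<noteq> 0" "v Delta = 0"
proof -
  have D0: "Delta \<in> I 0"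
    unfolding Delta_def by (intro ideal_add one_in_ideal ideal_mult_left numeral_in_ideal rho)
  have "Delta \<notin> I 1"
  proof
    assume D: "Delta \<in> I 1"
    show False
    proof (cases "e \<ge> 1")
      case True
      then have "4 * rho \<in> I 1" using ideal_mono[OF rho(1)] by (simp add: four_ideal)
      from ideal_diff[OF D this] show False by (simp add: Delta_def ideal_iff val_one)
    next
      case False
      then have e: "v 2 = 0" "v 4 = 0" using e_nonneg val_four by (auto simp: e_def)
      \<comment> \<open>If \<open>Delta\<close> vanished in the residue field, the polynomial with
        discriminant \<open>Delta\<close> would have the double root \<open>- 1 / 2\<close>, against
        the choice of \<open>rho\<close>.\<close>
      have "4 * ((- 1 / 2)\<^sup>2 + (- 1 / 2) - rho) \<in> I 1"
        using ideal_minus[OF D] by (simp add: Delta_def power2_eq_square algebra_simps)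
      then have "(- 1 / 2)\<^sup>2 + (- 1 / 2) - rho \<in> I 1" using e by (subst (asm) ideal_mult_iff) auto
      moreover have "- 1 / 2 \<in> I 0" using e val_divide[of "-1" 2]
        by (simp add: ideal_iff val_minus val_one)
      ultimately show False using rho by blast
    qed
  qed
  then show "Delta \<noteq> 0" by auto
  with D0 \<open>Delta \<notin> I 1\<close> show "v Delta = 0" by (simp add: ideal_iff)
qed

text \<open>Unless \<open>z\<close> is a unit, one of the two terms dominates. For a unit everything
  depends on how close \<open>z\<close> is to \<open>1\<close> compared with \<open>2\<close>, since
  \<open>z^2 - Delta = (z - 1) (z + 1) - 4 rho\<close>.\<close>

lemma even_val_square_minus_Delta:
  assumes "z\<^sup>2 \<noteq> Delta" shows "even (v (z\<^sup>2 - Delta))"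
proof (cases "z = 0")
  case True
  then show ?thesis using Delta_unit by (simp add: val_minus)
next
  case z: False
  consider "v z < 0" | "v z > 0" | "v z = 0" by linarith
  then show ?thesis
  proof cases
    case 1
    have "v (z\<^sup>2 - Delta) = v (z\<^sup>2)"
      using z 1 Delta_unit by (intro val_close(2)) (auto simp: val_square ideal_iff val_minus)
    then show ?thesis using z by (simp add: val_square)
  next
    case 2
    have "v (z\<^sup>2 - Delta) = v (- Delta)"
      using z 2 Delta_unit by (intro val_close(2)) (auto simp: val_square ideal_iff val_minus)
    then show ?thesis using Delta_unit by (simp add: val_minus)
  next
    case 3
    have eq: "z\<^sup>2 - Delta = (z - 1) * (z + 1) - 4 * rho"
      by (simp add: Delta_def power2_eq_square algebra_simps)
    show ?thesis
    proof (cases "z - 1 \<in> I e")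
      case True
      \<comment> \<open>Here \<open>z = 1 + 2 w\<close>, and by the choice of \<open>rho\<close> the
        value is \<open>4\<close> times a unit, of valuation \<open>2 e\<close>.\<close>
      define w where "w = (z - 1) / 2"
      have w: "w \<in> I 0" using True by (simp add: w_def ideal_divide_iff e_def[symmetric])
      have "z = 1 + 2 * w" by (simp add: w_def field_simps)
      then have eq4: "z\<^sup>2 - Delta = 4 * (w\<^sup>2 + w - rho)"
        by (simp add: Delta_def power2_eq_square algebra_simps)
      have "w\<^sup>2 + w - rho \<in> I 0" using ideal_square[OF w] w rho
        by (intro ideal_diff ideal_add) auto
      moreover have "w\<^sup>2 + w - rho \<noteq> 0" using rho(2)[OF w] by auto
      ultimately have "v (w\<^sup>2 + w - rho) = 0" using rho(2)[OF w] by (simp add: ideal_iff)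
      then show ?thesis using \<open>w\<^sup>2 + w - rho \<noteq> 0\<close> using val_mult[of 4 "w\<^sup>2 + w - rho"] unfolding eq4 by (simp add: val_four del: right_diff_distrib_numeral distrib_left_numeral)
    next
      case False
      \<comment> \<open>Here \<open>z - 1\<close> and \<open>z + 1\<close> differ by
        \<open>2\<close>, which has larger valuation; their product has even valuation below
        \<open>2 e\<close> and dominates \<open>4 rho\<close>.\<close>
      then have z1: "z - 1 \<noteq> 0" "v (z - 1) < e" by (auto simp: frac_ideal_def)
      have "v (z + 1) = v (z - 1) \<and> z + 1 \<noteq> 0"
        using val_close[of "z - 1" "z + 1"] z1 by (simp add: ideal_iff e_def)
      then have zz: "(z - 1) * (z + 1) \<noteq> 0" "v ((z - 1) * (z + 1)) = 2 * v (z - 1)"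
        using z1 by (auto simp: val_mult)
      have "4 * rho \<in> I (2 * v (z - 1) + 1)"
        using z1 ideal_mono[OF rho(1)] by (simp add: four_ideal)
      then have "v (z\<^sup>2 - Delta) = v ((z - 1) * (z + 1))"
        unfolding eq using zz by (intro val_close(2)) (auto simp: ideal_minus_iff)
      then show ?thesis using zz by simp
    qed
  qed
qed

lemma hil_Delta_even:
  assumes "hil Delta b" "b \<noteq> 0" shows "even (v b)"
proof -
  obtain x y where b: "b = x\<^sup>2 - Delta * y\<^sup>2" using assms unfolding hil_def by blast
  show ?thesis
  proof (cases "y = 0")
    case True
    then show ?thesis using b assms(2) by (auto simp: val_square)
  next
    case False
    have eq: "b = ((x / y)\<^sup>2 - Delta) * y\<^sup>2"
      using False by (simp add: b field_simps power_divide)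
    then have "(x / y)\<^sup>2 \<noteq> Delta" using assms(2) by auto
    then show ?thesis
      using even_val_square_minus_Delta[of "x / y"] False by (simp add: eq val_mult val_square)
  qed
qed

text \<open>Modulo \<open>2\<close> the map \<open>x^2 + x\<close> is additive with kernel
  \<open>0, - 1\<close>, so its image has index two in the residue field, and \<open>rho\<close>
  represents the other coset.\<close>

lemma artin_schreier_half:
  assumes e: "e \<ge> 1" and a: "a \<in> I 0"
  shows "\<exists>x\<in>I 0. a - (x\<^sup>2 + x) \<in> I 1 \<or> a - (rho + (x\<^sup>2 + x)) \<in> I 1"
proof (rule residue_two_to_one[where S = "I 0" and f = "\<lambda>x. x\<^sup>2 + x" and
      t = "\<lambda>x. rho + x" and g = "\<lambda>x. - 1 - x"])
  show "- 1 - x \<in> I 0" if "x \<in> I 0" for x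
    using that ideal_minus[OF one_in_ideal] by (intro ideal_diff)
  show *: "x\<^sup>2 + x \<in> I 0" if "x \<in> I 0" for x
    using ideal_square[OF that] that by (intro ideal_add) auto
  show "rho + (x\<^sup>2 + x) \<in> I 0" if "x \<in> I 0" for x
    by (intro ideal_add[of rho] rho * that)
  show "x - y \<in> I 1 \<or> x - (- 1 - y) \<in> I 1"
    if "x \<in> I 0" "y \<in> I 0" "x\<^sup>2 + x - (y\<^sup>2 + y) \<in> I 1" for x y
  proof (rule ideal_one_product)
    show "(x - y) * (x - (- 1 - y)) \<in> I 1"
      using that(3) by (simp add: power2_eq_square algebra_simps)
    show "x - (- 1 - y) \<in> I 0" using ideal_add[OF ideal_add[OF that(1,2)] one_in_ideal]
      by (simp add: algebra_simps)
  qed (intro ideal_diff that)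
  show "x\<^sup>2 + x - (rho + (y\<^sup>2 + y)) \<notin> I 1" if "x \<in> I 0" "y \<in> I 0" for x y
  proof
    assume A: "x\<^sup>2 + x - (rho + (y\<^sup>2 + y)) \<in> I 1"
    \<comment> \<open>This multiple of \<open>2\<close> turns \<open>x^2 - y^2\<close> into
      \<open>(x - y)^2\<close>, so that a collision would make \<open>rho\<close> an Artin-Schreier
      value.\<close>
    have "2 * (y * y - x * y) \<in> I 1"
      unfolding two_ideal
      by (rule ideal_mono[OF ideal_diff[OF ideal_mult_left[OF that(2,2)] ideal_mult_left[OF that]]])
        (use e in simp)
    from ideal_add[OF A this] have "(x - y)\<^sup>2 + (x - y) - rho \<in> I 1"
      by (simp add: power2_eq_square algebra_simps)
    then show False using rho ideal_diff[OF that] by blast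
  qed
qed (use a in auto)

text \<open>Squaring on residue units has fibres \<open>x, - x\<close>, so squares have index at
  most two and the nonsquare \<open>t\<close> represents the other coset.\<close>

lemma residue_unit_square_half:
  assumes e: "e = 0" and u: "u \<noteq> 0" "v u = 0"
    and t: "t \<noteq> 0" "v t = 0" "\<And>z. z \<noteq> 0 \<Longrightarrow> v z = 0 \<Longrightarrow> t - z\<^sup>2 \<notin> I 1"
  shows "\<exists>x. x \<noteq> 0 \<and> v x = 0 \<and> (u - x\<^sup>2 \<in> I 1 \<or> u - t * x\<^sup>2 \<in> I 1)"
proof -
  define S where "S = {x. x \<noteq> 0 \<and> v x = 0}"
  have SI: "x \<in> I 0" if "x \<in> S" for x using that by (simp add: S_def frac_ideal_def)
  have "\<exists>x\<in>S. u - x\<^sup>2 \<in> I 1 \<or> u - t * x\<^sup>2 \<in> I 1"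
  proof (rule residue_two_to_one[where S = S and f = "\<lambda>x. x\<^sup>2" and t = "\<lambda>x. t * x" and g = uminus])
    show "y \<in> S" if "x \<in> S" "y \<in> I 0" "x - y \<in> I 1" for x y
      using val_close_unit[of x y 1] that by (simp add: S_def ideal_diff_commute)
    show "x\<^sup>2 \<in> S" "t * x\<^sup>2 \<in> S" "- x \<in> S" if "x \<in> S" for x
      using that t by (auto simp: S_def val_square val_mult val_minus)
    show "t * x - t * y \<in> I 1 \<longleftrightarrow> x - y \<in> I 1" for x y
      using t ideal_mult_iff[of t "x - y" 1] by (simp add: right_diff_distrib)
    show "x - y \<in> I 1 \<or> x - - y \<in> I 1" if "x \<in> S" "y \<in> S" "x\<^sup>2 - y\<^sup>2 \<in> I 1" for x y
    proof (rule ideal_one_product)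
      show "(x - y) * (x - - y) \<in> I 1" using that(3) by (simp add: power2_eq_square algebra_simps)
      show "x - y \<in> I 0" "x - - y \<in> I 0" using ideal_diff ideal_add SI that by simp_all
    qed
    show "x\<^sup>2 - t * y\<^sup>2 \<notin> I 1" if "x \<in> S" "y \<in> S" for x y
    proof
      assume A: "x\<^sup>2 - t * y\<^sup>2 \<in> I 1"
      have y: "y \<noteq> 0" "v (y\<^sup>2) = 0" using that by (auto simp: S_def val_square)
      have "(x / y)\<^sup>2 - t = (x\<^sup>2 - t * y\<^sup>2) / y\<^sup>2" using y by (simp add: power_divide diff_divide_distrib)
      also have "\<dots> \<in> I 1" using A y by (subst ideal_divide_iff) auto
      finally have "(x / y)\<^sup>2 - t \<in> I 1" .
      moreover have "x / y \<noteq> 0" "v (x / y) = 0" using that by (auto simp: S_def val_divide)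
      ultimately show False using t(3)[of "x / y"] by (simp add: ideal_diff_commute)
    qed
  qed (use SI u in \<open>auto simp: S_def\<close>)
  then show ?thesis by (auto simp: S_def)
qed

text \<open>With \<open>z = 1 + 2 x\<close> and \<open>2\<close> a unit, a square congruent to
  \<open>Delta\<close> would make \<open>x^2 + x\<close> congruent to \<open>rho\<close>.\<close>

lemma Delta_not_residue_square:
  assumes "e = 0" "z \<noteq> 0" "v z = 0" shows "Delta - z\<^sup>2 \<notin> I 1"
proof
  assume "Delta - z\<^sup>2 \<in> I 1"
  define x where "x = (z - 1) / 2"
  have e: "v 2 = 0" "v 4 = 0" using assms val_four by (auto simp: e_def)
  have "z - 1 \<in> I 0" using assms by (intro ideal_diff one_in_ideal) (simp add: ideal_iff)
  then have x: "x \<in> I 0" using e by (simp add: x_def ideal_divide_iff)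
  have "z = 1 + 2 * x" by (simp add: x_def field_simps)
  then have "x\<^sup>2 + x - rho = (z\<^sup>2 - Delta) / 4"
    by (simp add: Delta_def power2_eq_square algebra_simps)
  also have "\<dots> \<in> I 1"
    using \<open>Delta - z\<^sup>2 \<in> I 1\<close> e by (simp add: ideal_divide_iff ideal_diff_commute)
  finally have "x\<^sup>2 + x - rho \<in> I 1" .
  then show False using rho(2)[OF x] by simp
qed

lemma square_of_close:
  assumes "z \<noteq> 0" "v z = 0" "u - c * z\<^sup>2 \<in> I (2 * e + 1)" "c \<noteq> 0" "v c = 0"
  shows "\<exists>y. u = c * y\<^sup>2"
proof -
  have "u / (c * z\<^sup>2) - 1 = 1 / (c * z\<^sup>2) * (u - c * z\<^sup>2)"
    using assms by (simp add: field_simps)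
  also have "\<dots> \<in> I (2 * e + 1)" using assms
    by (intro ideal_mult_left) (simp_all add: ideal_iff val_divide val_mult val_square val_one)
  finally obtain y where "u / (c * z\<^sup>2) = y\<^sup>2" using local_square by blast
  then have "u = c * (y * z)\<^sup>2" using assms by (simp add: field_simps power_mult_distrib)
  then show ?thesis ..
qed

text \<open>The last layer not covered by \<open>local_square\<close>. Squares account for half of
  it: through residue squares if \<open>e = 0\<close>, and through Artin-Schreier values of
  \<open>(u - 1) / 4\<close> otherwise.\<close>

lemma square_or_Delta:
  assumes "u \<noteq> 0" "v u = 0" "u - 1 \<in> I (2 * e)"
  shows "\<exists>y. u = y\<^sup>2 \<or> u = Delta * y\<^sup>2"
proof (cases "e = 0")
  case True
  obtain x where x: "x \<noteq> 0" "v x = 0" "u - x\<^sup>2 \<in> I 1 \<or> u - Delta * x\<^sup>2 \<in> I 1"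
    using residue_unit_square_half[OF True assms(1,2) Delta_unit Delta_not_residue_square[OF True]]
    by blast
  then show ?thesis
    using square_of_close[of x u 1] square_of_close[of x u Delta] True Delta_unit
    by (auto simp: val_one)
next
  case False
  then have e: "e \<ge> 1" using e_nonneg by simp
  define a where "a = (u - 1) / 4"
  have "a \<in> I 0" using assms(3) by (simp add: a_def ideal_divide_iff val_four)
  then obtain x where x: "x \<in> I 0" "a - (x\<^sup>2 + x) \<in> I 1 \<or> a - (rho + (x\<^sup>2 + x)) \<in> I 1"
    using artin_schreier_half[OF e] by blast
  have u: "u = 1 + 4 * a" by (simp add: a_def field_simps)
  have "2 * x \<in> I 1" using ideal_mono[OF x(1)] e by (simp add: two_ideal)
  then have z: "1 + 2 * x \<noteq> 0" "v (1 + 2 * x) = 0" using close_one[of "1 + 2 * x" 1] by auto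
  from x(2) show ?thesis
  proof
    assume "a - (x\<^sup>2 + x) \<in> I 1"
    then have "4 * (a - (x\<^sup>2 + x)) \<in> I (2 * e + 1)" unfolding four_ideal by simp
    also have "4 * (a - (x\<^sup>2 + x)) = u - 1 * (1 + 2 * x)\<^sup>2"
      by (simp add: u power2_eq_square algebra_simps)
    finally show ?thesis using square_of_close[OF z, of u 1] by (auto simp: val_one)
  next
    assume A: "a - (rho + (x\<^sup>2 + x)) \<in> I 1"
    \<comment> \<open>Cross term of \<open>Delta * (1 + 2 * x)^2\<close>, negligible because
      \<open>e \<ge> 1\<close>.\<close>
    have "4 * (rho * (x\<^sup>2 + x)) \<in> I 1"
      using ideal_mono[OF ideal_mult_left[OF rho(1) ideal_add[OF ideal_mono[OF ideal_square[OF x(1)]] x(1)]]] e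
      by (simp add: four_ideal)
    from ideal_diff[OF A this]
    have "4 * (a - (rho + (x\<^sup>2 + x)) - 4 * (rho * (x\<^sup>2 + x))) \<in> I (2 * e + 1)"
      unfolding four_ideal by simp
    also have "4 * (a - (rho + (x\<^sup>2 + x)) - 4 * (rho * (x\<^sup>2 + x))) = u - Delta * (1 + 2 * x)\<^sup>2"
      by (simp add: u Delta_def power2_eq_square algebra_simps)
    finally show ?thesis using square_of_close[OF z, of u Delta] Delta_unit by auto
  qed
qed


section \<open>The norm index of a quadratic extension\<close>

lemma unit_quotient:
  assumes "n \<noteq> 0" "v n = 0" "u \<noteq> 0" "v u = 0" "u - n \<in> I k"
  shows "\<exists>w. u = n * w \<and> w \<noteq> 0 \<and> v w = 0 \<and> w - 1 \<in> I k"
proof (intro exI conjI)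
  have "u / n - 1 = (u - n) / n" using assms by (simp add: field_simps)
  also have "\<dots> \<in> I k" using assms by (simp add: ideal_divide_iff)
  finally show "u / n - 1 \<in> I k" .
qed (use assms in \<open>auto simp: val_divide\<close>)

text \<open>In a ramified extension some norm has odd valuation; together with squares it reduces
  every element to a unit modulo norms.\<close>

lemma index_from_units:
  assumes b: "hil a b" "b \<noteq> 0" "odd (v b)"
    and units: "\<And>u. u \<noteq> 0 \<Longrightarrow> v u = 0 \<Longrightarrow> hil a u \<or> hil a (u * c)"
    and x: "x \<noteq> 0"
  shows "hil a x \<or> hil a (x * c)"
proof -
  have even: "hil a x \<or> hil a (x * c)" if x: "x \<noteq> 0" "even (v x)" for x
  proof -
    obtain p where p: "p \<noteq> 0" "v p = v x div 2" using ex_val by blast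
    define u where "u = x / p\<^sup>2"
    have u: "u \<noteq> 0" "v u = 0" using p x by (auto simp: u_def val_divide val_square)
    have "x = u * p\<^sup>2" "x * c = u * c * p\<^sup>2" using p by (auto simp: u_def)
    then show ?thesis using units[OF u] by (simp only: hil_mult_square[OF p(1)])
  qed
  show ?thesis
  proof (cases "even (v x)")
    case False
    then have "hil a (b * x) \<or> hil a (b * x * c)" using even[of "b * x"] b x by (simp add: val_mult)
    then show ?thesis using b by (simp add: hil_mult_iff mult.assoc)
  qed (use even x in blast)
qed

text \<open>Below layer \<open>2 e\<close>, squares fill the even layers and
  \<open>1 - d s^2\<close> the odd ones; at layer \<open>2 e\<close> only the factor
  \<open>Delta\<close> can be left.\<close>

lemma unit_norm_odd:
  assumes d: "d \<noteq> 0" "odd (v d)" and u: "u \<noteq> 0" "v u = 0"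
  shows "hil d u \<or> hil d (u * Delta)"
proof -
  have "\<exists>n w. hil d n \<and> n \<noteq> 0 \<and> v n = 0 \<and> u = n * w \<and> w \<noteq> 0 \<and> v w = 0 \<and> w - 1 \<in> I (2 * e)"
  proof (rule filtration[where k = 0])
    fix m u assume m: "0 \<le> m" "m < 2 * e" and um: "u - 1 \<in> I m"
    show "\<exists>n. hil d n \<and> u - n \<in> I (m + 1)"
    proof (cases "even m")
      case True
      then show ?thesis using even_step[OF True m um] hil_square by blast
    next
      case False
      \<comment> \<open>The division is exact because \<open>m\<close> and \<open>v d\<close> are
        both odd; \<open>i\<close> may be negative, since only \<open>d s^2\<close> has to be
        integral.\<close>
      define i where "i = (m - v d) div 2"
      have i: "m = v (- d) + 2 * i" using False d by (simp add: i_def val_minus)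
      obtain s where "u - 1 - (- d) * s\<^sup>2 \<in> I (m + 1)"
        using square_approx[of "- d" "u - 1" i] m d um unfolding i[symmetric] by auto
      then have "u - (1\<^sup>2 - d * s\<^sup>2) \<in> I (m + 1)" by (simp add: algebra_simps)
      then show ?thesis using hilI by blast
    qed
  qed (use e_nonneg u in \<open>auto simp: hil_mult hil_one ideal_iff intro: ideal_diff one_in_ideal\<close>)
  then obtain n w where n: "hil d n" "n \<noteq> 0" "u = n * w"
    and w: "w \<noteq> 0" "v w = 0" "w - 1 \<in> I (2 * e)" by blast
  obtain y where "w = y\<^sup>2 \<or> w = Delta * y\<^sup>2" using square_or_Delta[OF w] by blast
  then have "hil d w \<or> hil d (w * Delta)"
    using hil_square[of d y] hil_square[of d "Delta * y"]
    by (auto simp: power_mult_distrib power2_eq_square mult_ac)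
  then show ?thesis using n by (simp add: hil_mult_iff mult.assoc)
qed

text \<open>The required norm of odd valuation is \<open>- d\<close>.\<close>

lemma index_odd:
  assumes "d \<noteq> 0" "odd (v d)" "x \<noteq> 0"
  shows "hil d x \<or> hil d (x * Delta)"
  by (rule index_from_units[OF hil_neg]) (use assms unit_norm_odd in \<open>auto simp: val_minus\<close>)

text \<open>
  If \<open>0 < v a < 2 e\<close> is odd, adjoining a square root of \<open>1 + a\<close> gives a ramified extension with
  ramification break \<open>2 e - v a\<close>: the norms \<open>(1 - s)\<^sup>2 - (1 + a) s\<^sup>2 = 1 - 2 s - a s\<^sup>2\<close> fill each
  layer of the unit filtration, through the term \<open>a s\<^sup>2\<close> (or through squares) below the break and
  through \<open>2 s\<close> above it; at the break only half of the layer is reached.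
\<close>

lemma ramified_step:
  assumes a: "a \<noteq> 0" "odd (v a)" "v a < 2 * e" "0 < v a"
    and m: "0 \<le> m" "m < 2 * e - v a" and u: "u - 1 \<in> I m"
  shows "\<exists>n. hil (1 + a) n \<and> u - n \<in> I (m + 1)"
proof (cases "even m")
  case True
  then obtain z where "u - z\<^sup>2 \<in> I (m + 1)"
    using even_step[of m u] m u a by auto
  then show ?thesis using hil_square by blast
next
  case False
  define i where "i = (m - v a) div 2"
  have i: "m = v (- a) + 2 * i" using False a by (simp add: i_def val_minus)
  have e: "e \<ge> 1" using a by simp
  obtain s where s: "s \<in> I i" "u - 1 - (- a) * s\<^sup>2 \<in> I (m + 1)"
    using square_approx[of "- a" "u - 1" i] e a u unfolding i[symmetric] by auto
  \<comment> \<open>The layer lies before the break: \<open>i + v a < e\<close>, so the linear term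
    \<open>2 s\<close> is deeper than \<open>a s^2\<close>.\<close>
  have "i + e \<ge> m + 1" using i m by (simp add: val_minus)
  then have "2 * s \<in> I (m + 1)" unfolding two_ideal using ideal_mono[OF s(1)] by simp
  from ideal_add[OF s(2) this] have "u - ((1 - s)\<^sup>2 - (1 + a) * s\<^sup>2) \<in> I (m + 1)"
    by (simp add: power2_eq_square algebra_simps)
  then show ?thesis using hilI by blast
qed

text \<open>At the break the terms \<open>2 y\<close> and \<open>a y^2\<close> of the norm
  \<open>1 - 2 y - a y^2\<close> are of the same order. After the scaling
  \<open>y = (2 / a) s\<close> they add up to \<open>(4 / a) (s + s^2)\<close>, so only the
  Artin-Schreier half of the layer is reached.\<close>

lemma ramified_break:
  assumes a: "a \<noteq> 0" "odd (v a)" "v a < 2 * e" "0 < v a"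
    and u: "u - 1 \<in> I (2 * e - v a)"
  shows "\<exists>n. hil (1 + a) n \<and>
    (u - n \<in> I (2 * e - v a + 1) \<or> u - n * (1 - 4 / a * rho) \<in> I (2 * e - v a + 1))"
proof -
  define t where "t = 2 * e - v a"
  define f where "f = 4 / a"
  have f: "f \<noteq> 0" "v f = t" using a by (auto simp: f_def t_def val_divide val_four)
  have e: "e \<ge> 1" using a by simp
  define b where "b = (1 - u) / f"
  have ub: "u = 1 - f * b" using f by (simp add: b_def)
  have "b \<in> I 0" using u f by (simp add: b_def ideal_divide_iff t_def ideal_diff_commute)
  then obtain s where s: "s \<in> I 0" "b - (s\<^sup>2 + s) \<in> I 1 \<or> b - (rho + (s\<^sup>2 + s)) \<in> I 1"
    using artin_schreier_half[OF e] by blast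
  define n where "n = 1 - f * (s\<^sup>2 + s)"
  have af: "a * f = 4" using a by (simp add: f_def)
  have "n = (1 - f * s / 2)\<^sup>2 - (1 + a) * (f * s / 2)\<^sup>2"
  proof -
    have "(1 - f * s / 2)\<^sup>2 - (1 + a) * (f * s / 2)\<^sup>2 = 1 - f * s - (a * f) * f * s\<^sup>2 / 4"
      by (simp add: power2_eq_square algebra_simps)
    also have "\<dots> = n" by (simp add: af n_def algebra_simps)
    finally show ?thesis ..
  qed
  then have n: "hil (1 + a) n" by (rule hilI)
  have ft: "f * x \<in> I (t + 1) \<longleftrightarrow> x \<in> I 1" for x using f by (simp add: ideal_mult_iff)
  have "u - n \<in> I (t + 1) \<or> u - n * (1 - f * rho) \<in> I (t + 1)"
    using s(2)
  proof
    assume "b - (s\<^sup>2 + s) \<in> I 1"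
    then have "f * (- (b - (s\<^sup>2 + s))) \<in> I (t + 1)" using ft ideal_minus by blast
    then show ?thesis by (simp add: ub n_def algebra_simps)
  next
    assume A: "b - (rho + (s\<^sup>2 + s)) \<in> I 1"
    \<comment> \<open>Positive valuation of \<open>f\<close> makes the term with \<open>f^2\<close>
      in \<open>n * (1 - f * rho)\<close> negligible.\<close>
    have "f \<in> I 1" using f a by (simp add: ideal_iff t_def)
    moreover have "rho * (s\<^sup>2 + s) \<in> I 0"
      using ideal_mult_left[OF rho(1) ideal_add[OF _ s(1)]] ideal_square[OF s(1)] by simp
    ultimately have "rho * (s\<^sup>2 + s) * f \<in> I 1" by (rule ideal_mult_left[rotated])
    from ideal_minus[OF ideal_add[OF A this]] ft
    have "f * (- (b - (rho + (s\<^sup>2 + s)) + rho * (s\<^sup>2 + s) * f)) \<in> I (t + 1)" by blast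
    then show ?thesis by (simp add: ub n_def algebra_simps)
  qed
  then show ?thesis using n by (auto simp: t_def f_def)
qed

text \<open>Beyond the break the linear term suffices: with \<open>y = (1 - u) / 2\<close> the norm
  \<open>1 - 2 y - a y^2\<close> misses \<open>u\<close> by exactly \<open>a y^2\<close>, which lies
  a layer deeper. From \<open>2 e + 1\<close> on, \<open>local_square\<close> takes over.\<close>

lemma ramified_deep:
  assumes a: "a \<noteq> 0" "v a < 2 * e" "0 < v a"
    and u: "u \<noteq> 0" "v u = 0" "u - 1 \<in> I (2 * e - v a + 1)"
  shows "hil (1 + a) u"
proof -
  have "\<exists>n w. hil (1 + a) n \<and> n \<noteq> 0 \<and> v n = 0 \<and> u = n * w \<and> w \<noteq> 0 \<and> v w = 0 \<and> w - 1 \<in> I (2 * e + 1)"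
  proof (rule filtration[where k = "2 * e - v a + 1"])
    fix m u assume m: "2 * e - v a + 1 \<le> m" "m < 2 * e + 1" and um: "u - 1 \<in> I m"
    define y where "y = (1 - u) / 2"
    have "y \<in> I (m - e)" using um
      by (simp add: y_def ideal_divide_iff e_def[symmetric] ideal_diff_commute)
    from ideal_mult[OF _ ideal_square[OF this], of a "v a"]
    have "a * y\<^sup>2 \<in> I (v a + 2 * (m - e))" using a by (simp add: ideal_iff)
    then have "a * y\<^sup>2 \<in> I (m + 1)" by (rule ideal_mono) (use m in simp)
    also have "a * y\<^sup>2 = u - ((1 - y)\<^sup>2 - (1 + a) * y\<^sup>2)"
      unfolding y_def by (simp add: power2_eq_square field_simps)
    finally show "\<exists>n. hil (1 + a) n \<and> u - n \<in> I (m + 1)" using hilI by blast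
  qed (use a u in \<open>auto simp: hil_mult hil_one\<close>)
  then obtain n w where "hil (1 + a) n" "u = n * w" "w - 1 \<in> I (2 * e + 1)" by blast
  then show ?thesis using local_square[of w] hil_mult[OF _ hil_square] by auto
qed

text \<open>The break is the only layer at which a factor, namely \<open>1 - 4 / a * rho\<close>,
  may be left over; below and above it norms fill everything.\<close>

lemma unit_norm_ramified:
  assumes a: "a \<noteq> 0" "odd (v a)" "v a < 2 * e" "0 < v a" and u: "u \<noteq> 0" "v u = 0"
  shows "hil (1 + a) u \<or> hil (1 + a) (u * (1 - 4 / a * rho))"
proof -
  define t where "t = 2 * e - v a"
  define g where "g = 1 - 4 / a * rho"
  have "4 / a \<in> I 1" using a by (simp add: ideal_iff val_divide val_four)
  from ideal_minus[OF ideal_mult_left[OF rho(1) this]]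
  have g: "g \<noteq> 0" "v g = 0" using close_one[of g 1] by (auto simp: g_def mult.commute)
  have "\<exists>n w. hil (1 + a) n \<and> n \<noteq> 0 \<and> v n = 0 \<and> u = n * w \<and> w \<noteq> 0 \<and> v w = 0 \<and> w - 1 \<in> I t"
    by (rule filtration[where k = 0])
      (use a u ramified_step[OF a] in \<open>auto simp: t_def hil_mult hil_one ideal_iff intro: ideal_diff one_in_ideal\<close>)
  then obtain n w where n: "hil (1 + a) n" "n \<noteq> 0" "u = n * w"
    and w: "w \<noteq> 0" "v w = 0" "w - 1 \<in> I t" by blast
  obtain n' where n': "hil (1 + a) n'" "w - n' \<in> I (t + 1) \<or> w - n' * g \<in> I (t + 1)"
    using ramified_break[OF a w(3)[unfolded t_def]] by (auto simp: t_def g_def)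
  have t1: "t + 1 \<ge> 1" using a by (simp add: t_def)
  have "hil (1 + a) w \<or> hil (1 + a) (w * g)"
    using n'(2)
  proof
    assume A: "w - n' \<in> I (t + 1)"
    then have "n' \<noteq> 0" "v n' = 0"
      using val_close_unit[OF w(1,2) _ t1, of n'] by (auto simp: ideal_diff_commute)
    from unit_quotient[OF this w(1,2) A] obtain w' where
      "w = n' * w'" "w' \<noteq> 0" "v w' = 0" "w' - 1 \<in> I (t + 1)" by blast
    then show ?thesis
      using ramified_deep[OF a(1,3,4), of w'] hil_mult[OF n'(1)] by (simp add: t_def)
  next
    assume A: "w - n' * g \<in> I (t + 1)"
    then have *: "n' * g \<noteq> 0" "v (n' * g) = 0"
      using val_close_unit[OF w(1,2) _ t1, of "n' * g"] by (auto simp: ideal_diff_commute)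
    then obtain w' where w': "w = n' * g * w'" "w' \<noteq> 0" "v w' = 0" "w' - 1 \<in> I (t + 1)"
      using unit_quotient[OF _ _ w(1,2) A] by blast
    then have "hil (1 + a) w'" using ramified_deep[OF a(1,3,4)] by (simp add: t_def)
    \<comment> \<open>The factor \<open>g\<close> occurs twice in \<open>w * g\<close>, hence as a
      square.\<close>
    then have "hil (1 + a) (n' * w' * g\<^sup>2)" using n'(1) by (intro hil_mult hil_square)
    then show ?thesis by (simp add: w'(1) power2_eq_square mult_ac)
  qed
  then show ?thesis using n by (simp add: hil_mult_iff mult.assoc g_def)
qed

text \<open>The norm \<open>- a = 1 - (1 + a)\<close> has odd valuation, which reduces the claim to
  units.\<close>

lemma index_ramified:
  assumes a: "a \<noteq> 0" "odd (v a)" "v a < 2 * e" "0 < v a"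
  shows "\<exists>c. c \<noteq> 0 \<and> (\<forall>x. x \<noteq> 0 \<longrightarrow> hil (1 + a) x \<or> hil (1 + a) (x * c))"
proof (intro exI conjI allI impI)
  have "4 / a \<in> I 1" using a by (simp add: ideal_iff val_divide val_four)
  from ideal_minus[OF ideal_mult_left[OF rho(1) this]]
  show "1 - 4 / a * rho \<noteq> 0" using close_one[of "1 - 4 / a * rho" 1] by (auto simp: mult.commute)
  fix x :: 'a assume "x \<noteq> 0"
  show "hil (1 + a) x \<or> hil (1 + a) (x * (1 - 4 / a * rho))"
  proof (rule index_from_units)
    show "hil (1 + a) (- a)" by (rule hilI[of _ 1 _ 1]) simp
  qed (use a \<open>x \<noteq> 0\<close> unit_norm_ramified in \<open>auto simp: val_minus\<close>)
qed

text \<open>Pigeonhole: otherwise the residue squares and their images under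
  \<open>x \<mapsto> - 1 - x\<close> would be disjoint and cover all classes. The fixed point
  \<open>- 1 / 2\<close> would then be a square in either case, and \<open>x^2 = - 1 / 2\<close>
  gives \<open>x^2 + x^2 + 1 = 0\<close>.\<close>

lemma residue_minus_one_sum_squares:
  assumes e: "e = 0"
  shows "\<exists>x\<in>I 0. \<exists>y\<in>I 0. x\<^sup>2 + y\<^sup>2 + 1 \<in> I 1"
proof (rule ccontr)
  assume neg: "\<not> ?thesis"
  have v2: "v 2 = 0" using e by (simp add: e_def)
  have "\<exists>x\<in>I 0. - 1 / 2 - x\<^sup>2 \<in> I 1 \<or> - 1 / 2 - (- 1 - x\<^sup>2) \<in> I 1"
  proof (rule residue_two_to_one[where S = "I 0" and f = "\<lambda>x. x\<^sup>2" and t = "\<lambda>x. - 1 - x" and g = uminus])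
    show *: "x\<^sup>2 \<in> I 0" "- x \<in> I 0" if "x \<in> I 0" for x
      using ideal_square[OF that] ideal_minus[OF that] by auto
    show "- 1 - x\<^sup>2 \<in> I 0" if "x \<in> I 0" for x
      by (intro ideal_diff ideal_minus one_in_ideal * that)
    show "- 1 - x - (- 1 - y) \<in> I 1 \<longleftrightarrow> x - y \<in> I 1" for x y
      using ideal_diff_commute[of x y] by simp
    show "x - y \<in> I 1 \<or> x - - y \<in> I 1" if "x \<in> I 0" "y \<in> I 0" "x\<^sup>2 - y\<^sup>2 \<in> I 1" for x y
    proof (rule ideal_one_product)
      show "(x - y) * (x - - y) \<in> I 1" using that(3) by (simp add: power2_eq_square algebra_simps)
      show "x - y \<in> I 0" "x - - y \<in> I 0" using ideal_diff ideal_add that by simp_all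
    qed
    show "x\<^sup>2 - (- 1 - y\<^sup>2) \<notin> I 1" if "x \<in> I 0" "y \<in> I 0" for x y
      using neg that by (auto simp: algebra_simps)
    show "- 1 / 2 \<in> I 0" using ideal_minus[OF one_in_ideal] v2 by (subst ideal_divide_iff) auto
  qed auto
  then obtain x where x: "x \<in> I 0" "- 1 / 2 - x\<^sup>2 \<in> I 1 \<or> - 1 / 2 - (- 1 - x\<^sup>2) \<in> I 1" by blast
  from x(2) have "- 1 / 2 - x\<^sup>2 \<in> I 1"
  proof
    assume "- 1 / 2 - (- 1 - x\<^sup>2) \<in> I 1"
    from ideal_minus[OF this] have "- (- 1 / 2 - (- 1 - x\<^sup>2)) \<in> I 1" .
    also have "- (- 1 / 2 - (- 1 - x\<^sup>2)) = - 1 / 2 - x\<^sup>2" by simp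
    finally show ?thesis .
  qed
  from ideal_minus[OF ideal_add[OF this this]] have "x\<^sup>2 + x\<^sup>2 + 1 \<in> I 1"
    by (simp add: algebra_simps)
  then show False using neg x(1) by blast
qed

text \<open>If \<open>- 1\<close> is not a square, it lies in the class of \<open>Delta\<close>, so
  it suffices that \<open>x^2 + w^2\<close> represents \<open>- 1\<close>; such a representation
  lifts from the residue field.\<close>

lemma hil_Delta_minus_one:
  assumes e: "e = 0" shows "hil Delta (- 1)"
proof -
  have "- 1 - 1 \<in> I (2 * e)" using e ideal_diff[OF ideal_minus[OF one_in_ideal] one_in_ideal] by simp
  then obtain y where y: "- 1 = y\<^sup>2 \<or> - 1 = Delta * y\<^sup>2"
    using square_or_Delta[of "- 1"] by (auto simp: val_minus val_one)
  show ?thesis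
  proof (cases "\<exists>y. - 1 = (y :: 'a)\<^sup>2")
    case True
    then obtain y :: 'a where "- 1 = y\<^sup>2" ..
    then show ?thesis using hil_square[of Delta y] by simp
  next
    case False
    then have y: "- 1 = Delta * y\<^sup>2" using y by blast
    then have y0: "y \<noteq> 0" by auto
    obtain a b where ab: "a \<in> I 0" "b \<in> I 0" "a\<^sup>2 + b\<^sup>2 + 1 \<in> I 1"
      using residue_minus_one_sum_squares[OF e] by blast
    have unit: "x \<noteq> 0 \<and> v x = 0" if "x \<in> I 0" "x \<notin> I 1" for x
      using that by (auto simp: frac_ideal_def)
    \<comment> \<open>Lifting a square root requires a unit, and \<open>a\<close> and
      \<open>b\<close> cannot both be nonunits.\<close>
    have "a \<notin> I 1 \<or> b \<notin> I 1"
    proof (rule ccontr)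
      assume "\<not> ?thesis"
      then have "a * a \<in> I 1" "b * b \<in> I 1" using ideal_mult_left ab(1,2) by blast+
      then have "a\<^sup>2 + b\<^sup>2 \<in> I 1" unfolding power2_eq_square by (rule ideal_add)
      from ideal_diff[OF ab(3) this] show False by (simp add: ideal_iff val_one)
    qed
    then obtain x z where xz: "z \<noteq> 0" "v z = 0" "x\<^sup>2 + z\<^sup>2 + 1 \<in> I 1"
    proof
      assume "a \<notin> I 1"
      then show ?thesis using that[of a b] unit[OF ab(1)] ab(3) by (simp add: add.commute)
    next
      assume "b \<notin> I 1"
      then show ?thesis using that[of b a] unit[OF ab(2)] ab(3) by simp
    qed
    have "- 1 - x\<^sup>2 - 1 * z\<^sup>2 \<in> I (2 * e + 1)" using ideal_minus[OF xz(3)] e by (simp add: algebra_simps)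
    from square_of_close[OF xz(1,2) this] obtain w where "- 1 - x\<^sup>2 = w\<^sup>2" by (auto simp: val_one)
    then have "x\<^sup>2 - (- 1) * w\<^sup>2 = - 1" by (simp flip: \<open>- 1 - x\<^sup>2 = w\<^sup>2\<close>)
    from this[symmetric] have "hil (Delta * y\<^sup>2) (- 1)" unfolding y[symmetric] by (rule hilI)
    then show ?thesis using y0 by (simp add: hil_square_mult_left)
  qed
qed

text \<open>For \<open>e = 0\<close> the class of \<open>Delta\<close> consists of norms because
  \<open>Delta = (- 1) (- Delta)\<close>. For \<open>e \<ge> 1\<close> the norms
  \<open>1 + y - rho y^2\<close> fill every layer of positive index, and a square handles layer
  \<open>0\<close>.\<close>

lemma unit_norm_Delta:
  assumes u: "u \<noteq> 0" "v u = 0" shows "hil Delta u"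
proof (cases "e = 0")
  case True
  have "hil Delta (- 1 * - Delta)" by (intro hil_mult hil_neg hil_Delta_minus_one True)
  then have D: "hil Delta Delta" by simp
  have "u - 1 \<in> I (2 * e)" using u True by (auto simp: ideal_iff intro: ideal_diff one_in_ideal)
  then obtain y where "u = y\<^sup>2 \<or> u = Delta * y\<^sup>2" using square_or_Delta[OF u] by blast
  then show ?thesis using hil_square[of Delta y] hil_mult[OF D hil_square[of Delta y]] by auto
next
  case False
  then have e: "e \<ge> 1" using e_nonneg by simp
  obtain z where z: "u - z\<^sup>2 \<in> I 1"
    using even_step[of 0 u] e ideal_diff[OF _ one_in_ideal, of u] u by (auto simp: ideal_iff)
  then have "z\<^sup>2 \<noteq> 0" "v (z\<^sup>2) = 0" using val_close_unit[OF u, of "z\<^sup>2" 1] by (auto simp: ideal_diff_commute)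
  from unit_quotient[OF this u z] obtain w where
    w: "u = z\<^sup>2 * w" "w \<noteq> 0" "v w = 0" "w - 1 \<in> I 1" by blast
  have "\<exists>n w'. hil Delta n \<and> n \<noteq> 0 \<and> v n = 0 \<and> w = n * w' \<and> w' \<noteq> 0 \<and> v w' = 0 \<and> w' - 1 \<in> I (2 * e + 1)"
  proof (rule filtration[where k = 1])
    fix m u assume m: "1 \<le> m" and um: "u - 1 \<in> I m"
    define y where "y = u - 1"
    have "rho * y\<^sup>2 \<in> I (m + 1)"
      using ideal_mult_left[OF rho(1) ideal_square[OF um]] m by (auto simp: y_def intro: ideal_mono)
    \<comment> \<open>Taking \<open>y / 2\<close> in both places cancels \<open>y^2 / 4\<close> and
      leaves an error of order \<open>2 m\<close>; this reaches \<open>m + 1\<close> because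
      \<open>m \<ge> 1\<close>.\<close>
    also have "rho * y\<^sup>2 = u - ((1 + y / 2)\<^sup>2 - Delta * (y / 2)\<^sup>2)"
      by (simp add: y_def Delta_def power2_eq_square field_simps)
    finally show "\<exists>n. hil Delta n \<and> u - n \<in> I (m + 1)" using hilI by blast
  qed (use w e in \<open>auto simp: hil_mult hil_one\<close>)
  then obtain n w' where "hil Delta n" "w = n * w'" "w' - 1 \<in> I (2 * e + 1)" by blast
  then have "hil Delta w" using local_square[of w'] hil_mult[OF _ hil_square] by auto
  then show ?thesis by (simp add: w(1) hil_mult hil_square)
qed

lemma index_Delta:
  assumes p: "odd (v p)" "p \<noteq> 0" and x: "x \<noteq> 0" shows "hil Delta x \<or> hil Delta (x * p)"
proof -
  have even: "hil Delta x" if x: "x \<noteq> 0" "even (v x)" for x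
  proof -
    obtain p where p: "p \<noteq> 0" "v p = v x div 2" using ex_val by blast
    have "x / p\<^sup>2 \<noteq> 0" "v (x / p\<^sup>2) = 0" using p x by (auto simp: val_divide val_square)
    from unit_norm_Delta[OF this] have "hil Delta (x / p\<^sup>2 * p\<^sup>2)" by (rule hil_mult[OF _ hil_square])
    then show ?thesis using p by simp
  qed
  show ?thesis using even[of x] even[of "x * p"] p x by (auto simp: val_mult)
qed

section \<open>Square classes and non-norms\<close>

lemma unit_square_class:
  assumes u: "u \<noteq> 0" "v u = 0"
  shows "\<exists>z w. z \<noteq> 0 \<and> u = w * z\<^sup>2 \<and>
    (w = 1 \<or> w = Delta \<or> (\<exists>a. w = 1 + a \<and> a \<noteq> 0 \<and> odd (v a) \<and> v a < 2 * e \<and> 0 < v a))"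
proof -
  \<comment> \<open>The quadratic defect: squares clear the even layers, and \<open>A\<close>
    records that the climb stopped at an odd layer with nonvanishing leading coefficient. If it
    reaches layer \<open>2 e\<close>, only the classes of \<open>1\<close> and \<open>Delta\<close>
    remain.\<close>
  define A where "A = (\<exists>z a. z \<noteq> 0 \<and> u = (1 + a) * z\<^sup>2 \<and> a \<noteq> 0 \<and> odd (v a) \<and> v a < 2 * e \<and> 0 < v a)"
  have "A \<or> (\<exists>z w. z \<noteq> 0 \<and> u = w * z\<^sup>2 \<and> w \<noteq> 0 \<and> v w = 0 \<and> w - 1 \<in> I m)"
    if "0 \<le> m" "m \<le> 2 * e" for m
    using that
  proof (induction m rule: int_ge_induct)
    case base
    have "u - 1 \<in> I 0" using u by (auto simp: ideal_iff intro: ideal_diff one_in_ideal)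
    then show ?case using u by (intro disjI2 exI[of _ 1] exI[of _ u]) simp
  next
    case (step m)
    show ?case
    proof (cases A)
      case False
      then obtain z w where zw: "z \<noteq> 0" "u = w * z\<^sup>2" "w \<noteq> 0" "v w = 0" "w - 1 \<in> I m"
        using step by auto
      show ?thesis
      proof (cases "even m")
        case True
        obtain y where y: "w - y\<^sup>2 \<in> I (m + 1)"
          using even_step[OF True _ _ zw(5)] step.hyps step.prems by auto
        then have y0: "y\<^sup>2 \<noteq> 0" "v (y\<^sup>2) = 0"
          using val_close_unit[OF zw(3,4), of "y\<^sup>2" "m + 1"] step by (auto simp: ideal_diff_commute)
        from unit_quotient[OF this zw(3,4) y] obtain w' where
          "w = y\<^sup>2 * w'" "w' \<noteq> 0" "v w' = 0" "w' - 1 \<in> I (m + 1)" by blast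
        then show ?thesis using zw y0
          by (intro disjI2 exI[of _ "z * y"] exI[of _ w']) (simp add: power_mult_distrib mult_ac)
      next
        case odd: False
        have "w - 1 \<in> I (m + 1)"
        proof (rule ccontr)
          assume "w - 1 \<notin> I (m + 1)"
          then have "w - 1 \<noteq> 0" "v (w - 1) = m" using zw(5) by (auto simp: frac_ideal_def)
          moreover have "0 < m" using odd step(1) by (cases "m = 0") auto
          moreover have "u = (1 + (w - 1)) * z\<^sup>2" using zw by simp
          ultimately have A unfolding A_def using zw(1) odd step(3) by (intro exI[of _ z] exI[of _ "w - 1"]) simp
          then show False using False by simp
        qed
        then show ?thesis using zw by blast
      qed
    qed simp
  qed
  from this[of "2 * e"] e_nonneg consider A |
    z w where "z \<noteq> 0" "u = w * z\<^sup>2" "w \<noteq> 0" "v w = 0" "w - 1 \<in> I (2 * e)" by auto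
  then show ?thesis
  proof cases
    case 1
    then show ?thesis unfolding A_def by blast
  next
    case 2
    obtain y where y: "w = y\<^sup>2 \<or> w = Delta * y\<^sup>2" using square_or_Delta[OF 2(3-5)] by blast
    then have "y \<noteq> 0" using 2(3) by auto
    have "u = 1 * (y * z)\<^sup>2 \<or> u = Delta * (y * z)\<^sup>2" using y 2(2) by (auto simp: power_mult_distrib)
    moreover have "y * z \<noteq> 0" using \<open>y \<noteq> 0\<close> 2(1) by simp
    ultimately show ?thesis by blast
  qed
qed

lemma square_classes:
  assumes x: "x \<noteq> 0"
  shows "\<exists>z w. z \<noteq> 0 \<and> x = w * z\<^sup>2 \<and>
    (odd (v w) \<or> w = 1 \<or> w = Delta \<or>
      (\<exists>a. w = 1 + a \<and> a \<noteq> 0 \<and> odd (v a) \<and> v a < 2 * e \<and> 0 < v a))"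
proof (cases "even (v x)")
  case True
  obtain p where p: "p \<noteq> 0" "v p = v x div 2" using ex_val by blast
  have "x / p\<^sup>2 \<noteq> 0" "v (x / p\<^sup>2) = 0" using p x True by (auto simp: val_divide val_square)
  from unit_square_class[OF this] obtain z w where zw: "z \<noteq> 0" "x / p\<^sup>2 = w * z\<^sup>2" and
    w: "w = 1 \<or> w = Delta \<or> (\<exists>a. w = 1 + a \<and> a \<noteq> 0 \<and> odd (v a) \<and> v a < 2 * e \<and> 0 < v a)" by blast
  have "x = w * (z * p)\<^sup>2" "z * p \<noteq> 0" using zw p by (auto simp: field_simps power_mult_distrib)
  then show ?thesis using w by blast
next
  case False
  then show ?thesis by (intro exI[of _ 1] exI[of _ x]) simp
qed

text \<open>
  For \<open>a b = 4 rho (1 + a)\<close> one has \<open>(1 + a) (1 + a (1 + b)) = (1 + a)\<^sup>2 Delta\<close>.  If \<open>1 + b\<close> were a norm,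
  both factors on the left, hence \<open>Delta\<close>, would be norms for \<open>- a (1 + b)\<close>, which has odd valuation.
\<close>

lemma not_hil_ramified:
  assumes a: "a \<noteq> 0" "odd (v a)" "v a < 2 * e" "0 < v a"
  shows "\<exists>c. c \<noteq> 0 \<and> \<not> hil (1 + a) c"
proof -
  have "1 + a - 1 \<in> I 1" using a by (simp add: ideal_iff)
  from close_one[OF this] have a1: "1 + a \<noteq> 0" "v (1 + a) = 0" by auto
  define b where "b = 4 * rho * (1 + a) / a"
  have "4 / a \<in> I 1" using a by (simp add: ideal_iff val_divide val_four)
  moreover have "rho * (1 + a) \<in> I 0" using a1 by (intro ideal_mult_left rho(1)) (simp add: ideal_iff)
  ultimately have "rho * (1 + a) * (4 / a) \<in> I 1" by (rule ideal_mult_left[rotated])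
  then have "b \<in> I 1" by (simp add: b_def mult_ac)
  then have b1: "1 + b \<noteq> 0" "v (1 + b) = 0" using close_one[of "1 + b" 1] by auto
  define c where "c = - a * (1 + b)"
  have c: "c \<noteq> 0" "odd (v c)" using a b1 by (auto simp: c_def val_mult val_minus)
  have "\<not> hil (1 + a) (1 + b)"
  proof
    assume "hil (1 + a) (1 + b)"
    moreover have "hil (1 + a) (- a)" by (rule hilI[of _ 1 _ 1]) simp
    ultimately have "hil (1 + a) c" unfolding c_def by (intro hil_mult)
    then have 1: "hil c (1 + a)" by (rule hil_commute[OF c(1)])
    have 2: "hil c (1 + a * (1 + b))" by (rule hilI[of _ 1 _ 1]) (simp add: c_def)
    have "a * b = 4 * rho * (1 + a)" using a by (simp add: b_def)
    then have "(1 + a) * (1 + a * (1 + b)) = (1 + a)\<^sup>2 * Delta"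
      by (simp add: Delta_def power2_eq_square distrib_left distrib_right mult_ac)
    then have "hil c ((1 + a)\<^sup>2 * Delta)" using hil_mult[OF 1 2] by simp
    then have "hil c Delta" using a1 hil_mult_square[of "1 + a" c Delta] by (simp add: mult.commute)
    then have "hil Delta c" by (rule hil_commute[OF Delta_unit(1)])
    then show False using hil_Delta_even c by blast
  qed
  then show ?thesis using b1 by blast
qed

text \<open>The norm group is proper, and its index is at most two; stating the latter through
  products of non-norms avoids the quotient group. Each kind of representative in
  \<open>square_classes\<close> has its own argument.\<close>

theorem hil_nonsquare:
  fixes d :: 'a
  assumes d: "d \<noteq> 0" "\<nexists>z. d = z\<^sup>2"
  shows "\<exists>c. c \<noteq> 0 \<and> \<not> hil d c"
    and "x \<noteq> 0 \<Longrightarrow> y \<noteq> 0 \<Longrightarrow> \<not> hil d x \<Longrightarrow> \<not> hil d y \<Longrightarrow> hil d (x * y)"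
proof -
  obtain z w where zw: "z \<noteq> 0" "d = w * z\<^sup>2" and
    w: "odd (v w) \<or> w = 1 \<or> w = Delta \<or>
      (\<exists>a. w = 1 + a \<and> a \<noteq> 0 \<and> odd (v a) \<and> v a < 2 * e \<and> 0 < v a)"
    using square_classes[OF d(1)] by blast
  have w0: "w \<noteq> 0" "w \<noteq> 1" using zw d by auto
  have dw: "hil d c \<longleftrightarrow> hil w c" for c using zw by (simp add: hil_square_mult_left)
  obtain p where p: "p \<noteq> 0" "v p = 1" using uniformizer by blast
  have "\<exists>c. c \<noteq> 0 \<and> \<not> hil w c"
  proof (cases "\<exists>a. w = 1 + a \<and> a \<noteq> 0 \<and> odd (v a) \<and> v a < 2 * e \<and> 0 < v a")
    case True
    then show ?thesis using not_hil_ramified by blast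
  next
    case False
    then have "w = Delta \<or> odd (v w)" using w w0 by blast
    then show ?thesis
    proof
      assume "w = Delta"
      then show ?thesis using hil_Delta_even[of p] p by (intro exI[of _ p]) auto
    next
      assume "odd (v w)"
      then have "\<not> hil w Delta"
        using hil_commute[of Delta w] hil_Delta_even[of w] w0 Delta_unit by blast
      then show ?thesis using Delta_unit by blast
    qed
  qed
  then show "\<exists>c. c \<noteq> 0 \<and> \<not> hil d c" by (simp add: dw)
  have "\<exists>c. c \<noteq> 0 \<and> (\<forall>x. x \<noteq> 0 \<longrightarrow> hil w x \<or> hil w (x * c))"
    using w
  proof (elim disjE exE)
    assume "odd (v w)"
    then show ?thesis using index_odd[OF w0(1)] Delta_unit by blast
  next
    assume "w = Delta"
    then show ?thesis using index_Delta[of p] p by (intro exI[of _ p]) simp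
  next
    fix a assume "w = 1 + a \<and> a \<noteq> 0 \<and> odd (v a) \<and> v a < 2 * e \<and> 0 < v a"
    then show ?thesis using index_ramified[of a] by blast
  qed (use w0 in simp)
  then obtain c where c0: "c \<noteq> 0" and c: "\<And>x. x \<noteq> 0 \<Longrightarrow> hil d x \<or> hil d (x * c)" by (auto simp: dw)
  show "hil d (x * y)" if "x \<noteq> 0" "y \<noteq> 0" "\<not> hil d x" "\<not> hil d y"
  proof -
    \<comment> \<open>Both non-norms lie in the coset of \<open>c\<close>, so their product differs
      from a norm by \<open>c^2\<close>.\<close>
    have "hil d (x * c * (y * c))" using c that by (blast intro: hil_mult[of d "x * c" "y * c"])
    then have h: "hil d (x * y * c\<^sup>2)" by (simp add: power2_eq_square mult_ac)
    show ?thesis using h c0 by (simp add: hil_mult_square)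
  qed
qed

end

section \<open>Values of ternary and quaternary forms\<close>

text \<open>On the line through a basis vector in the direction of an isotropic vector the form is
  affine in the parameter \<open>l\<close>, with slope \<open>2 a x\<close> or \<open>2 b y\<close>;
  the second assumption makes one of the slopes nonzero.\<close>

lemma isotropic_ternary_universal:
  fixes a b c t :: "'a::field_char_0"
  assumes 0: "a * x\<^sup>2 + b * y\<^sup>2 + c * z\<^sup>2 = 0" and nz: "a * x\<^sup>2 + b * y\<^sup>2 \<noteq> 0"
  shows "\<exists>x y z. a * x\<^sup>2 + b * y\<^sup>2 + c * z\<^sup>2 = t"
proof (cases "a * x = 0")
  case False
  define l where "l = (t - a) / (2 * a * x)"
  have "a * (1 + l * x)\<^sup>2 + b * (l * y)\<^sup>2 + c * (l * z)\<^sup>2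
      = a + 2 * a * x * l + l\<^sup>2 * (a * x\<^sup>2 + b * y\<^sup>2 + c * z\<^sup>2)"
    by (simp add: power2_eq_square algebra_simps)
  also have "\<dots> = t" using False 0 by (simp add: l_def)
  finally show ?thesis by blast
next
  case True
  then have nz_by: "b * y \<noteq> 0" using nz by (auto simp: power2_eq_square)
  define l where "l = (t - b) / (2 * b * y)"
  have "a * (l * x)\<^sup>2 + b * (1 + l * y)\<^sup>2 + c * (l * z)\<^sup>2
      = b + 2 * b * y * l + l\<^sup>2 * (a * x\<^sup>2 + b * y\<^sup>2 + c * z\<^sup>2)"
    by (simp add: power2_eq_square algebra_simps)
  also have "\<dots> = t" using nz_by 0 by (simp add: l_def)
  finally show ?thesis by blast
qed

text \<open>Multiplication by \<open>a\<close> gives a norm form: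
  \<open>a s = (a x)^2 + a b y^2\<close>.\<close>

lemma binary_represents:
  fixes a b s :: "'a::field_char_0"
  assumes "a \<noteq> 0"
  shows "(\<exists>x y. a * x\<^sup>2 + b * y\<^sup>2 = s) \<longleftrightarrow> hil (- (a * b)) (a * s)"
proof
  assume "\<exists>x y. a * x\<^sup>2 + b * y\<^sup>2 = s"
  then obtain x y where "a * x\<^sup>2 + b * y\<^sup>2 = s" by blast
  then have "a * s = (a * x)\<^sup>2 - (- (a * b)) * y\<^sup>2"
    by (auto simp: power2_eq_square algebra_simps)
  then show "hil (- (a * b)) (a * s)" by (rule hilI)
next
  assume "hil (- (a * b)) (a * s)"
  then obtain x y where "a * s = x\<^sup>2 - (- (a * b)) * y\<^sup>2" unfolding hil_def by blast
  then have "a * s = a * (a * (x / a)\<^sup>2 + b * y\<^sup>2)"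
    using assms by (simp add: power2_eq_square field_simps)
  then have "a * (x / a)\<^sup>2 + b * y\<^sup>2 = s" using assms by simp
  then show "\<exists>x y. a * x\<^sup>2 + b * y\<^sup>2 = s" by blast
qed

section \<open>Bilinearity of the Hilbert symbol and diagonal forms\<close>

context nonarch_local_field
begin

text \<open>Read as signs, equivalence of truth values is multiplication, so this is
  bimultiplicativity of the Hilbert symbol; it rests on the index being at most two.\<close>

lemma hil_mult_eq:
  assumes "a \<noteq> 0" "x \<noteq> 0" "y \<noteq> (0::'a)"
  shows "hil a (x * y) \<longleftrightarrow> (hil a x \<longleftrightarrow> hil a y)"
proof (cases "\<exists>z. a = z\<^sup>2")
  case True
  then obtain z where "a = z\<^sup>2" "z \<noteq> 0" using assms by auto
  then show ?thesis by (simp add: hil_of_square)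
next
  case False
  then show ?thesis
    using hil_mult_iff[of a x y] hil_mult_iff[of a y x] hil_nonsquare(2)[of a x y] assms
    by (auto simp: mult.commute)
qed

lemma hil_sym: "a \<noteq> 0 \<Longrightarrow> b \<noteq> (0::'a) \<Longrightarrow> hil a b \<longleftrightarrow> hil b a"
  using hil_commute[of a b] hil_commute[of b a] by blast

lemma hil_mult_left_eq:
  assumes "a \<noteq> 0" "b \<noteq> 0" "x \<noteq> (0::'a)"
  shows "hil (a * b) x \<longleftrightarrow> (hil a x \<longleftrightarrow> hil b x)"
  using hil_mult_eq[of x a b] assms hil_sym[of x] by simp

text \<open>The sign pairs of \<open>1\<close>, \<open>r\<close>, \<open>p\<close> and
  \<open>r * p\<close> exhaust all four possibilities.\<close>

lemma hil_prescribed_aux: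
  fixes a b :: 'a
  assumes a: "a \<noteq> 0" "b \<noteq> 0" and r: "r \<noteq> 0" "hil a r" "\<not> hil b r" and p: "p \<noteq> 0" "\<not> hil a p"
  shows "\<exists>s. s \<noteq> 0 \<and> (hil a s \<longleftrightarrow> P) \<and> (hil b s \<longleftrightarrow> Q)"
proof -
  have rp: "r * p \<noteq> 0" "\<not> hil a (r * p)" "hil b (r * p) \<longleftrightarrow> \<not> hil b p"
    using r p by (auto simp: hil_mult_eq[OF a(1)] hil_mult_eq[OF a(2)])
  have one: "(1::'a) \<noteq> 0" "hil a 1" "hil b 1" by (simp_all add: hil_one)
  show ?thesis
  proof (cases P)
    case True
    then show ?thesis using one r by (cases Q) blast+
  next
    case False
    have "p \<noteq> 0 \<and> (hil a p \<longleftrightarrow> P) \<and> (hil b p \<longleftrightarrow> Q) \<or>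
        r * p \<noteq> 0 \<and> (hil a (r * p) \<longleftrightarrow> P) \<and> (hil b (r * p) \<longleftrightarrow> Q)"
      using False p rp by (cases Q; cases "hil b p") simp_all
    then show ?thesis by blast
  qed
qed

text \<open>Independence of the characters \<open>hil a\<close> and \<open>hil b\<close>: a non-norm
  \<open>r\<close> for \<open>a * b\<close> separates them, so exactly one of them is trivial on
  \<open>r\<close>.\<close>

lemma hil_prescribed:
  fixes a b :: 'a
  assumes ab: "a \<noteq> 0" "b \<noteq> 0" "\<nexists>z. a = z\<^sup>2" "\<nexists>z. b = z\<^sup>2" "\<nexists>z. a * b = z\<^sup>2"
  shows "\<exists>s. s \<noteq> 0 \<and> (hil a s \<longleftrightarrow> P) \<and> (hil b s \<longleftrightarrow> Q)"
proof -
  obtain p where p: "p \<noteq> 0" "\<not> hil a p" using hil_nonsquare(1) ab by blast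
  obtain q where q: "q \<noteq> 0" "\<not> hil b q" using hil_nonsquare(1) ab by blast
  obtain r where r: "r \<noteq> 0" "\<not> hil (a * b) r" using hil_nonsquare(1)[of "a * b"] ab by auto
  have r': "hil a r \<longleftrightarrow> \<not> hil b r" using r ab by (simp add: hil_mult_left_eq)
  show ?thesis
  proof (cases "hil a r")
    case True
    then show ?thesis using hil_prescribed_aux[OF ab(1,2) r(1) _ _ p] r' by blast
  next
    case False
    then show ?thesis using hil_prescribed_aux[OF ab(2,1) r(1) _ _ q, of Q P] r' by blast
  qed
qed

text \<open>The aim is a value \<open>s\<close> common to \<open>a x^2 + b y^2\<close> and
  \<open>t z^2 - c w^2\<close>. Being a value is one symbol condition for \<open>A\<close> and one
  for \<open>B\<close>; as \<open>A * B\<close> is not a square, both can be met together.\<close>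

lemma ternary_represents:
  fixes a b c t :: 'a
  assumes 0: "a \<noteq> 0" "b \<noteq> 0" "c \<noteq> 0" "t \<noteq> 0" and ns: "\<nexists>z. - (a * b * c * t) = z\<^sup>2"
  shows "\<exists>x y z. a * x\<^sup>2 + b * y\<^sup>2 + c * z\<^sup>2 = t"
proof -
  define A where "A = - (a * b)"
  define B where "B = t * c"
  have AB: "A \<noteq> 0" "B \<noteq> 0" "\<nexists>z. A * B = z\<^sup>2" using 0 ns by (auto simp: A_def B_def mult_ac)
  have "\<exists>s. s \<noteq> 0 \<and> hil A (a * s) \<and> hil B (t * s)"
  proof (cases "\<exists>z. A = z\<^sup>2")
    case True
    then have "hil A x" for x using hil_of_square AB(1) by (metis power_zero_numeral)
    then show ?thesis using hil_square[of B t] 0 by (intro exI[of _ t]) (simp add: power2_eq_square)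
  next
    case A: False
    show ?thesis
    proof (cases "\<exists>z. B = z\<^sup>2")
      case True
      then have "hil B x" for x using hil_of_square AB(2) by (metis power_zero_numeral)
      then show ?thesis using hil_square[of A a] 0 by (intro exI[of _ a]) (simp add: power2_eq_square)
    next
      case False
      obtain s where "s \<noteq> 0" "hil A s \<longleftrightarrow> hil A a" "hil B s \<longleftrightarrow> hil B t"
        using hil_prescribed[OF AB(1,2) A False AB(3)] by blast
      then show ?thesis using hil_mult_eq AB 0 by blast
    qed
  qed
  then obtain s where s: "s \<noteq> 0" "hil A (a * s)" "hil B (t * s)" by blast
  obtain x y where xy: "a * x\<^sup>2 + b * y\<^sup>2 = s" using s binary_represents[of a b s] 0 A_def by blast
  obtain z w where zw: "t * z\<^sup>2 + (- c) * w\<^sup>2 = s"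
    using s binary_represents[of t "- c" s] 0 B_def by auto
  show ?thesis
  proof (cases "z = 0")
    \<comment> \<open>With \<open>z = 0\<close> the common value makes the ternary form isotropic,
      hence universal.\<close>
    case True
    then have "a * x\<^sup>2 + b * y\<^sup>2 + c * w\<^sup>2 = s + c * w\<^sup>2" using xy by simp
    also have "- (c * w\<^sup>2) = s" using zw True by simp
    then have "s + c * w\<^sup>2 = 0" by (simp add: eq_neg_iff_add_eq_0[symmetric])
    finally have "a * x\<^sup>2 + b * y\<^sup>2 + c * w\<^sup>2 = 0" .
    then show ?thesis using isotropic_ternary_universal xy s(1) by blast
  next
    case False
    have "a * (x / z)\<^sup>2 + b * (y / z)\<^sup>2 + c * (w / z)\<^sup>2 = (s + c * w\<^sup>2) / z\<^sup>2"
      using False by (simp add: xy[symmetric] field_simps power_divide)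
    also have "s + c * w\<^sup>2 = t * z\<^sup>2" using zw by (simp add: algebra_simps)
    finally have "a * (x / z)\<^sup>2 + b * (y / z)\<^sup>2 + c * (w / z)\<^sup>2 = t" using False by simp
    then show ?thesis by blast
  qed
qed

text \<open>A uniformizer and its product with \<open>Delta\<close> have odd valuation. If
  \<open>Delta\<close> were a square, its norm form would take every value, against the parity of
  valuations.\<close>

lemma nonsquare_classes:
  shows "\<exists>p q::'a. p \<noteq> 0 \<and> q \<noteq> 0 \<and> (\<nexists>z. p = z\<^sup>2) \<and> (\<nexists>z. q = z\<^sup>2) \<and> (\<nexists>z. p * q = z\<^sup>2)"
proof -
  obtain p where p: "p \<noteq> 0" "v p = 1" using uniformizer by blast
  have odd: "\<nexists>z. x = z\<^sup>2" if "x \<noteq> 0" "odd (v x)" for x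
    using that by (auto simp: val_square)
  have "\<nexists>z. Delta = z\<^sup>2"
  proof
    assume "\<exists>z. Delta = z\<^sup>2"
    then obtain z where "Delta = z\<^sup>2" "z \<noteq> 0" using Delta_unit by auto
    then have "hil Delta p" by (simp add: hil_of_square)
    then show False using hil_Delta_even[of p] p by simp
  qed
  moreover have "\<nexists>z. p = z\<^sup>2" "\<nexists>z. p * Delta = z\<^sup>2"
    using p Delta_unit odd[of p] odd[of "p * Delta"] by (simp_all add: val_mult)
  ultimately show ?thesis using p(1) Delta_unit(1) by blast
qed

lemma ex_nonsquare_mult:
  fixes a :: 'a
  assumes "a \<noteq> 0" shows "\<exists>t. t \<noteq> 0 \<and> (\<nexists>z. a * t = z\<^sup>2)"
proof -
  obtain p :: 'a where p: "p \<noteq> 0" "\<nexists>z. p = z\<^sup>2" using nonsquare_classes by blast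
  then show ?thesis using assms by (intro exI[of _ "p / a"]) simp
qed

text \<open>Among \<open>p\<close>, \<open>q\<close>, \<open>p * q\<close>, bimultiplicativity makes
  at least one a sum of two squares, and none of them is a square.\<close>

lemma sum_two_squares_nonsquare:
  assumes "\<nexists>z::'a. - 1 = z\<^sup>2"
  shows "\<exists>x y::'a. \<nexists>z. x\<^sup>2 + y\<^sup>2 = z\<^sup>2"
proof -
  obtain p q :: 'a where pq: "p \<noteq> 0" "q \<noteq> 0" "\<nexists>z. p = z\<^sup>2" "\<nexists>z. q = z\<^sup>2" "\<nexists>z. p * q = z\<^sup>2"
    using nonsquare_classes by blast
  have "hil (- 1) p \<or> hil (- 1) q \<or> hil (- 1) (p * q)"
    using hil_mult_eq[of "- 1" p q] pq by auto
  then obtain s :: 'a where s: "hil (- 1) s" "\<nexists>z. s = z\<^sup>2" using pq(3-5) by metis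
  then obtain x y where "s = x\<^sup>2 + y\<^sup>2" by (auto simp: hil_def)
  then show ?thesis using s(2) by blast
qed

text \<open>Leaving out one variable gives a ternary form, which is settled outside one square class
  of \<open>t\<close>. If all four ternary forms are excluded, then \<open>a\<close>,
  \<open>b\<close>, \<open>c\<close>, \<open>f\<close> agree up to squares.\<close>

lemma quaternary_represents:
  fixes a b c f t :: 'a
  assumes 0: "a \<noteq> 0" "b \<noteq> 0" "c \<noteq> 0" "f \<noteq> 0" "t \<noteq> 0"
  shows "\<exists>x y z w. a * x\<^sup>2 + b * y\<^sup>2 + c * z\<^sup>2 + f * w\<^sup>2 = t"
proof -
  consider "\<nexists>z. - (a * b * c * t) = z\<^sup>2" | "\<nexists>z. - (a * b * f * t) = z\<^sup>2" |
    "\<nexists>z. - (a * c * f * t) = z\<^sup>2" | "\<nexists>z. - (b * c * f * t) = z\<^sup>2" |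
    "\<exists>z. - (a * b * c * t) = z\<^sup>2" "\<exists>z. - (a * b * f * t) = z\<^sup>2"
    "\<exists>z. - (a * c * f * t) = z\<^sup>2" "\<exists>z. - (b * c * f * t) = z\<^sup>2" by blast
  then show ?thesis
  proof cases
    case 1
    then obtain x y z where "a * x\<^sup>2 + b * y\<^sup>2 + c * z\<^sup>2 = t" using ternary_represents 0 by blast
    then have "a * x\<^sup>2 + b * y\<^sup>2 + c * z\<^sup>2 + f * 0\<^sup>2 = t" by simp
    then show ?thesis by blast
  next
    case 2
    then obtain x y z where "a * x\<^sup>2 + b * y\<^sup>2 + f * z\<^sup>2 = t" using ternary_represents 0 by blast
    then have "a * x\<^sup>2 + b * y\<^sup>2 + c * 0\<^sup>2 + f * z\<^sup>2 = t" by simp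
    then show ?thesis by blast
  next
    case 3
    then obtain x y z where "a * x\<^sup>2 + c * y\<^sup>2 + f * z\<^sup>2 = t" using ternary_represents 0 by blast
    then have "a * x\<^sup>2 + b * 0\<^sup>2 + c * y\<^sup>2 + f * z\<^sup>2 = t" by simp
    then show ?thesis by blast
  next
    case 4
    then obtain x y z where "b * x\<^sup>2 + c * y\<^sup>2 + f * z\<^sup>2 = t" using ternary_represents 0 by blast
    then have "a * 0\<^sup>2 + b * x\<^sup>2 + c * y\<^sup>2 + f * z\<^sup>2 = t" by simp
    then show ?thesis by blast
  next
    case 5
    have ratio: "\<exists>z. z \<noteq> 0 \<and> r = s * z\<^sup>2"
      if "- (k * r) = z1\<^sup>2" "- (k * s) = z2\<^sup>2" "k \<noteq> 0" "r \<noteq> 0" "s \<noteq> 0" for k r s z1 z2 :: 'a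
    proof (intro exI conjI)
      have nz: "z1 \<noteq> 0" "z2 \<noteq> 0" using that by auto
      then show "z1 / z2 \<noteq> 0" by simp
      have "(z1 / z2)\<^sup>2 = (- (k * r)) / (- (k * s))" unfolding that power_divide ..
      then show "r = s * (z1 / z2)\<^sup>2" using that(3-5) by simp
    qed
    obtain z1 z2 z3 z4 where z: "- (a * b * c * t) = z1\<^sup>2" "- (a * b * f * t) = z2\<^sup>2"
      "- (a * c * f * t) = z3\<^sup>2" "- (b * c * f * t) = z4\<^sup>2" using 5 by blast
    have "\<exists>z. z \<noteq> 0 \<and> a = f * z\<^sup>2" using ratio[of "b * c * t" a z1 f z4] z 0 by (simp add: mult_ac)
    then obtain za where za: "za \<noteq> 0" "a = f * za\<^sup>2" by blast
    have "\<exists>z. z \<noteq> 0 \<and> b = f * z\<^sup>2" using ratio[of "a * c * t" b z1 f z3] z 0 by (simp add: mult_ac)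
    then obtain zb where zb: "zb \<noteq> 0" "b = f * zb\<^sup>2" by blast
    have "\<exists>z. z \<noteq> 0 \<and> c = f * z\<^sup>2" using ratio[of "a * b * t" c z1 f z2] z 0 by (simp add: mult_ac)
    then obtain zc where zc: "zc \<noteq> 0" "c = f * zc\<^sup>2" by blast
    have "\<exists>x y z w. f * x\<^sup>2 + f * y\<^sup>2 + f * z\<^sup>2 + f * w\<^sup>2 = t"
    proof (cases "\<exists>i::'a. - 1 = i\<^sup>2")
      case True
      then obtain i :: 'a where i: "- 1 = i\<^sup>2" by blast
      have "f * 1\<^sup>2 + f * i\<^sup>2 + f * 0\<^sup>2 = 0" "f * 1\<^sup>2 + f * 0\<^sup>2 \<noteq> 0" using 0 by (simp_all flip: i)
      then have "f * 1\<^sup>2 + f * 0\<^sup>2 + f * i\<^sup>2 = 0" by (simp add: add_ac)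
      from isotropic_ternary_universal[OF this, of t] 0 obtain x y z where
        "f * x\<^sup>2 + f * y\<^sup>2 + f * z\<^sup>2 = t" by auto
      then have "f * x\<^sup>2 + f * y\<^sup>2 + f * z\<^sup>2 + f * 0\<^sup>2 = t" by simp
      then show ?thesis by blast
    next
      \<comment> \<open>Two of the entries together represent \<open>f * s\<close> with
        \<open>s\<close> not a square. The ternary form with entries \<open>f s, f, f\<close> then
        has a discriminant outside the excluded class.\<close>
      case False
      obtain x y :: 'a where xy: "\<nexists>z. x\<^sup>2 + y\<^sup>2 = z\<^sup>2" using sum_two_squares_nonsquare[OF False] by blast
      define s where "s = x\<^sup>2 + y\<^sup>2"
      have s: "s \<noteq> 0" "\<nexists>z. s = z\<^sup>2" using xy by (auto simp: s_def)
      have "- (f * f * f * t) = (z1 / (za * zb * zc))\<^sup>2 * f\<^sup>2 / f\<^sup>2" 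
        using z(1) za zb zc 0 by (simp add: field_simps power2_eq_square)
      then have ft: "- (f * f * f * t) = (z1 / (za * zb * zc))\<^sup>2" using 0 by simp
      have "\<nexists>z. - (f * s * f * f * t) = z\<^sup>2"
      proof
        assume "\<exists>z. - (f * s * f * f * t) = z\<^sup>2"
        then obtain z where "- (f * s * f * f * t) = z\<^sup>2" by blast
        then have "s * (z1 / (za * zb * zc))\<^sup>2 = z\<^sup>2" unfolding ft[symmetric] by (simp add: mult_ac)
        moreover have nz: "z1 / (za * zb * zc) \<noteq> 0" using ft 0 by auto
        ultimately have "s = (z / (z1 / (za * zb * zc)))\<^sup>2"
          by (metis nonzero_eq_divide_eq power_divide power_not_zero)
        then show False using s by blast
      qed
      then obtain X Y Z where "f * s * X\<^sup>2 + f * Y\<^sup>2 + f * Z\<^sup>2 = t"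
        using ternary_represents[of "f * s" f f t] 0 s by auto
      then have "f * (x * X)\<^sup>2 + f * (y * X)\<^sup>2 + f * Y\<^sup>2 + f * Z\<^sup>2 = t"
        by (simp add: s_def power_mult_distrib algebra_simps)
      then show ?thesis by blast
    qed
    then obtain x y z w where "f * x\<^sup>2 + f * y\<^sup>2 + f * z\<^sup>2 + f * w\<^sup>2 = t" by blast
    then have "a * (x / za)\<^sup>2 + b * (y / zb)\<^sup>2 + c * (z / zc)\<^sup>2 + f * w\<^sup>2 = t"
      using za zb zc by (simp add: power_divide)
    then show ?thesis by blast
  qed
qed

end

section \<open>Congruence of symmetric matrices\<close>

lemma GL_iff:
  fixes g :: "'a::field mat"
  shows "g \<in> carrier (GL n) \<longleftrightarrow> g \<in> carrier_mat n n \<and> det g \<noteq> 0"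
  using det_non_zero_imp_unit[of g n "()"] unit_imp_det_non_zero[of g n "()"]
  unfolding GL_def units_of_def by (auto simp: Units_def ring_mat_simps)

lemma GL_inverse:
  fixes g :: "'a::field mat"
  assumes "g \<in> carrier (GL n)"
  obtains h where "h \<in> carrier (GL n)" "g * h = 1\<^sub>m n" "h * g = 1\<^sub>m n"
proof -
  have "g \<in> Units (ring_mat TYPE('a) n ())" using assms by (simp add: GL_def units_of_def)
  then obtain h where h: "h \<in> carrier_mat n n" "g * h = 1\<^sub>m n" "h * g = 1\<^sub>m n"
    and g: "g \<in> carrier_mat n n"
    by (auto simp: Units_def ring_mat_simps)
  have "det g * det h = 1" using det_mult[OF g h(1)] h(2) by simp
  then have "det h \<noteq> 0" by auto
  then show ?thesis using that h by (simp add: GL_iff)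
qed

lemma GL_mult: "g \<in> carrier (GL n) \<Longrightarrow> h \<in> carrier (GL n) \<Longrightarrow> g * h \<in> carrier (GL n)"
  for g :: "'a::field mat"
  by (auto simp: GL_iff det_mult)

lemma GL_one: "1\<^sub>m n \<in> carrier (GL n)"
  by (simp add: GL_iff)

section \<open>The congruence action on symmetric matrices\<close>

lemma sym_space_iff:
  fixes y :: "'a::field mat"
  shows "y \<in> sym_space n \<longleftrightarrow> y \<in> carrier_mat n n \<and> det y \<noteq> 0 \<and> transpose_mat y = y"
  by (auto simp: sym_space_def GL_iff)

lemma star_carrier [simp]:
  "g \<in> carrier_mat n m \<Longrightarrow> y \<in> carrier_mat n n \<Longrightarrow> star g y \<in> carrier_mat m m"
  by (simp add: star_def)

lemma star_mult:
  fixes y :: "'a::field mat"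
  assumes "g \<in> carrier_mat n m" "h \<in> carrier_mat m l" "y \<in> carrier_mat n n"
  shows "star (g * h) y = star h (star g y)"
proof -
  have t: "transpose_mat g \<in> carrier_mat m n" "transpose_mat h \<in> carrier_mat l m" using assms by auto
  have "star (g * h) y = transpose_mat h * transpose_mat g * y * (g * h)"
    using assms by (simp add: star_def transpose_mult)
  also have "\<dots> = transpose_mat h * (transpose_mat g * y) * (g * h)"
    using assms t by (simp add: assoc_mult_mat[of _ l m _ n _ n])
  also have "\<dots> = transpose_mat h * ((transpose_mat g * y) * (g * h))"
    using assms t by (intro assoc_mult_mat[of _ l m _ n _ l]) auto
  also have "(transpose_mat g * y) * (g * h) = (transpose_mat g * y * g) * h"
    using assms t by (intro assoc_mult_mat[symmetric, of _ m n _ m _ l]) auto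
  also have "transpose_mat h * (transpose_mat g * y * g * h) = transpose_mat h * (transpose_mat g * y * g) * h"
    using assms t by (intro assoc_mult_mat[symmetric, of _ l m _ m _ l]) auto
  finally show ?thesis by (simp add: star_def)
qed

lemma star_one: "y \<in> carrier_mat n n \<Longrightarrow> star (1\<^sub>m n) y = y"
  by (simp add: star_def)

lemma det_star:
  fixes y :: "'a::field mat"
  assumes "g \<in> carrier_mat n n" "y \<in> carrier_mat n n"
  shows "det (star g y) = (det g)\<^sup>2 * det y"
  using assms by (simp add: star_def det_mult[of _ n] det_transpose power2_eq_square)

lemma transpose_star:
  fixes y :: "'a::field mat"
  assumes "g \<in> carrier_mat n m" "y \<in> carrier_mat n n"
  shows "transpose_mat (star g y) = star g (transpose_mat y)"
proof -
  have "star g y = transpose_mat g * (y * g)"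
    unfolding star_def using assms by (intro assoc_mult_mat[of _ m n _ n _ m]) auto
  also have "transpose_mat \<dots> = transpose_mat (y * g) * g"
    using assms by (subst transpose_mult[of _ m n _ m]) auto
  also have "\<dots> = star g (transpose_mat y)"
    unfolding star_def using assms by (subst transpose_mult[of _ n n _ m]) auto
  finally show ?thesis .
qed

lemma transpose_smult: "transpose_mat (a \<cdot>\<^sub>m A) = a \<cdot>\<^sub>m transpose_mat A"
  by (rule eq_matI) auto

text \<open>Allows the sign of a congruence to be chosen freely in Witt cancellation.\<close>

lemma star_uminus:
  fixes y :: "'a::field mat"
  assumes "g \<in> carrier_mat n m" "y \<in> carrier_mat n n" shows "star ((- 1) \<cdot>\<^sub>m g) y = star g y"
  using assms unfolding star_def
  by (simp add: transpose_smult mult_smult_assoc_mat[of _ m n _ n] mult_smult_assoc_mat[of _ m n _ m]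
      mult_smult_distrib[of _ m n _ m]) (auto intro!: eq_matI)

lemma mult_minus_smult:
  fixes A :: "'a::field mat"
  assumes "A \<in> carrier_mat n n" "B \<in> carrier_mat n n" "C \<in> carrier_mat n n" "D \<in> carrier_mat n n"
  shows "(A - l \<cdot>\<^sub>m B) * (C - l \<cdot>\<^sub>m D) =
    A * C - l \<cdot>\<^sub>m (A * D) - (l \<cdot>\<^sub>m (B * C) - (l * l) \<cdot>\<^sub>m (B * D))"
proof -
  have "(A - l \<cdot>\<^sub>m B) * (C - l \<cdot>\<^sub>m D) = A * (C - l \<cdot>\<^sub>m D) - (l \<cdot>\<^sub>m B) * (C - l \<cdot>\<^sub>m D)"
    using assms by (intro minus_mult_distrib_mat[of _ n n _ _ n]) auto
  also have "A * (C - l \<cdot>\<^sub>m D) = A * C - l \<cdot>\<^sub>m (A * D)"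
    using assms by (simp add: mult_minus_distrib_mat[of _ n n _ n] mult_smult_distrib[of _ n n _ n])
  also have "(l \<cdot>\<^sub>m B) * (C - l \<cdot>\<^sub>m D) = (l \<cdot>\<^sub>m B) * C - (l \<cdot>\<^sub>m B) * (l \<cdot>\<^sub>m D)"
    using assms by (intro mult_minus_distrib_mat[of _ n n _ n]) auto
  also have "(l \<cdot>\<^sub>m B) * C = l \<cdot>\<^sub>m (B * C)" using assms by (intro mult_smult_assoc_mat) auto
  also have "(l \<cdot>\<^sub>m B) * (l \<cdot>\<^sub>m D) = l \<cdot>\<^sub>m (l \<cdot>\<^sub>m (B * D))"
    using assms by (simp add: mult_smult_assoc_mat[of _ n n _ n] mult_smult_distrib[of _ n n _ n])
  also have "\<dots> = (l * l) \<cdot>\<^sub>m (B * D)" by (rule eq_matI) (auto simp: mult.assoc)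
  finally show ?thesis .
qed

lemma star_in_sym_space:
  fixes y :: "'a::field mat"
  assumes "g \<in> carrier (GL n)" "y \<in> sym_space n" shows "star g y \<in> sym_space n"
  using assms unfolding sym_space_iff GL_iff
  by (auto simp: det_star[of _ n] transpose_star[of _ n n])

definition cong_mat :: "nat \<Rightarrow> 'a::field mat \<Rightarrow> 'a mat \<Rightarrow> bool" where
  "cong_mat n y z \<longleftrightarrow> (\<exists>g \<in> carrier (GL n). z = star g y)"

lemma cong_mat_refl: "y \<in> carrier_mat n n \<Longrightarrow> cong_mat n y y"
  unfolding cong_mat_def using GL_one star_one by metis

lemma cong_mat_trans:
  assumes "y \<in> carrier_mat n n" "cong_mat n y z" "cong_mat n z w" shows "cong_mat n y w"
proof -
  obtain g h where "g \<in> carrier (GL n)" "h \<in> carrier (GL n)" "z = star g y" "w = star h z"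
    using assms unfolding cong_mat_def by blast
  then show ?thesis unfolding cong_mat_def
    by (intro bexI[of _ "g * h"]) (use assms(1) in \<open>auto simp: GL_mult GL_iff star_mult det_mult\<close>)
qed

lemma cong_mat_sym:
  assumes "y \<in> carrier_mat n n" "cong_mat n y z" shows "cong_mat n z y"
proof -
  obtain g where g: "g \<in> carrier (GL n)" "z = star g y"
    using assms unfolding cong_mat_def by blast
  obtain h where h: "h \<in> carrier (GL n)" "g * h = 1\<^sub>m n" using GL_inverse g(1) by metis
  have "star h z = star (g * h) y"
    unfolding g(2) using g(1) h(1) assms(1) by (intro star_mult[symmetric, of _ n n _ n]) (auto simp: GL_iff)
  also have "\<dots> = y" using h assms(1) by (simp add: star_one)
  finally show ?thesis unfolding cong_mat_def using h(1) by metis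
qed

lemma cong_mat_sym_space: "y \<in> sym_space n \<Longrightarrow> cong_mat n y z \<Longrightarrow> z \<in> sym_space n"
  unfolding cong_mat_def using star_in_sym_space by blast

section \<open>Orthogonal sums\<close>

definition bsum :: "'a::zero mat \<Rightarrow> 'a mat \<Rightarrow> 'a mat" where
  "bsum A B = four_block_mat A (0\<^sub>m (dim_row A) (dim_col B)) (0\<^sub>m (dim_row B) (dim_col A)) B"

definition sing :: "'a \<Rightarrow> 'a mat" where
  "sing a = mat 1 1 (\<lambda>_. a)"

lemma sing_carrier [simp]: "sing a \<in> carrier_mat 1 1" "sing a \<in> carrier_mat (Suc 0) (Suc 0)"
  by (simp_all add: sing_def)

lemma sing_index [simp]: "sing a $$ (0, 0) = a" "dim_row (sing a) = 1" "dim_col (sing a) = 1"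
  by (simp_all add: sing_def)

lemma mat_1_1: "A \<in> carrier_mat 1 1 \<Longrightarrow> A = sing (A $$ (0, 0))"
  by (rule eq_matI) (auto simp: sing_def)

lemma det_sing [simp]: "det (sing a) = a"
  by (simp add: det_single[of "sing a"])

lemma transpose_sing [simp]: "transpose_mat (sing a) = sing a"
  by (rule eq_matI) (auto simp: sing_def)

lemma star_sing [simp]: "star (sing a) (sing b) = sing (a\<^sup>2 * b)" for a :: "'a::field"
  by (rule eq_matI) (auto simp: sing_def star_def scalar_prod_def power2_eq_square mult_ac)

lemma bsum_carrier [simp]:
  "A \<in> carrier_mat n1 m1 \<Longrightarrow> B \<in> carrier_mat n2 m2 \<Longrightarrow> bsum A B \<in> carrier_mat (n1 + n2) (m1 + m2)"
  unfolding bsum_def by auto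

lemma bsum_assoc: "bsum A (bsum B C) = bsum (bsum A B) C"
  unfolding bsum_def using assoc_four_block_mat[of A B C] by simp

lemma det_bsum:
  fixes A :: "'a::field mat"
  assumes "A \<in> carrier_mat n n" "B \<in> carrier_mat m m" shows "det (bsum A B) = det A * det B"
  unfolding bsum_def using assms by (subst det_four_block_mat_upper_right_zero[of _ n _ m]) auto

lemma bsum_mult:
  fixes A :: "'a::field mat"
  assumes "A \<in> carrier_mat n1 n1" "B \<in> carrier_mat n2 n2" "C \<in> carrier_mat n1 n1" "D \<in> carrier_mat n2 n2"
  shows "bsum A B * bsum C D = bsum (A * C) (B * D)"
  unfolding bsum_def using assms
  by (subst mult_four_block_mat[of _ n1 n1 _ n2 _ n2]) auto

lemma transpose_bsum:
  "A \<in> carrier_mat n1 n1 \<Longrightarrow> B \<in> carrier_mat n2 n2 \<Longrightarrow>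
    transpose_mat (bsum A B) = bsum (transpose_mat A) (transpose_mat B)"
  unfolding bsum_def by (subst transpose_four_block_mat[of _ n1 n1 _ n2 _ n2]) auto

lemma star_bsum:
  fixes A :: "'a::field mat"
  assumes "A \<in> carrier_mat n1 n1" "B \<in> carrier_mat n2 n2" "g \<in> carrier_mat n1 n1" "h \<in> carrier_mat n2 n2"
  shows "star (bsum g h) (bsum A B) = bsum (star g A) (star h B)"
  using assms by (simp add: star_def transpose_bsum[of _ n1 _ n2] bsum_mult[of _ n1 _ n2])

lemma bsum_sym_space:
  fixes A :: "'a::field mat"
  assumes "A \<in> sym_space n" "B \<in> sym_space m" shows "bsum A B \<in> sym_space (n + m)"
  using assms unfolding sym_space_iff by (auto simp: det_bsum[of _ n _ m] transpose_bsum[of _ n _ m])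

lemma cong_mat_bsum:
  fixes A :: "'a::field mat"
  assumes "A \<in> carrier_mat n n" "B \<in> carrier_mat m m" "cong_mat n A A'" "cong_mat m B B'"
  shows "cong_mat (n + m) (bsum A B) (bsum A' B')"
proof -
  obtain g h where "g \<in> carrier (GL n)" "h \<in> carrier (GL m)" "A' = star g A" "B' = star h B"
    using assms unfolding cong_mat_def by blast
  then show ?thesis unfolding cong_mat_def using assms(1,2)
    by (intro bexI[of _ "bsum g h"]) (auto simp: GL_iff det_bsum star_bsum[of _ n _ m])
qed

lemma sing_sym_space: "sing a \<in> sym_space (Suc 0) \<longleftrightarrow> a \<noteq> 0" for a :: "'a::field"
  by (simp add: sym_space_iff)

abbreviation ext :: "'a::zero \<Rightarrow> 'a mat \<Rightarrow> 'a mat" where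
  "ext a y \<equiv> bsum (sing a) y"

lemma ext_carrier [simp]: "y \<in> carrier_mat n n \<Longrightarrow> ext a y \<in> carrier_mat (Suc n) (Suc n)"
  using bsum_carrier[of "sing a" 1 1 y n n] by simp

lemma ext_sym_space: "a \<noteq> 0 \<Longrightarrow> y \<in> sym_space n \<Longrightarrow> ext a y \<in> sym_space (Suc n)" for a :: "'a::field"
  using bsum_sym_space[of "sing a" 1 y n] by (simp add: sing_sym_space)

lemma det_ext: "y \<in> carrier_mat n n \<Longrightarrow> det (ext a y) = a * det y" for a :: "'a::field"
  using det_bsum[of "sing a" 1 y n] by simp

lemma cong_mat_ext:
  "y \<in> carrier_mat n n \<Longrightarrow> cong_mat n y z \<Longrightarrow> cong_mat (Suc n) (ext a y) (ext a z)" for a :: "'a::field"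
  using cong_mat_bsum[of "sing a" 1 y n "sing a" z] cong_mat_refl[of "sing a" 1] by simp

lemma map_mat_sing: "map_mat f (sing a) = sing (f a)"
  by (rule eq_matI) (auto simp: sing_def)

lemma map_mat_ext:
  assumes "f 0 = 0" shows "map_mat f (ext a y) = ext (f a) (map_mat f y)"
proof -
  have "map_mat f (ext a y) = four_block_mat (map_mat f (sing a)) (map_mat f (0\<^sub>m 1 (dim_col y)))
      (map_mat f (0\<^sub>m (dim_row y) 1)) (map_mat f y)"
    unfolding bsum_def
    by (subst map_four_block_mat[of _ 1 1 _ "dim_col y" _ "dim_row y"]) auto
  moreover have "map_mat f (0\<^sub>m k l) = 0\<^sub>m k l" for k l
    using assms by (intro eq_matI) auto
  ultimately show ?thesis by (simp add: bsum_def map_mat_sing)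
qed

lemma bsum_inject:
  assumes "A \<in> carrier_mat n n" "B \<in> carrier_mat m m" "B' \<in> carrier_mat m m" "bsum A B = bsum A B'"
  shows "B = B'"
proof (rule eq_matI)
  fix i j assume "i < dim_row B'" "j < dim_col B'"
  then have "B $$ (i, j) = bsum A B $$ (n + i, n + j)" "B' $$ (i, j) = bsum A B' $$ (n + i, n + j)"
    using assms(1-3) by (auto simp: bsum_def)
  then show "B $$ (i, j) = B' $$ (i, j)" using assms(4) by simp
qed (use assms in auto)

lemma ext_sym_space_iff:
  fixes a :: "'a::field"
  assumes "y \<in> carrier_mat n n"
  shows "ext a y \<in> sym_space (Suc n) \<longleftrightarrow> a \<noteq> 0 \<and> y \<in> sym_space n"
proof
  assume *: "ext a y \<in> sym_space (Suc n)"
  then have "bsum (sing a) (transpose_mat y) = bsum (sing a) y"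
    using assms by (simp add: sym_space_iff transpose_bsum[of _ 1 _ n])
  from bsum_inject[OF _ _ _ this, of 1 n] assms have "transpose_mat y = y" by simp
  then show "a \<noteq> 0 \<and> y \<in> sym_space n" using * assms by (auto simp: sym_space_iff det_ext)
qed (use ext_sym_space in blast)

lemma sing_mult: "r \<in> carrier_mat 1 n \<Longrightarrow> sing t * r = t \<cdot>\<^sub>m r" for t :: "'a::field"
  by (rule eq_matI) (auto simp: sing_def scalar_prod_def)

lemma mult_sing: "c \<in> carrier_mat n 1 \<Longrightarrow> c * sing t = t \<cdot>\<^sub>m c" for t :: "'a::field"
  by (rule eq_matI) (auto simp: sing_def scalar_prod_def mult.commute)

lemma sing_mult_sing [simp]: "sing a * sing b = sing (a * b)" for a :: "'a::field"
  by (rule eq_matI) (auto simp: sing_def scalar_prod_def)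

lemma GL_first_column_aux:
  fixes v :: "'a::field vec"
  assumes "v \<in> carrier_vec (Suc n)" "v $ 0 \<noteq> 0"
  shows "\<exists>g \<in> carrier (GL (Suc n)). col g 0 = v"
proof -
  define g where "g = four_block_mat (sing (v $ 0)) (0\<^sub>m 1 n) (mat n 1 (\<lambda>(i, j). v $ Suc i)) (1\<^sub>m n)"
  have "g \<in> carrier_mat (1 + n) (1 + n)" unfolding g_def by (intro four_block_carrier_mat) auto
  moreover have "det g = v $ 0"
    unfolding g_def by (subst det_four_block_mat_upper_right_zero[of _ 1 _ n]) auto
  moreover have "col g 0 = v"
    by (rule eq_vecI) (use assms in \<open>auto simp: g_def sing_def\<close>)
  ultimately show ?thesis using assms(2) by (auto simp: GL_iff)
qed

text \<open>A vanishing first entry is replaced by a nonzero entry \<open>v $ k\<close>; subtracting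
  row \<open>k\<close> from row \<open>0\<close> afterwards restores it.\<close>

lemma GL_first_column:
  fixes v :: "'a::field vec"
  assumes v: "v \<in> carrier_vec (Suc n)" "v \<noteq> 0\<^sub>v (Suc n)"
  shows "\<exists>g \<in> carrier (GL (Suc n)). col g 0 = v"
proof (cases "v $ 0 = 0")
  case False
  then show ?thesis using GL_first_column_aux v by blast
next
  case True
  obtain k where k: "k < Suc n" "v $ k \<noteq> 0" using v by (metis eq_vecI index_zero_vec carrier_vecD)
  with True have k0: "k \<noteq> 0" by metis
  define w where "w = vec (Suc n) (\<lambda>i. if i = 0 then v $ k else v $ i)"
  obtain g where g: "g \<in> carrier (GL (Suc n))" "col g 0 = w"
    using GL_first_column_aux[of w n] k by (auto simp: w_def)
  define h where "h = addrow (- 1) 0 k g"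
  have gc: "g \<in> carrier_mat (Suc n) (Suc n)" "det g \<noteq> 0" using g(1) by (auto simp: GL_iff)
  have "g $$ (i, 0) = w $ i" if "i < Suc n" for i using g(2) gc that by auto
  then have "col h 0 = v" using gc k k0 v True
    by (intro eq_vecI) (auto simp: h_def mat_addrow_def w_def)
  moreover have "h \<in> carrier (GL (Suc n))"
    using gc k k0 by (simp add: GL_iff h_def det_addrow)
  ultimately show ?thesis by blast
qed

text \<open>The vector may be zero, so \<open>0\<close> is always a value; splitting arguments
  therefore ask for \<open>t \<noteq> 0\<close>.\<close>

definition represents :: "'a::field mat \<Rightarrow> 'a \<Rightarrow> bool" where
  "represents y t \<longleftrightarrow> (\<exists>v \<in> carrier_vec (dim_row y). v \<bullet> (y *\<^sub>v v) = t)"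

lemma star_0_0:
  fixes y :: "'a::field mat"
  assumes "g \<in> carrier_mat n (Suc m)" "y \<in> carrier_mat n n"
  shows "star g y $$ (0, 0) = col g 0 \<bullet> (y *\<^sub>v col g 0)"
proof -
  have "star g y = transpose_mat g * (y * g)"
    unfolding star_def using assms by (intro assoc_mult_mat[of _ "Suc m" n _ n _ "Suc m"]) auto
  also have "\<dots> $$ (0, 0) = col g 0 \<bullet> col (y * g) 0" using assms by simp
  also have "col (y * g) 0 = y *\<^sub>v col g 0" using assms by (intro col_mult2[of _ n n _ "Suc m"]) auto
  finally show ?thesis .
qed

text \<open>Completing the square with pivot \<open>t\<close>: the unipotent \<open>h\<close> clears
  the first row and column, and \<open>B'\<close> is the Schur complement.\<close>

lemma split_off_corner:
  fixes M :: "'a::field mat"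
  assumes M: "M \<in> sym_space (Suc n)" and t: "M $$ (0, 0) = t" "t \<noteq> 0"
  shows "\<exists>y' \<in> sym_space n. cong_mat (Suc n) M (ext t y')"
proof -
  have Mc: "M \<in> carrier_mat (Suc n) (Suc n)" and Ms: "transpose_mat M = M"
    using M by (auto simp: sym_space_iff)
  have Mij: "M $$ (i, j) = M $$ (j, i)" if "i < Suc n" "j < Suc n" for i j
    using Ms Mc that by (metis carrier_matD index_transpose_mat(1))
  define r where "r = mat 1 n (\<lambda>(i, j). M $$ (0, Suc j))"
  define B where "B = mat n n (\<lambda>(i, j). M $$ (Suc i, Suc j))"
  define h where "h = four_block_mat (1\<^sub>m 1) ((- 1 / t) \<cdot>\<^sub>m r) (0\<^sub>m n 1) (1\<^sub>m n)"
  define B' where "B' = (- 1 / t) \<cdot>\<^sub>m (transpose_mat r * r) + B"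
  have c: "r \<in> carrier_mat 1 n" "B \<in> carrier_mat n n" "B' \<in> carrier_mat n n"
    "transpose_mat r \<in> carrier_mat n 1" by (auto simp: r_def B_def B'_def)
  have Mb: "M = four_block_mat (sing t) r (transpose_mat r) B"
    by (rule eq_matI) (use Mc Mij t in \<open>auto simp: r_def B_def sing_def\<close>)
  have hc: "h \<in> carrier_mat (1 + n) (1 + n)" unfolding h_def by (intro four_block_carrier_mat) auto
  have det_h: "det h = 1"
    unfolding h_def using c by (subst det_four_block_mat_lower_left_zero[of _ 1 _ n]) auto
  have ht: "transpose_mat h = four_block_mat (1\<^sub>m 1) (0\<^sub>m 1 n) ((- 1 / t) \<cdot>\<^sub>m transpose_mat r) (1\<^sub>m n)"
    unfolding h_def using c
    by (subst transpose_four_block_mat[of _ 1 1 _ n _ n]) (auto simp: transpose_smult)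
  have "M * h = four_block_mat (sing t) (0\<^sub>m 1 n) (transpose_mat r) B'"
  proof -
    have "M * h = four_block_mat (sing t * 1\<^sub>m 1 + r * 0\<^sub>m n 1)
      (sing t * ((- 1 / t) \<cdot>\<^sub>m r) + r * 1\<^sub>m n) (transpose_mat r * 1\<^sub>m 1 + B * 0\<^sub>m n 1)
      (transpose_mat r * ((- 1 / t) \<cdot>\<^sub>m r) + B * 1\<^sub>m n)"
      unfolding Mb h_def using c by (intro mult_four_block_mat[of _ 1 1 _ n _ n]) auto
    also have "sing t * ((- 1 / t) \<cdot>\<^sub>m r) + r * 1\<^sub>m n = 0\<^sub>m 1 n"
      using c t(2) sing_mult[of "(- 1 / t) \<cdot>\<^sub>m r" n t] by (intro eq_matI) auto
    also have "transpose_mat r * ((- 1 / t) \<cdot>\<^sub>m r) + B * 1\<^sub>m n = B'"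
      using c by (simp add: B'_def mult_smult_distrib[of _ n 1 _ n])
    finally show ?thesis using c by simp
  qed
  then have "star h M = transpose_mat h * four_block_mat (sing t) (0\<^sub>m 1 n) (transpose_mat r) B'"
    unfolding star_def using hc Mc by (subst assoc_mult_mat[of _ "Suc n" "Suc n" _ "Suc n" _ "Suc n"]) auto
  also have "\<dots> = four_block_mat (1\<^sub>m 1 * sing t + 0\<^sub>m 1 n * transpose_mat r)
      (1\<^sub>m 1 * 0\<^sub>m 1 n + 0\<^sub>m 1 n * B')
      ((- 1 / t) \<cdot>\<^sub>m transpose_mat r * sing t + 1\<^sub>m n * transpose_mat r)
      ((- 1 / t) \<cdot>\<^sub>m transpose_mat r * 0\<^sub>m 1 n + 1\<^sub>m n * B')"
    unfolding ht using c by (intro mult_four_block_mat[of _ 1 1 _ n _ n]) auto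
  also have "(- 1 / t) \<cdot>\<^sub>m transpose_mat r * sing t + 1\<^sub>m n * transpose_mat r = 0\<^sub>m n 1"
    using c t(2) mult_sing[of "(- 1 / t) \<cdot>\<^sub>m transpose_mat r" n t] by (intro eq_matI) auto
  finally have eq: "star h M = ext t B'" using c by (simp add: bsum_def)
  have hGL: "h \<in> carrier (GL (Suc n))" using hc det_h by (simp add: GL_iff)
  have "ext t B' \<in> sym_space (Suc n)" using star_in_sym_space[OF hGL M] eq by simp
  then have "B' \<in> sym_space n" using ext_sym_space_iff c by blast
  then show ?thesis using eq hGL unfolding cong_mat_def by metis
qed

lemma split_off:
  fixes y :: "'a::field mat"
  assumes y: "y \<in> sym_space (Suc n)" and t: "represents y t" "t \<noteq> 0"
  shows "\<exists>y' \<in> sym_space n. cong_mat (Suc n) y (ext t y')"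
proof -
  have yc: "y \<in> carrier_mat (Suc n) (Suc n)" using y by (simp add: sym_space_iff)
  obtain v where v: "v \<in> carrier_vec (Suc n)" "v \<bullet> (y *\<^sub>v v) = t"
    using t(1) yc by (auto simp: represents_def)
  have "v \<noteq> 0\<^sub>v (Suc n)" using v t(2) yc by auto
  then obtain g where g: "g \<in> carrier (GL (Suc n))" "col g 0 = v" using GL_first_column v by blast
  have "star g y $$ (0, 0) = t" using g v yc by (subst star_0_0[of _ "Suc n" n]) (auto simp: GL_iff)
  then obtain y' where "y' \<in> sym_space n" "cong_mat (Suc n) (star g y) (ext t y')"
    using split_off_corner[OF star_in_sym_space[OF g(1) y]] t(2) by blast
  moreover have "cong_mat (Suc n) y (star g y)" using g unfolding cong_mat_def by blast
  ultimately show ?thesis using cong_mat_trans[OF yc] by blast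
qed

text \<open>
  Writing the congruence as a block matrix with rows \<open>(\<alpha>, r)\<close> and \<open>(c, k)\<close>, where \<open>\<alpha> \<noteq> - 1\<close> after a
  change of sign, the matrix \<open>k - c r / (1 + \<alpha>)\<close> carries \<open>y\<close> to \<open>y'\<close>.
\<close>

lemma witt_cancellation:
  fixes y :: "'a::field_char_0 mat"
  assumes y: "y \<in> sym_space n" and y': "y' \<in> sym_space n" and a: "a \<noteq> 0"
    and cong: "cong_mat (Suc n) (ext a y) (ext a y')"
  shows "cong_mat n y y'"
proof -
  have yc: "y \<in> carrier_mat n n" "transpose_mat y = y" "det y \<noteq> 0"
    and y'c: "y' \<in> carrier_mat n n" "det y' \<noteq> 0" using y y' by (auto simp: sym_space_iff)
  \<comment> \<open>If the corner entry is \<open>- 1\<close>, that of the negated matrix is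
    \<open>1\<close>, which differs from \<open>- 1\<close> in characteristic zero.\<close>
  have "\<exists>g \<in> carrier_mat (Suc n) (Suc n). ext a y' = star g (ext a y) \<and> g $$ (0, 0) \<noteq> - 1"
  proof -
    obtain g where g: "g \<in> carrier_mat (Suc n) (Suc n)" "ext a y' = star g (ext a y)"
      using cong by (auto simp: cong_mat_def GL_iff)
    have "star ((- 1) \<cdot>\<^sub>m g) (ext a y) = star g (ext a y)"
      using g(1) yc(1) by (intro star_uminus) auto
    then show ?thesis using g
      by (cases "g $$ (0, 0) = - 1") (auto intro: bexI[of _ "(- 1) \<cdot>\<^sub>m g"] bexI[of _ g])
  qed
  then obtain g where gc: "g \<in> carrier_mat (Suc n) (Suc n)" and g: "ext a y' = star g (ext a y)"
    and g0: "g $$ (0, 0) \<noteq> - 1" by blast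
  define \<alpha> where "\<alpha> = g $$ (0, 0)"
  define r where "r = mat 1 n (\<lambda>(i, j). g $$ (0, Suc j))"
  define c where "c = mat n 1 (\<lambda>(i, j). g $$ (Suc i, 0))"
  define k where "k = mat n n (\<lambda>(i, j). g $$ (Suc i, Suc j))"
  have car: "r \<in> carrier_mat 1 n" "c \<in> carrier_mat n 1" "k \<in> carrier_mat n n"
    by (auto simp: r_def c_def k_def)
  have gb: "g = four_block_mat (sing \<alpha>) r c k"
    by (rule eq_matI) (use gc in \<open>auto simp: \<alpha>_def r_def c_def k_def sing_def\<close>)
  have gt: "transpose_mat g = four_block_mat (sing \<alpha>) (transpose_mat c) (transpose_mat r) (transpose_mat k)"
    unfolding gb using car by (subst transpose_four_block_mat[of _ 1 1 _ n _ n]) auto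
  have "ext a y * g = four_block_mat (sing a * sing \<alpha> + 0\<^sub>m 1 n * c) (sing a * r + 0\<^sub>m 1 n * k)
      (0\<^sub>m n 1 * sing \<alpha> + y * c) (0\<^sub>m n 1 * r + y * k)"
    unfolding bsum_def gb using car yc by (subst mult_four_block_mat[of _ 1 1 _ n _ n]) auto
  also have "\<dots> = four_block_mat (sing (a * \<alpha>)) (a \<cdot>\<^sub>m r) (y * c) (y * k)"
    using car yc sing_mult[OF car(1)] by (intro cong_four_block_mat) auto
  finally have qg: "ext a y * g = four_block_mat (sing (a * \<alpha>)) (a \<cdot>\<^sub>m r) (y * c) (y * k)" .
  have "star g (ext a y) = transpose_mat g * (ext a y * g)"
    unfolding star_def using gc yc by (intro assoc_mult_mat[of _ "Suc n" "Suc n" _ "Suc n" _ "Suc n"]) auto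
  also have "\<dots> = four_block_mat
      (sing \<alpha> * sing (a * \<alpha>) + transpose_mat c * (y * c)) (sing \<alpha> * (a \<cdot>\<^sub>m r) + transpose_mat c * (y * k))
      (transpose_mat r * sing (a * \<alpha>) + transpose_mat k * (y * c))
      (transpose_mat r * (a \<cdot>\<^sub>m r) + transpose_mat k * (y * k))"
    unfolding gt qg using car yc by (intro mult_four_block_mat[of _ 1 1 _ n _ n]) auto
  finally have blocks: "ext a y' = \<dots>" using g by simp
  \<comment> \<open>Comparing the four blocks at once requires an index below \<open>n\<close>,
    which is why \<open>n = 0\<close> is treated separately.\<close>
  have ent: "X $$ (i, j) = A $$ (i, j)" "Y $$ (i, j') = B $$ (i, j')"
    "Z $$ (i', j) = C $$ (i', j)" "W $$ (i', j') = D $$ (i', j')"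
    if "four_block_mat X Y Z W = four_block_mat A B C D" "i < 1" "j < 1" "i' < n" "j' < n"
      "X \<in> carrier_mat 1 1" "Y \<in> carrier_mat 1 n" "Z \<in> carrier_mat n 1" "W \<in> carrier_mat n n"
      "A \<in> carrier_mat 1 1" "B \<in> carrier_mat 1 n" "C \<in> carrier_mat n 1" "D \<in> carrier_mat n n"
    for X Y Z W A B C D :: "'a mat" and i j i' j'
  proof -
    have "four_block_mat X Y Z W $$ p = four_block_mat A B C D $$ p" for p using that(1) by simp
    from this[of "(i, j)"] this[of "(i, Suc j')"] this[of "(Suc i', j)"] this[of "(Suc i', Suc j')"]
    show "X $$ (i, j) = A $$ (i, j)" "Y $$ (i, j') = B $$ (i, j')"
      "Z $$ (i', j) = C $$ (i', j)" "W $$ (i', j') = D $$ (i', j')"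
      using that(2-) by auto
  qed
  define S where "S = transpose_mat c * (y * c)"
  define P where "P = transpose_mat c * (y * k)"
  define Q where "Q = transpose_mat k * (y * c)"
  define K where "K = transpose_mat k * (y * k)"
  define R where "R = transpose_mat r * r"
  have car2: "S \<in> carrier_mat 1 1" "P \<in> carrier_mat 1 n" "Q \<in> carrier_mat n 1" "K \<in> carrier_mat n n"
    "R \<in> carrier_mat n n"
    using car yc by (auto simp: S_def P_def Q_def K_def R_def)
  note bl = blocks[folded S_def P_def Q_def K_def, unfolded bsum_def]
  have e1: "S = sing (a - a * \<alpha>\<^sup>2)" if "n > 0"
  proof -
    have "S $$ (0, 0) = a - a * \<alpha>\<^sup>2"
      using ent(1)[OF bl, of 0 0 0 0] that car car2 yc y'c
      by (simp add: sing_mult[of _ 1] power2_eq_square algebra_simps)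
    then show ?thesis using mat_1_1[OF car2(1)] by simp
  qed
  have e2: "P = (- a * \<alpha>) \<cdot>\<^sub>m r"
  proof (rule eq_matI)
    fix i j assume "i < dim_row ((- a * \<alpha>) \<cdot>\<^sub>m r)" "j < dim_col ((- a * \<alpha>) \<cdot>\<^sub>m r)"
    then have ij: "i < 1" "j < n" using car by auto
    have eq: "sing \<alpha> * (a \<cdot>\<^sub>m r) = \<alpha> \<cdot>\<^sub>m (a \<cdot>\<^sub>m r)" using car by (intro sing_mult) auto
    have "0 = (\<alpha> \<cdot>\<^sub>m (a \<cdot>\<^sub>m r) + P) $$ (i, j)"
      using ent(2)[OF bl, of i 0 0 j] ij car car2 yc y'c unfolding eq by auto
    then have "a * \<alpha> * r $$ (i, j) + P $$ (i, j) = 0" using ij car car2 by (simp add: mult_ac)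
    then show "P $$ (i, j) = ((- a * \<alpha>) \<cdot>\<^sub>m r) $$ (i, j)"
      using ij car by (simp add: eq_neg_iff_add_eq_0 add.commute)
  qed (use car car2 in auto)
  have e3: "Q = (- a * \<alpha>) \<cdot>\<^sub>m transpose_mat r"
  proof -
    have "Q = transpose_mat P"
      unfolding P_def Q_def using car yc
      by (simp add: transpose_mult[of _ 1 n _ n] transpose_mult[of _ n n _ n] assoc_mult_mat[of _ n n _ n _ 1])
    then show ?thesis by (simp add: e2 transpose_smult)
  qed
  have e4: "K = y' - a \<cdot>\<^sub>m R"
  proof (rule eq_matI)
    fix i j assume "i < dim_row (y' - a \<cdot>\<^sub>m R)" "j < dim_col (y' - a \<cdot>\<^sub>m R)"
    then have ij: "i < n" "j < n" using car2 by auto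
    have eq: "transpose_mat r * (a \<cdot>\<^sub>m r) = a \<cdot>\<^sub>m R"
      unfolding R_def using car by (intro mult_smult_distrib) auto
    have "y' $$ (i, j) = (a \<cdot>\<^sub>m R + K) $$ (i, j)"
      using ent(4)[OF bl, of 0 0 i j] ij car car2 yc y'c unfolding eq by auto
    then show "K $$ (i, j) = (y' - a \<cdot>\<^sub>m R) $$ (i, j)"
      using ij car2 y'c by simp
  qed (use car2 in auto)
  show ?thesis
  proof (cases "n = 0")
    case True
    have "y = y'" by (rule eq_matI) (use True yc y'c in auto)
    then show ?thesis using cong_mat_refl yc by auto
  next
    case False
    define l where "l = 1 / (1 + \<alpha>)"
    have l: "l * (1 + \<alpha>) = 1"
    proof -
      have "1 + \<alpha> \<noteq> 0" using g0 add_eq_0_iff[of 1 \<alpha>] by (simp add: \<alpha>_def)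
      then show ?thesis by (simp add: l_def)
    qed
    \<comment> \<open>Origin of the formula: the reflection along the sum of the first basis vector
      and its image under \<open>g\<close> sends that image to minus the first basis vector;
      composed with \<open>g\<close> it acts on the complement as \<open>k'\<close>. The sum is
      anisotropic because its value is \<open>2 a (1 + \<alpha>)\<close>.\<close>
    define k' where "k' = k - l \<cdot>\<^sub>m (c * r)"
    have k'c: "k' \<in> carrier_mat n n" unfolding k'_def using mult_carrier_mat[OF car(2,1)] by (auto intro!: minus_carrier_mat)
    have "star k' y = transpose_mat k' * (y * k')"
      unfolding star_def using k'c yc by (intro assoc_mult_mat[of _ n n _ n _ n]) auto
    also have "y * k' = y * k - l \<cdot>\<^sub>m ((y * c) * r)"
      unfolding k'_def using car yc
      by (simp add: mult_minus_distrib_mat[of _ n n _ n] mult_smult_distrib[of _ n n _ n] assoc_mult_mat[of _ n n _ 1 _ n])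
    also have "transpose_mat k' = transpose_mat k - l \<cdot>\<^sub>m (transpose_mat r * transpose_mat c)"
      unfolding k'_def using car by (simp add: transpose_minus transpose_smult transpose_mult[of _ n 1 _ n])
    also have "(transpose_mat k - l \<cdot>\<^sub>m (transpose_mat r * transpose_mat c)) * (y * k - l \<cdot>\<^sub>m ((y * c) * r))
      = transpose_mat k * (y * k) - l \<cdot>\<^sub>m (transpose_mat k * (y * c) * r)
        - (l \<cdot>\<^sub>m (transpose_mat r * (transpose_mat c * (y * k)))
          - (l * l) \<cdot>\<^sub>m (transpose_mat r * ((transpose_mat c * (y * c)) * r)))"
    proof -
      have A: "transpose_mat k * ((y * c) * r) = transpose_mat k * (y * c) * r"
        using car yc by (intro assoc_mult_mat[symmetric, of _ n n _ 1 _ n]) auto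
      have B: "transpose_mat r * transpose_mat c * (y * k) = transpose_mat r * (transpose_mat c * (y * k))"
        using car yc by (intro assoc_mult_mat[of _ n 1 _ n _ n]) auto
      have "transpose_mat r * transpose_mat c * ((y * c) * r) = transpose_mat r * (transpose_mat c * ((y * c) * r))"
        using car yc by (intro assoc_mult_mat[of _ n 1 _ n _ n]) auto
      also have "transpose_mat c * ((y * c) * r) = (transpose_mat c * (y * c)) * r"
        using car yc by (intro assoc_mult_mat[symmetric, of _ 1 n _ 1 _ n]) auto
      finally have C: "transpose_mat r * transpose_mat c * ((y * c) * r)
        = transpose_mat r * ((transpose_mat c * (y * c)) * r)" .
      show ?thesis using car yc by (subst mult_minus_smult[of _ n]) (auto simp only: A B C intro!: mult_carrier_mat transpose_carrier_mat[THEN iffD2])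
    qed
    also have "\<dots> = K - l \<cdot>\<^sub>m (Q * r) - (l \<cdot>\<^sub>m (transpose_mat r * P) - (l * l) \<cdot>\<^sub>m (transpose_mat r * (S * r)))"
      by (simp add: K_def Q_def P_def S_def)
    also have "Q * r = (- a * \<alpha>) \<cdot>\<^sub>m R" using car by (simp add: e3 R_def mult_smult_assoc_mat[of _ n 1 _ n])
    also have "transpose_mat r * P = (- a * \<alpha>) \<cdot>\<^sub>m R" using car by (simp add: e2 R_def mult_smult_distrib[of _ n 1 _ n])
    also have "transpose_mat r * (S * r) = (a - a * \<alpha>\<^sup>2) \<cdot>\<^sub>m R"
      using car False by (simp add: e1 sing_mult[of _ n] R_def mult_smult_distrib[of _ n 1 _ n])
    also have "K - l \<cdot>\<^sub>m ((- a * \<alpha>) \<cdot>\<^sub>m R) -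
      (l \<cdot>\<^sub>m ((- a * \<alpha>) \<cdot>\<^sub>m R) - (l * l) \<cdot>\<^sub>m ((a - a * \<alpha>\<^sup>2) \<cdot>\<^sub>m R)) = y'"
    proof (rule eq_matI)
      fix i j assume ij: "i < dim_row y'" "j < dim_col y'"
      define x where "x = R $$ (i, j)"
      \<comment> \<open>The coefficient of \<open>R\<close> cancels because
        \<open>l * (1 + \<alpha>) = 1\<close>.\<close>
      have "l * l * (a - a * \<alpha>\<^sup>2) = l * (1 + \<alpha>) * (l * a * (1 - \<alpha>))"
        by (simp add: power2_eq_square algebra_simps)
      also have "\<dots> = l * a * (1 - \<alpha>)" by (simp add: l)
      finally have "- a + 2 * l * a * \<alpha> + l * l * (a - a * \<alpha>\<^sup>2) = a * (l * (1 + \<alpha>) - 1)"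
        by (simp add: algebra_simps)
      then have "- a + 2 * l * a * \<alpha> + l * l * (a - a * \<alpha>\<^sup>2) = 0" by (simp add: l)
      then have "y' $$ (i, j) + (- a + 2 * l * a * \<alpha> + l * l * (a - a * \<alpha>\<^sup>2)) * x = y' $$ (i, j)" by simp
      then show "(K - l \<cdot>\<^sub>m ((- a * \<alpha>) \<cdot>\<^sub>m R) -
        (l \<cdot>\<^sub>m ((- a * \<alpha>) \<cdot>\<^sub>m R) - (l * l) \<cdot>\<^sub>m ((a - a * \<alpha>\<^sup>2) \<cdot>\<^sub>m R))) $$ (i, j) = y' $$ (i, j)"
        using ij car2 y'c by (simp add: e4 x_def algebra_simps)
    qed (use car2 y'c in auto)
    finally have st: "star k' y = y'" .
    then have "(det k')\<^sup>2 * det y = det y'" using det_star[OF k'c yc(1)] by simp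
    then have "det k' \<noteq> 0" using y'c(2) by auto
    then show ?thesis unfolding cong_mat_def using st k'c by (intro bexI[of _ k']) (auto simp: GL_iff)
  qed
qed

section \<open>Classes of given rank and discriminant\<close>

lemma represents_ext:
  fixes y :: "'a::field mat"
  assumes y: "y \<in> carrier_mat n n"
  shows "represents (ext a y) t \<longleftrightarrow> (\<exists>x s. represents y s \<and> t = a * x\<^sup>2 + s)"
proof -
  have ext: "(u @\<^sub>v w) \<bullet> (ext a y *\<^sub>v (u @\<^sub>v w)) = a * (u $ 0)\<^sup>2 + w \<bullet> (y *\<^sub>v w)"
    if "u \<in> carrier_vec 1" "w \<in> carrier_vec n" for u w
  proof -
    have "ext a y *\<^sub>v (u @\<^sub>v w) = (sing a *\<^sub>v u + 0\<^sub>m 1 n *\<^sub>v w) @\<^sub>v (0\<^sub>m n 1 *\<^sub>v u + y *\<^sub>v w)"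
      unfolding bsum_def using that y by (subst four_block_mat_mult_vec[of _ 1 1 _ n _ n]) auto
    also have "0\<^sub>m 1 n *\<^sub>v w = 0\<^sub>v 1" using that by (auto intro!: eq_vecI)
    also have "0\<^sub>m n 1 *\<^sub>v u = 0\<^sub>v n" using that by (auto intro!: eq_vecI)
    also have "(sing a *\<^sub>v u + 0\<^sub>v 1) @\<^sub>v (0\<^sub>v n + y *\<^sub>v w) = (sing a *\<^sub>v u) @\<^sub>v (y *\<^sub>v w)"
      using that y right_zero_vec[OF mult_mat_vec_carrier[OF sing_carrier(1) that(1)], of a] by simp
    finally have "(u @\<^sub>v w) \<bullet> (ext a y *\<^sub>v (u @\<^sub>v w)) = u \<bullet> (sing a *\<^sub>v u) + w \<bullet> (y *\<^sub>v w)"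
      using that y scalar_prod_append[OF that mult_mat_vec_carrier[OF sing_carrier(1) that(1)], of "y *\<^sub>v w" a]
      by simp
    moreover have "u \<bullet> (sing a *\<^sub>v u) = a * (u $ 0)\<^sup>2"
      using that by (simp add: scalar_prod_def sing_def power2_eq_square)
    ultimately show ?thesis by simp
  qed
  show ?thesis
  proof
    assume "represents (ext a y) t"
    then obtain v where v: "v \<in> carrier_vec (1 + n)" "v \<bullet> (ext a y *\<^sub>v v) = t"
      using y by (auto simp: represents_def bsum_def)
    define u w where "u = vec_first v 1" and "w = vec_last v n"
    have uw: "u \<in> carrier_vec 1" "w \<in> carrier_vec n" "v = u @\<^sub>v w"
      using v by (auto simp: u_def w_def)
    have "t = a * (u $ 0)\<^sup>2 + w \<bullet> (y *\<^sub>v w)" using v(2) ext[OF uw(1,2)] uw(3) by simp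
    moreover have "represents y (w \<bullet> (y *\<^sub>v w))" using uw y by (auto simp: represents_def)
    ultimately show "\<exists>x s. represents y s \<and> t = a * x\<^sup>2 + s" by blast
  next
    assume "\<exists>x s. represents y s \<and> t = a * x\<^sup>2 + s"
    then obtain x w where w: "w \<in> carrier_vec n" "t = a * x\<^sup>2 + w \<bullet> (y *\<^sub>v w)"
      using y by (auto simp: represents_def)
    define u where "u = vec 1 (\<lambda>_. x)"
    have "u \<in> carrier_vec 1" "u $ 0 = x" by (auto simp: u_def)
    then have "u @\<^sub>v w \<in> carrier_vec (1 + n)" "(u @\<^sub>v w) \<bullet> (ext a y *\<^sub>v (u @\<^sub>v w)) = t"
      using ext[of u w] w append_carrier_vec[of u 1 w n] by auto
    then show "represents (ext a y) t" using y by (auto simp: represents_def bsum_def)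
  qed
qed

lemma represents_zero: "y \<in> carrier_mat n n \<Longrightarrow> represents y 0" for y :: "'a::field mat"
  by (auto simp: represents_def intro!: bexI[of _ "0\<^sub>v n"])

lemma represents_sing: "represents (sing b) s \<longleftrightarrow> (\<exists>z. s = b * z\<^sup>2)" for b :: "'a::field"
proof -
  have eq: "v \<bullet> (sing b *\<^sub>v v) = b * (v $ 0)\<^sup>2" if "v \<in> carrier_vec 1" for v
    using that by (simp add: scalar_prod_def sing_def power2_eq_square)
  show ?thesis
  proof
    assume "\<exists>z. s = b * z\<^sup>2"
    then obtain z where "s = b * z\<^sup>2" by blast
    then show "represents (sing b) s" using eq[of "vec 1 (\<lambda>_. z)"]
      by (auto simp: represents_def intro!: bexI[of _ "vec 1 (\<lambda>_. z)"])
  qed (auto simp: represents_def eq)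
qed

text \<open>Evaluating \<open>star g y\<close> at \<open>v\<close> is evaluating \<open>y\<close> at
  \<open>g v\<close>.\<close>

lemma represents_cong:
  fixes y :: "'a::field mat"
  assumes y: "y \<in> carrier_mat n n" and c: "cong_mat n y z"
  shows "represents y t \<longleftrightarrow> represents z t"
proof -
  have imp: "represents y t" if y: "y \<in> carrier_mat n n" and c: "cong_mat n y z" and r: "represents z t"
    for y z :: "'a mat"
  proof -
    obtain g where g: "g \<in> carrier_mat n n" "z = star g y" using c by (auto simp: cong_mat_def GL_iff)
    obtain v where v: "v \<in> carrier_vec n" "v \<bullet> (z *\<^sub>v v) = t" using r g y by (auto simp: represents_def star_def)
    have "z *\<^sub>v v = transpose_mat g *\<^sub>v (y *\<^sub>v (g *\<^sub>v v))"
      unfolding g(2) star_def using g(1) y v(1)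
      by (simp add: assoc_mult_mat_vec[of _ n n _ n])
    then have "v \<bullet> (z *\<^sub>v v) = (transpose_mat g *\<^sub>v (y *\<^sub>v (g *\<^sub>v v))) \<bullet> v"
      using g y v by (simp add: comm_scalar_prod[of _ n])
    also have "\<dots> = (y *\<^sub>v (g *\<^sub>v v)) \<bullet> (g *\<^sub>v v)"
      using g y v by (intro transpose_vec_mult_scalar[of _ n n]) auto
    also have "\<dots> = (g *\<^sub>v v) \<bullet> (y *\<^sub>v (g *\<^sub>v v))"
      using g y v by (intro comm_scalar_prod[of _ n]) auto
    finally show ?thesis using v g y by (auto simp: represents_def intro!: bexI[of _ "g *\<^sub>v v"])
  qed
  have "z \<in> carrier_mat n n" using c y by (auto simp: cong_mat_def GL_iff)
  then show ?thesis using imp[OF y c] imp[OF _ cong_mat_sym[OF y c]] by blast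
qed

text \<open>Polarization: if all values vanish, so do the diagonal entries and then
  \<open>2 * y $$ (i, j)\<close>, hence the whole matrix.\<close>

lemma represents_nonzero:
  fixes y :: "'a::field_char_0 mat"
  assumes y: "y \<in> sym_space (Suc n)" shows "\<exists>t. t \<noteq> 0 \<and> represents y t"
proof (rule ccontr)
  assume "\<not> ?thesis"
  then have neg: "represents y t \<Longrightarrow> t = 0" for t by blast
  have yc: "y \<in> carrier_mat (Suc n) (Suc n)" "transpose_mat y = y" "det y \<noteq> 0"
    using y by (auto simp: sym_space_iff)
  have ys: "y $$ (i, j) = y $$ (j, i)" if "i < Suc n" "j < Suc n" for i j
    using yc that by (metis carrier_matD index_transpose_mat(1))
  have q: "v \<bullet> (y *\<^sub>v v) = 0" if "v \<in> carrier_vec (Suc n)" for v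
    using neg that yc by (auto simp: represents_def)
  have unit: "y *\<^sub>v unit_vec (Suc n) i = col y i" if "i < Suc n" for i
    using yc that by (intro eq_vecI) auto
  have d: "y $$ (i, i) = 0" if "i < Suc n" for i
    using q[of "unit_vec (Suc n) i"] yc that by (simp add: unit)
  have "y $$ (i, j) = 0" if ij: "i < Suc n" "j < Suc n" for i j
  proof -
    let ?u = "unit_vec (Suc n) i" and ?w = "unit_vec (Suc n) j"
    have "y *\<^sub>v (?u + ?w) = col y i + col y j"
      using yc ij by (simp add: mult_add_distrib_mat_vec[of _ "Suc n" "Suc n"] unit)
    then have "(?u + ?w) \<bullet> (y *\<^sub>v (?u + ?w)) = y $$ (i, i) + y $$ (i, j) + (y $$ (j, i) + y $$ (j, j))"
      using yc ij by (simp add: add_scalar_prod_distrib[of _ "Suc n"] scalar_prod_add_distrib[of _ "Suc n"])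
    then have "2 * y $$ (i, j) = 0" using q[of "?u + ?w"] d ij ys[OF ij] by simp
    then show ?thesis by simp
  qed
  then have "y = 0\<^sub>m (Suc n) (Suc n)" by (intro eq_matI) (use yc in auto)
  then show False using yc(3) by simp
qed

lemma sym_space_split:
  fixes y :: "'a::field_char_0 mat"
  assumes "y \<in> sym_space (Suc n)"
  shows "\<exists>a y'. a \<noteq> 0 \<and> y' \<in> sym_space n \<and> cong_mat (Suc n) y (ext a y')"
  using represents_nonzero[OF assms] split_off[OF assms] by blast

section \<open>Forms of prescribed discriminant\<close>

definition sym_with_disc :: "nat \<Rightarrow> 'a::field \<Rightarrow> 'a mat set" where
  "sym_with_disc n D = {y \<in> sym_space n. \<exists>c. c \<noteq> 0 \<and> det y = D * c\<^sup>2}"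

lemma sym_with_disc_cong:
  assumes "y \<in> sym_with_disc n D" "cong_mat n y z" shows "z \<in> sym_with_disc n D"
proof -
  have y: "y \<in> sym_space n" using assms by (simp add: sym_with_disc_def)
  obtain c where c: "c \<noteq> 0" "det y = D * c\<^sup>2" using assms by (auto simp: sym_with_disc_def)
  obtain g where g: "g \<in> carrier (GL n)" "z = star g y" using assms by (auto simp: cong_mat_def)
  have "det z = (det g)\<^sup>2 * det y"
    using g y by (auto simp: GL_iff sym_space_iff intro!: det_star)
  then have "det z = D * (det g * c)\<^sup>2" by (simp add: c(2) power_mult_distrib mult_ac)
  moreover have "det g * c \<noteq> 0" using g c by (auto simp: GL_iff)
  ultimately show ?thesis using cong_mat_sym_space[OF y assms(2)] unfolding sym_with_disc_def by blast
qed

lemma sym_with_disc_ext: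
  assumes "t \<noteq> 0" "y \<in> sym_with_disc n D" shows "ext t y \<in> sym_with_disc (Suc n) (t * D)"
proof -
  obtain c where "c \<noteq> 0" "det y = D * c\<^sup>2" using assms by (auto simp: sym_with_disc_def)
  moreover have "y \<in> sym_space n" using assms by (auto simp: sym_with_disc_def)
  ultimately show ?thesis using assms(1) ext_sym_space[of t y n]
    by (auto simp: sym_with_disc_def sym_space_iff det_ext mult.assoc)
qed

text \<open>The complement has discriminant \<open>D / t\<close>, in the same square class as
  \<open>D * t\<close>.\<close>

lemma sym_with_disc_split:
  assumes y: "y \<in> sym_with_disc (Suc n) D" and t: "represents y t" "t \<noteq> 0"
  shows "\<exists>y' \<in> sym_with_disc n (D * t). cong_mat (Suc n) y (ext t y')"
proof -
  have "y \<in> sym_space (Suc n)" using y by (simp add: sym_with_disc_def)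
  then obtain y' where y': "y' \<in> sym_space n" "cong_mat (Suc n) y (ext t y')"
    using split_off t by blast
  have "ext t y' \<in> sym_with_disc (Suc n) D" using sym_with_disc_cong y y' by blast
  then obtain c where c: "c \<noteq> 0" "det (ext t y') = D * c\<^sup>2" by (auto simp: sym_with_disc_def)
  have "t * det y' = D * c\<^sup>2" using c y' by (auto simp: det_ext[of _ n] sym_space_iff)
  then have "det y' = D * t * (c / t)\<^sup>2" using t(2) by (simp add: field_simps power2_eq_square)
  moreover have "c / t \<noteq> 0" using c t by simp
  ultimately show ?thesis using y' unfolding sym_with_disc_def by blast
qed

text \<open>The inductive step of a classification: after a common value is split off, only
  complements of equal discriminant remain to be compared.\<close>

lemma cong_mat_common_value:
  assumes y: "y \<in> sym_with_disc (Suc n) D" "represents y t"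
    and z: "z \<in> sym_with_disc (Suc n) D" "represents z t" and t: "t \<noteq> 0"
    and IH: "\<And>y' z'. y' \<in> sym_with_disc n (D * t) \<Longrightarrow> z' \<in> sym_with_disc n (D * t) \<Longrightarrow>
      cong_mat (Suc n) y (ext t y') \<Longrightarrow> cong_mat (Suc n) z (ext t z') \<Longrightarrow> cong_mat n y' z'"
  shows "cong_mat (Suc n) y z"
proof -
  obtain y' where y': "y' \<in> sym_with_disc n (D * t)" "cong_mat (Suc n) y (ext t y')"
    using sym_with_disc_split[OF y t] by blast
  obtain z' where z': "z' \<in> sym_with_disc n (D * t)" "cong_mat (Suc n) z (ext t z')"
    using sym_with_disc_split[OF z t] by blast
  have car: "y \<in> carrier_mat (Suc n) (Suc n)" "z \<in> carrier_mat (Suc n) (Suc n)"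
    "y' \<in> carrier_mat n n" using y z y' by (auto simp: sym_with_disc_def sym_space_iff)
  have "cong_mat (Suc n) (ext t y') (ext t z')"
    using IH[OF y'(1) z'(1) y'(2) z'(2)] car by (intro cong_mat_ext)
  then show ?thesis using cong_mat_trans y'(2) cong_mat_sym[OF car(2) z'(2)] car(1) by blast
qed

lemma cong_mat_rank_one:
  assumes y: "y \<in> sym_with_disc 1 D" and z: "z \<in> sym_with_disc 1 D"
  shows "cong_mat 1 y z"
proof -
  obtain c where c: "c \<noteq> 0" "det y = D * c\<^sup>2" using y by (auto simp: sym_with_disc_def)
  obtain b where b: "b \<noteq> 0" "det z = D * b\<^sup>2" using z by (auto simp: sym_with_disc_def)
  have "y \<in> carrier_mat 1 1" "z \<in> carrier_mat 1 1"
    using y z by (auto simp: sym_with_disc_def sym_space_iff)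
  then have *: "y = sing (D * c\<^sup>2)" "z = sing (D * b\<^sup>2)"
    using c b mat_1_1[of y] mat_1_1[of z] by (metis det_sing)+
  have "z = star (sing (b / c)) y" using c by (simp add: * power_divide mult.commute)
  moreover have "sing (b / c) \<in> carrier (GL 1)" using b c by (simp add: GL_iff)
  ultimately show ?thesis unfolding cong_mat_def by blast
qed

lemma rank_two_diagonal:
  fixes D :: "'a::field_char_0"
  assumes y: "y \<in> sym_with_disc 2 D"
  shows "\<exists>a b. a \<noteq> 0 \<and> b \<noteq> 0 \<and> cong_mat 2 y (ext a (sing b)) \<and> (\<exists>c. c \<noteq> 0 \<and> a * b = D * c\<^sup>2)"
proof -
  have 2: "2 = Suc 1" by simp
  have "y \<in> sym_space (Suc 1)" using y unfolding 2 by (simp add: sym_with_disc_def)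
  then obtain a where a: "a \<noteq> 0" "represents y a" using represents_nonzero by blast
  then obtain y' where y': "y' \<in> sym_with_disc 1 (D * a)" "cong_mat 2 y (ext a y')"
    using sym_with_disc_split[OF y[unfolded 2]] unfolding 2 by blast
  then have "y' \<in> sym_space 1" by (simp add: sym_with_disc_def)
  then obtain b where b: "y' = sing b" "b \<noteq> 0" using mat_1_1[of y'] by (auto simp: sym_space_iff) (metis det_sing)
  have "ext a (sing b) \<in> sym_with_disc 2 D" using sym_with_disc_cong[OF y] y' b by simp
  then show ?thesis using a b y' by (auto simp: sym_with_disc_def det_ext[of _ 1])
qed

lemma represents_diag2: "represents (ext a (sing b)) t \<longleftrightarrow> (\<exists>x z. a * x\<^sup>2 + b * z\<^sup>2 = t)"
  for a :: "'a::field"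
  by (auto simp: represents_ext[of _ 1] represents_sing)

text \<open>The nonzero values form a coset of the norm group for \<open>- D\<close>; this coset is
  the invariant that separates classes of rank two.\<close>

lemma rank_two_represents:
  fixes D :: "'a::field_char_0"
  assumes y: "y \<in> sym_with_disc 2 D"
  shows "\<exists>a. a \<noteq> 0 \<and> (\<forall>t. represents y t \<longleftrightarrow> hil (- D) (a * t))"
proof -
  obtain a b c where ab: "a \<noteq> 0" "b \<noteq> 0" "cong_mat 2 y (ext a (sing b))" "c \<noteq> 0" "a * b = D * c\<^sup>2"
    using rank_two_diagonal[OF y] by blast
  have "y \<in> carrier_mat 2 2" using y by (simp add: sym_with_disc_def sym_space_iff)
  then have "represents y t \<longleftrightarrow> hil (- (a * b)) (a * t)" for t
    using represents_cong[OF _ ab(3)] ab(1) by (simp add: represents_diag2 binary_represents)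
  moreover have "- (a * b) = (- D) * c\<^sup>2" using ab(5) by simp
  ultimately have "represents y t \<longleftrightarrow> hil (- D) (a * t)" for t
    using hil_square_mult_left[OF ab(4), of "- D"] by simp
  then show ?thesis using ab(1) by blast
qed

text \<open>The complements of a common value have rank one and equal discriminant, so they are
  congruent.\<close>

lemma cong_mat_rank_two:
  fixes D :: "'a::field_char_0"
  assumes "y \<in> sym_with_disc 2 D" "z \<in> sym_with_disc 2 D" "represents y t" "represents z t" "t \<noteq> 0"
  shows "cong_mat 2 y z"
  using cong_mat_common_value[of y 1 D t z] cong_mat_rank_one assms by (auto simp: numeral_2_eq_2)

text \<open>All symbols of the square \<open>- D\<close> are trivial, so both forms represent
  \<open>1\<close>.\<close>

lemma hyperbolic_plane_unique:
  fixes D :: "'a::field_char_0"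
  assumes "y \<in> sym_with_disc 2 D" "z \<in> sym_with_disc 2 D" and D: "D \<noteq> 0" "- D = w\<^sup>2"
  shows "cong_mat 2 y z"
proof -
  have "w \<noteq> 0" using D by auto
  then have "hil (- D) x" for x using hil_of_square D(2) by metis
  then have "represents y 1" "represents z 1" using rank_two_represents assms(1,2) by blast+
  then show ?thesis using cong_mat_rank_two assms(1,2) by (metis one_neq_zero)
qed

section \<open>Counting classes over the local field\<close>

context nonarch_local_field
begin

text \<open>Splitting off lines exposes four diagonal entries, or three whose product is
  \<open>det y\<close> up to squares; the results on diagonal forms then apply.\<close>

lemma represents_rank_ge_3:
  fixes y :: "'a mat"
  assumes y: "y \<in> sym_space (Suc (Suc (Suc n)))" and t: "t \<noteq> 0"
    and n: "n \<ge> 1 \<or> (\<nexists>z. - (det y * t) = z\<^sup>2)"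
  shows "represents y t"
proof -
  obtain a y1 where 1: "a \<noteq> 0" "y1 \<in> sym_space (Suc (Suc n))" "cong_mat (Suc (Suc (Suc n))) y (ext a y1)"
    using sym_space_split[OF y] by blast
  obtain b y2 where 2: "b \<noteq> 0" "y2 \<in> sym_space (Suc n)" "cong_mat (Suc (Suc n)) y1 (ext b y2)"
    using sym_space_split[OF 1(2)] by blast
  obtain c y3 where 3: "c \<noteq> 0" "y3 \<in> sym_space n" "cong_mat (Suc n) y2 (ext c y3)"
    using sym_space_split[OF 2(2)] by blast
  have car: "y \<in> carrier_mat (Suc (Suc (Suc n))) (Suc (Suc (Suc n)))"
    "y1 \<in> carrier_mat (Suc (Suc n)) (Suc (Suc n))" "y2 \<in> carrier_mat (Suc n) (Suc n)"
    "y3 \<in> carrier_mat n n" using y 1 2 3 by (auto simp: sym_space_iff)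
  have rep: "represents y (a * x1\<^sup>2 + (b * x2\<^sup>2 + (c * x3\<^sup>2 + s)))" if "represents y3 s" for x1 x2 x3 s
  proof -
    have "represents y2 (c * x3\<^sup>2 + s)"
      using represents_cong[OF car(3) 3(3)] represents_ext[OF car(4)] that by blast
    then have "represents y1 (b * x2\<^sup>2 + (c * x3\<^sup>2 + s))"
      using represents_cong[OF car(2) 2(3)] represents_ext[OF car(3)] by blast
    then show ?thesis using represents_cong[OF car(1) 1(3)] represents_ext[OF car(2)] by blast
  qed
  show ?thesis
  proof (cases n)
    case 0
    have det1: "\<exists>e. e \<noteq> 0 \<and> det z = (det y) * e\<^sup>2"
      if c: "cong_mat m y z" and yc: "y \<in> carrier_mat m m" for m and y z :: "'a mat"
    proof -
      obtain g where "g \<in> carrier (GL m)" "z = star g y" using c unfolding cong_mat_def by blast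
      then have "det g \<noteq> 0 \<and> det z = det y * (det g)\<^sup>2"
        using yc by (simp add: GL_iff det_star[of _ m] mult.commute)
      then show ?thesis by blast
    qed
    have "det y3 = 1" using car(4) 0 by (simp add: det_dim_zero)
    then have "det (ext c y3) = c" using det_ext[OF car(4)] by simp
    then obtain e3 where e3: "e3 \<noteq> 0" "c = det y2 * e3\<^sup>2" using det1[OF 3(3) car(3)] by auto
    obtain e2 where e2: "e2 \<noteq> 0" "b * det y2 = det y1 * e2\<^sup>2"
      using det1[OF 2(3) car(2)] det_ext[OF car(3)] by auto
    obtain e1 where e1: "e1 \<noteq> 0" "a * det y1 = det y * e1\<^sup>2"
      using det1[OF 1(3) car(1)] det_ext[OF car(2)] by auto
    have "a * b * c * t = a * (b * det y2) * t * e3\<^sup>2" using e3 by (simp add: mult_ac)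
    also have "\<dots> = det y * t * (e1 * e2 * e3)\<^sup>2"
      using e1 e2 by (simp add: power_mult_distrib mult_ac)
    finally have abct: "a * b * c * t = det y * t * (e1 * e2 * e3)\<^sup>2" .
    have "\<nexists>z. - (a * b * c * t) = z\<^sup>2"
    proof
      assume "\<exists>z. - (a * b * c * t) = z\<^sup>2"
      then obtain z where "- (a * b * c * t) = z\<^sup>2" by blast
      then have "- (det y * t) = (z / (e1 * e2 * e3))\<^sup>2"
        using e1(1) e2(1) e3(1) unfolding abct by (simp add: power_divide field_simps)
      then show False using n 0 by auto
    qed
    then obtain x y z where "a * x\<^sup>2 + b * y\<^sup>2 + c * z\<^sup>2 = t"
      using ternary_represents 1(1) 2(1) 3(1) t by blast
    then have "t = a * x\<^sup>2 + (b * y\<^sup>2 + (c * z\<^sup>2 + 0))" by (simp add: add_ac)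
    then show ?thesis using rep[OF represents_zero[OF car(4)]] by blast
  next
    case (Suc m)
    obtain f y4 where 4: "f \<noteq> 0" "y4 \<in> sym_space m" "cong_mat n y3 (ext f y4)"
      using sym_space_split[of y3 m] 3(2) Suc by blast
    have car4: "y4 \<in> carrier_mat m m" using 4 by (auto simp: sym_space_iff)
    obtain x y z w where "a * x\<^sup>2 + b * y\<^sup>2 + c * z\<^sup>2 + f * w\<^sup>2 = t"
      using quaternary_represents[OF 1(1) 2(1) 3(1) 4(1) t] by blast
    then have "t = a * x\<^sup>2 + (b * y\<^sup>2 + (c * z\<^sup>2 + (f * w\<^sup>2 + 0)))" by (simp add: add_ac)
    moreover have "represents y3 (f * w\<^sup>2 + 0)"
      using represents_cong[OF car(4) 4(3)] represents_ext[OF car4] represents_zero[OF car4] by blast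
    ultimately show ?thesis using rep by simp
  qed
qed

text \<open>In rank two, three cosets of a subgroup of index at most two cannot be distinct. In
  higher rank a common value \<open>t\<close> is split off.\<close>

lemma at_most_two_classes:
  fixes D :: 'a
  assumes "D \<noteq> 0" "y1 \<in> sym_with_disc (Suc (Suc n)) D" "y2 \<in> sym_with_disc (Suc (Suc n)) D"
    "y3 \<in> sym_with_disc (Suc (Suc n)) D"
  shows "cong_mat (Suc (Suc n)) y1 y2 \<or> cong_mat (Suc (Suc n)) y2 y3 \<or> cong_mat (Suc (Suc n)) y1 y3"
  using assms
proof (induction n arbitrary: D y1 y2 y3)
  case 0
  then have y: "y1 \<in> sym_with_disc 2 D" "y2 \<in> sym_with_disc 2 D" "y3 \<in> sym_with_disc 2 D"
    by (simp_all add: numeral_2_eq_2)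
  obtain a1 where a1: "a1 \<noteq> 0" "\<And>t. represents y1 t \<longleftrightarrow> hil (- D) (a1 * t)" using rank_two_represents[OF y(1)] by blast
  obtain a2 where a2: "a2 \<noteq> 0" "\<And>t. represents y2 t \<longleftrightarrow> hil (- D) (a2 * t)" using rank_two_represents[OF y(2)] by blast
  obtain a3 where a3: "a3 \<noteq> 0" "\<And>t. represents y3 t \<longleftrightarrow> hil (- D) (a3 * t)" using rank_two_represents[OF y(3)] by blast
  have self: "hil (- D) (a * a)" for a using hil_square by (metis power2_eq_square)
  have D: "- D \<noteq> 0" using 0 by simp
  have "hil (- D) (a1 * a2) \<or> hil (- D) (a2 * a3) \<or> hil (- D) (a1 * a3)"
    using hil_mult_eq[OF D] a1(1) a2(1) a3(1) by blast
  then show ?case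
    using cong_mat_rank_two[OF y(1,2), of a2] cong_mat_rank_two[OF y(2,3), of a3]
      cong_mat_rank_two[OF y(1,3), of a3] a1 a2 a3 self by (auto simp: numeral_2_eq_2)
next
  case (Suc n)
  \<comment> \<open>This \<open>t\<close> is represented by every form of discriminant
    \<open>D\<close>: in rank three by the condition on \<open>- D * t\<close>, in larger rank in
    any case.\<close>
  obtain t where t: "t \<noteq> 0" "\<nexists>z. - D * t = z\<^sup>2" using ex_nonsquare_mult[of "- D"] Suc.prems(1) by auto
  have rep: "represents y t" if y: "y \<in> sym_with_disc (Suc (Suc (Suc n))) D" for y
  proof (rule represents_rank_ge_3)
    show "y \<in> sym_space (Suc (Suc (Suc n)))" using y by (simp add: sym_with_disc_def)
    obtain c where c: "c \<noteq> 0" "det y = D * c\<^sup>2" using y by (auto simp: sym_with_disc_def)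
    have "\<nexists>z. - (det y * t) = z\<^sup>2"
    proof
      assume "\<exists>z. - (det y * t) = z\<^sup>2"
      then obtain z where "- (det y * t) = z\<^sup>2" by blast
      then have "- D * t = (z / c)\<^sup>2" using c by (simp add: power_divide field_simps)
      then show False using t(2) by blast
    qed
    then show "n \<ge> 1 \<or> (\<nexists>z. - (det y * t) = z\<^sup>2)" by blast
  qed (use t in simp)
  let ?N = "Suc (Suc n)"
  have ex: "\<exists>y' \<in> sym_with_disc ?N (D * t). cong_mat (Suc ?N) y (ext t y')"
    if "y \<in> sym_with_disc (Suc ?N) D" for y
    using sym_with_disc_split[OF that rep[OF that] t(1)] .
  obtain z1 z2 z3 where z: "z1 \<in> sym_with_disc ?N (D * t)" "cong_mat (Suc ?N) y1 (ext t z1)"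
    "z2 \<in> sym_with_disc ?N (D * t)" "cong_mat (Suc ?N) y2 (ext t z2)"
    "z3 \<in> sym_with_disc ?N (D * t)" "cong_mat (Suc ?N) y3 (ext t z3)"
    using ex[OF Suc.prems(2)] ex[OF Suc.prems(3)] ex[OF Suc.prems(4)] by blast
  have lift: "cong_mat (Suc ?N) x y" if "cong_mat (Suc ?N) x (ext t u)" "cong_mat (Suc ?N) y (ext t w)"
    "cong_mat ?N u w" "x \<in> sym_with_disc (Suc ?N) D" "y \<in> sym_with_disc (Suc ?N) D"
    "u \<in> sym_with_disc ?N (D * t)" for x y u w :: "'a mat"
  proof -
    have car: "x \<in> carrier_mat (Suc ?N) (Suc ?N)" "y \<in> carrier_mat (Suc ?N) (Suc ?N)" "u \<in> carrier_mat ?N ?N"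
      using that by (auto simp: sym_with_disc_def sym_space_iff)
    show ?thesis
      using cong_mat_trans[OF car(1) cong_mat_trans[OF car(1) that(1) cong_mat_ext[OF car(3) that(3)]]
        cong_mat_sym[OF car(2) that(2)]] .
  qed
  have "D * t \<noteq> 0" using t Suc.prems by simp
  from Suc.IH[OF this z(1,3,5)] show ?case using lift z Suc.prems by blast
qed

text \<open>In rank two, if \<open>u\<close> is not a norm for \<open>- D\<close>, the diagonal
  forms with entries \<open>1, D\<close> and \<open>u, u D\<close> are told apart by the value
  \<open>u\<close>. Witt cancellation transports inequivalence to higher rank.\<close>

lemma at_least_two_classes:
  fixes D :: 'a
  assumes "D \<noteq> 0" "n \<ge> 1 \<or> (\<nexists>z. - D = z\<^sup>2)"
  shows "\<exists>y1 \<in> sym_with_disc (Suc (Suc n)) D. \<exists>y2 \<in> sym_with_disc (Suc (Suc n)) D.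
    \<not> cong_mat (Suc (Suc n)) y1 y2"
  using assms
proof (induction n arbitrary: D)
  case 0
  then obtain u where u: "u \<noteq> 0" "\<not> hil (- D) u" using hil_nonsquare(1)[of "- D"] by auto
  have "det (ext 1 (sing D)) = D * 1\<^sup>2" "det (ext u (sing (u * D))) = D * u\<^sup>2"
    by (simp_all add: det_ext[of _ 1] power2_eq_square algebra_simps)
  moreover have "ext 1 (sing D) \<in> sym_space 2" "ext u (sing (u * D)) \<in> sym_space 2"
    using 0 u by (simp_all add: ext_sym_space sing_sym_space numeral_2_eq_2)
  ultimately have "ext 1 (sing D) \<in> sym_with_disc 2 D" "ext u (sing (u * D)) \<in> sym_with_disc 2 D"
    using u(1) unfolding sym_with_disc_def mem_Collect_eq by (metis one_neq_zero)+
  moreover have "\<not> cong_mat 2 (ext 1 (sing D)) (ext u (sing (u * D)))"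
  proof
    assume c: "cong_mat 2 (ext 1 (sing D)) (ext u (sing (u * D)))"
    have car: "ext 1 (sing D) \<in> carrier_mat 2 2" using ext_carrier[of "sing D" 1 1] by (simp add: numeral_2_eq_2)
    have "u * 1\<^sup>2 + u * D * 0\<^sup>2 = u" by simp
    then have "represents (ext u (sing (u * D))) u" unfolding represents_diag2 by blast
    then have "represents (ext 1 (sing D)) u" using represents_cong[OF car c] by blast
    then show False using u(2) binary_represents[of 1 D u] unfolding represents_diag2 by simp
  qed
  ultimately show ?case by (auto simp: numeral_2_eq_2)
next
  case (Suc n)
  \<comment> \<open>Then \<open>- D / t\<close> is not a square either, so the induction hypothesis
    applies to the discriminant \<open>D / t\<close> even in rank two.\<close>
  obtain t where t: "t \<noteq> 0" "\<nexists>z. - D * t = z\<^sup>2" using ex_nonsquare_mult[of "- D"] Suc.prems(1) by auto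
  let ?N = "Suc (Suc n)"
  have "\<nexists>z. - (D / t) = z\<^sup>2"
  proof
    assume "\<exists>z. - (D / t) = z\<^sup>2"
    then obtain z where "- (D / t) = z\<^sup>2" by blast
    then have "- D * t = (z * t)\<^sup>2" using t(1) by (simp add: power_mult_distrib power2_eq_square field_simps)
    then show False using t(2) by blast
  qed
  moreover have "D / t \<noteq> 0" using t Suc.prems by simp
  ultimately obtain y1 y2 where y: "y1 \<in> sym_with_disc ?N (D / t)" "y2 \<in> sym_with_disc ?N (D / t)"
    "\<not> cong_mat ?N y1 y2" using Suc.IH by blast
  then have "\<not> cong_mat (Suc ?N) (ext t y1) (ext t y2)"
    using witt_cancellation[of y1 ?N y2 t] t(1) by (auto simp: sym_with_disc_def)
  moreover have "ext t y1 \<in> sym_with_disc (Suc ?N) D" "ext t y2 \<in> sym_with_disc (Suc ?N) D"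
    using sym_with_disc_ext[OF t(1) y(1)] sym_with_disc_ext[OF t(1) y(2)] t(1) by simp_all
  ultimately show ?case by blast
qed

end

section \<open>Cancellation, reflections and orbits\<close>

lemma mat_assoc:
  "A \<in> carrier_mat n n \<Longrightarrow> B \<in> carrier_mat n n \<Longrightarrow> C \<in> carrier_mat n n \<Longrightarrow>
    A * B * C = A * (B * C)" for A :: "'a::semiring_0 mat"
  by (rule assoc_mult_mat)

lemma GL_cancel_right:
  fixes A :: "'a::field mat"
  assumes "A \<in> carrier_mat n n" "B \<in> carrier_mat n n" "g \<in> carrier (GL n)" "A * g = B * g"
  shows "A = B"
proof -
  obtain h where h: "h \<in> carrier (GL n)" "g * h = 1\<^sub>m n" using GL_inverse[OF assms(3)] by metis
  have car: "g \<in> carrier_mat n n" "h \<in> carrier_mat n n" using assms(3) h(1) by (auto simp: GL_iff)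
  have "A * g * h = B * g * h" using assms(4) by simp
  then show ?thesis using assms(1,2) car h(2) by (simp add: mat_assoc[of _ n])
qed

lemma GL_cancel_left:
  fixes A :: "'a::field mat"
  assumes "A \<in> carrier_mat n n" "B \<in> carrier_mat n n" "g \<in> carrier (GL n)" "g * A = g * B"
  shows "A = B"
proof -
  obtain h where h: "h \<in> carrier (GL n)" "h * g = 1\<^sub>m n" using GL_inverse[OF assms(3)] by metis
  have car: "g \<in> carrier_mat n n" "h \<in> carrier_mat n n" using assms(3) h(1) by (auto simp: GL_iff)
  have "h * (g * A) = h * (g * B)" using assms(4) by simp
  then show ?thesis using assms(1,2) car h(2) by (simp add: mat_assoc[of _ n, symmetric])
qed

lemma star_inject:
  fixes A :: "'a::field mat"
  assumes A: "A \<in> carrier_mat n n" "B \<in> carrier_mat n n" and g: "g \<in> carrier (GL n)" "star g A = star g B"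
  shows "A = B"
proof -
  obtain h where h: "h \<in> carrier (GL n)" "g * h = 1\<^sub>m n" using GL_inverse[OF g(1)] by metis
  have car: "g \<in> carrier_mat n n" "h \<in> carrier_mat n n" using g(1) h(1) by (auto simp: GL_iff)
  have "star (g * h) A = star (g * h) B" using A car g(2) by (simp add: star_mult[of _ n n _ n])
  then show ?thesis using A h(2) by (simp add: star_one)
qed

lemma GL_inv:
  fixes g :: "'a::field mat"
  assumes "g \<in> carrier (GL n)"
  shows "inv\<^bsub>GL n\<^esub> g \<in> carrier (GL n)" "inv\<^bsub>GL n\<^esub> g * g = 1\<^sub>m n"
proof -
  interpret R: ring "ring_mat TYPE('a) n ()" by (rule ring_mat)
  interpret group "GL n :: 'a mat monoid" unfolding GL_def by (rule R.units_group)
  show "inv\<^bsub>GL n\<^esub> g \<in> carrier (GL n)" using assms by simp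
  have "inv\<^bsub>GL n\<^esub> g \<otimes>\<^bsub>GL n\<^esub> g = \<one>\<^bsub>GL n\<^esub>" using assms by (rule l_inv)
  then show "inv\<^bsub>GL n\<^esub> g * g = 1\<^sub>m n" by (simp add: GL_def units_of_def ring_mat_simps)
qed

text \<open>A sign change of the first coordinate of a split form, carried back by the
  congruence.\<close>

lemma ex_reflection:
  fixes y :: "'a::field_char_0 mat"
  assumes y: "y \<in> sym_space (Suc n)"
  shows "\<exists>s \<in> carrier_mat (Suc n) (Suc n). star s y = y \<and> det s = - 1"
proof -
  let ?N = "Suc n"
  obtain t y' where y': "y' \<in> sym_space n" "cong_mat ?N y (ext t y')" using sym_space_split[OF y] by blast
  obtain g where g: "g \<in> carrier (GL ?N)" "ext t y' = star g y" using y'(2) unfolding cong_mat_def by blast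
  obtain h where h: "h \<in> carrier (GL ?N)" "g * h = 1\<^sub>m ?N" using GL_inverse[OF g(1)] by metis
  define s :: "'a mat" where "s = bsum (sing (- 1)) (1\<^sub>m n)"
  have car: "g \<in> carrier_mat ?N ?N" "h \<in> carrier_mat ?N ?N" "y \<in> carrier_mat ?N ?N" "y' \<in> carrier_mat n n"
    "s \<in> carrier_mat ?N ?N"
    using g h y y' by (auto simp: GL_iff sym_space_iff s_def)
  have "star s (ext t y') = ext t y'"
    unfolding s_def using car by (subst star_bsum[of _ 1 _ n]) (auto simp: star_one)
  moreover have "star (g * s * h) y = star h (star s (star g y))"
    using car by (simp add: star_mult[of _ ?N ?N _ ?N])
  moreover have "star h (star g y) = y"
    using car h(2) star_mult[of g ?N ?N h ?N y] by (simp add: star_one)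
  ultimately have "star (g * s * h) y = y" by (simp add: g(2)[symmetric])
  moreover have "det (g * s * h) = - 1"
  proof -
    have "det s = - 1" unfolding s_def by (simp add: det_ext[of _ n])
    moreover have "det g * det h = 1" using car h(2) det_mult[of g ?N h] by simp
    ultimately show ?thesis using car by (simp add: det_mult[of _ ?N])
  qed
  ultimately show ?thesis using car by (intro bexI[of _ "g * s * h"]) auto
qed

lemma sq_class_eq_iff:
  fixes a b :: "'a::field"
  shows "sq_class a = sq_class b \<longleftrightarrow> (\<exists>c. c \<noteq> 0 \<and> a = b * c\<^sup>2)"
proof
  assume "sq_class a = sq_class b"
  moreover have "a \<in> sq_class a" unfolding sq_class_def by (auto intro: exI[of _ 1])
  ultimately show "\<exists>c. c \<noteq> 0 \<and> a = b * c\<^sup>2" by (auto simp: sq_class_def)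
next
  assume "\<exists>c. c \<noteq> 0 \<and> a = b * c\<^sup>2"
  then obtain c where c: "c \<noteq> 0" "a = b * c\<^sup>2" by blast
  show "sq_class a = sq_class b"
  proof (intro equalityI subsetI)
    fix x assume "x \<in> sq_class a"
    then obtain r where "r \<noteq> 0" "x = a * r\<^sup>2" by (auto simp: sq_class_def)
    then have "x = b * (c * r)\<^sup>2 \<and> c * r \<noteq> 0" using c by (simp add: power_mult_distrib)
    then show "x \<in> sq_class b" unfolding sq_class_def by blast
  next
    fix x assume "x \<in> sq_class b"
    then obtain r where "r \<noteq> 0" "x = b * r\<^sup>2" by (auto simp: sq_class_def)
    then have "x = a * (r / c)\<^sup>2 \<and> r / c \<noteq> 0" using c by (simp add: power_divide)
    then show "x \<in> sq_class a" unfolding sq_class_def by blast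
  qed
qed

lemma orbit_star: "orbit (GL n) star y = {z. cong_mat n y z}"
  unfolding orbit_def cong_mat_def by auto

lemma orbit_star_eq_iff:
  assumes "y \<in> carrier_mat n n" "z \<in> carrier_mat n n"
  shows "orbit (GL n) star y = orbit (GL n) star z \<longleftrightarrow> cong_mat n y z"
  unfolding orbit_star
  using cong_mat_refl[OF assms(2)] cong_mat_sym[OF assms(1)] cong_mat_trans[OF assms(1)]
    cong_mat_trans[OF assms(2)] by blast

text \<open>Discriminants are constant along orbits, so a condition on all members can be tested on
  one representative.\<close>

lemma sym_orbits_disc_eq:
  "sym_orbits_disc n (sq_class D) = orbit (GL n) star ` sym_with_disc n D"
proof -
  have disc: "disc y = sq_class D \<longleftrightarrow> (\<exists>c. c \<noteq> 0 \<and> det y = D * c\<^sup>2)" for y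
    unfolding disc_def by (rule sq_class_eq_iff)
  have "(\<forall>z \<in> orbit (GL n) star y. disc z = sq_class D) \<longleftrightarrow> y \<in> sym_with_disc n D"
    if y: "y \<in> sym_space n" for y
  proof
    assume *: "\<forall>z \<in> orbit (GL n) star y. disc z = sq_class D"
    have "y \<in> carrier_mat n n" using y by (simp add: sym_space_iff)
    then have "y \<in> orbit (GL n) star y" by (simp add: orbit_star cong_mat_refl)
    then show "y \<in> sym_with_disc n D" using * y disc by (auto simp: sym_with_disc_def)
  next
    assume "y \<in> sym_with_disc n D"
    then have "z \<in> sym_with_disc n D" if "z \<in> orbit (GL n) star y" for z
      using that sym_with_disc_cong by (auto simp: orbit_star)
    then show "\<forall>z \<in> orbit (GL n) star y. disc z = sq_class D" by (auto simp: disc sym_with_disc_def)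
  qed
  moreover have "sym_with_disc n D \<subseteq> sym_space n" by (auto simp: sym_with_disc_def)
  ultimately show ?thesis unfolding sym_orbits_disc_def sym_orbits_def orbits_def by blast
qed

text \<open>A relation takes the place of a map, because descent determines \<open>y\<close> only up
  to congruence; compatibility with both equivalences makes it a bijection of classes.\<close>

lemma card_image_correspondence:
  assumes "\<And>x. x \<in> A \<Longrightarrow> \<exists>y \<in> B. R x y" "\<And>y. y \<in> B \<Longrightarrow> \<exists>x \<in> A. R x y"
    and "\<And>x x' y y'. x \<in> A \<Longrightarrow> x' \<in> A \<Longrightarrow> y \<in> B \<Longrightarrow> y' \<in> B \<Longrightarrow> R x y \<Longrightarrow> R x' y' \<Longrightarrow>
      f x = f x' \<longleftrightarrow> g y = g y'"
  shows "card (f ` A) = card (g ` B)"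
proof -
  have "\<forall>x\<in>A. \<exists>y. y \<in> B \<and> R x y" using assms(1) by blast
  from bchoice[OF this] obtain s where "\<forall>x\<in>A. s x \<in> B \<and> R x (s x)" ..
  then have s: "s x \<in> B \<and> R x (s x)" if "x \<in> A" for x using that by blast
  define p where "p = inv_into A f"
  have p: "p c \<in> A \<and> f (p c) = c" if "c \<in> f ` A" for c
    using that by (simp add: p_def inv_into_into f_inv_into_f)
  have "bij_betw (\<lambda>c. g (s (p c))) (f ` A) (g ` B)"
  proof (rule bij_betw_imageI)
    show "inj_on (\<lambda>c. g (s (p c))) (f ` A)"
    proof (rule inj_onI)
      fix c c' assume c: "c \<in> f ` A" "c' \<in> f ` A" "g (s (p c)) = g (s (p c'))"
      have "f (p c) = f (p c')"
        using assms(3)[of "p c" "p c'" "s (p c)" "s (p c')"] p[OF c(1)] p[OF c(2)] s c(3) by blast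
      then show "c = c'" using p c by metis
    qed
    show "(\<lambda>c. g (s (p c))) ` (f ` A) = g ` B"
    proof (intro equalityI subsetI)
      fix b assume "b \<in> g ` B"
      then obtain y where y: "y \<in> B" "b = g y" by blast
      obtain x where x: "x \<in> A" "R x y" using assms(2) y(1) by blast
      have px: "p (f x) \<in> A" "f (p (f x)) = f x" using p x(1) by auto
      then have "g (s (p (f x))) = g y"
        using assms(3)[of "p (f x)" x "s (p (f x))" y] s x y(1) by blast
      then show "b \<in> (\<lambda>c. g (s (p c))) ` (f ` A)" using x(1) y(2) by force
    qed (use p s in auto)
  qed
  then show ?thesis by (rule bij_betw_same_card)
qed

lemma (in nonarch_local_field) card_sym_orbits_disc:
  fixes D :: 'a
  assumes D: "D \<noteq> 0" and n: "n \<ge> 1"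
  shows "card (sym_orbits_disc n (sq_class D)) = (if n = 1 \<or> n = 2 \<and> (\<exists>z. - D = z\<^sup>2) then 1 else 2)"
proof -
  let ?O = "orbit (GL n) star"
  have car: "y \<in> carrier_mat n n" if "y \<in> sym_with_disc n D" for y
    using that by (simp add: sym_with_disc_def sym_space_iff)
  have eq: "?O y = ?O z \<longleftrightarrow> cong_mat n y z" if "y \<in> sym_with_disc n D" "z \<in> sym_with_disc n D" for y z
    using orbit_star_eq_iff car that by blast
  have ex: "\<exists>y. y \<in> sym_with_disc (Suc m) D" for m
  proof (induction m)
    case 0
    have "sing D \<in> sym_with_disc (Suc 0) D" using D by (auto simp: sym_with_disc_def sing_sym_space intro: exI[of _ 1])
    then show ?case by blast
  next
    case (Suc m)
    then show ?case using sym_with_disc_ext[of 1 _ "Suc m" D] by auto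
  qed
  obtain m where m: "n = Suc m" using n by (cases n) auto
  obtain y0 where y0: "y0 \<in> sym_with_disc n D" using ex m by blast
  show ?thesis
  proof (cases "n = 1 \<or> n = 2 \<and> (\<exists>z. - D = z\<^sup>2)")
    case True
    have "cong_mat n y z" if "y \<in> sym_with_disc n D" "z \<in> sym_with_disc n D" for y z
      using True that D cong_mat_rank_one hyperbolic_plane_unique by blast
    then have "?O ` sym_with_disc n D = {?O y0}" using eq y0 by blast
    then show ?thesis using True by (simp add: sym_orbits_disc_eq)
  next
    case False
    then obtain k where k: "n = Suc (Suc k)" using m by (cases m) auto
    have "k \<ge> 1 \<or> (\<nexists>z. - D = z\<^sup>2)" using False k by auto
    then obtain y1 y2 where y: "y1 \<in> sym_with_disc n D" "y2 \<in> sym_with_disc n D" "\<not> cong_mat n y1 y2"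
      using at_least_two_classes[OF D] k by blast
    have "?O ` sym_with_disc n D = {?O y1, ?O y2}"
    proof -
      have "?O z \<in> {?O y1, ?O y2}" if z: "z \<in> sym_with_disc n D" for z
      proof -
        have "cong_mat n y1 z \<or> cong_mat n y2 z"
          using at_most_two_classes[OF D, of y1 k y2 z] y z unfolding k by blast
        then show ?thesis using eq[OF y(1) z] eq[OF y(2) z] by blast
      qed
      then show ?thesis using y by blast
    qed
    moreover have "?O y1 \<noteq> ?O y2" using eq y by blast
    ultimately show ?thesis using False by (simp add: sym_orbits_disc_eq)
  qed
qed

section \<open>Descent from the quadratic extension\<close>

locale local_quadratic = nonarch_local_field v + quadratic_extension emb gal
  for v :: "'f::field_char_0 \<Rightarrow> int" and emb :: "'f \<Rightarrow> 'e::field_char_0" and gal :: "'e \<Rightarrow> 'e" +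
  fixes \<iota> :: 'e and d :: 'f
  assumes iota_gen: "\<And>x. \<exists>a b. x = emb a + emb b * \<iota>"
    and iota_notin: "\<iota> \<notin> range emb"
    and iota_sq: "\<iota>\<^sup>2 = emb d"
begin

lemma iota_nonzero: "\<iota> \<noteq> 0"
  using iota_notin emb.hom_zero by (metis rangeI)

lemma emb_eq_iff: "emb a = emb b \<longleftrightarrow> a = b"
  by simp

text \<open>\<open>gal \<iota>\<close> is a square root of \<open>\<iota>^2\<close>, and the root
  \<open>\<iota>\<close> itself would make \<open>gal\<close> trivial, since \<open>\<iota>\<close>
  generates the extension.\<close>

lemma gal_iota: "gal \<iota> = - \<iota>"
proof -
  have "(gal \<iota>)\<^sup>2 = \<iota>\<^sup>2" using gal.hom_power[of \<iota> 2] by (simp add: iota_sq gal_emb)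
  moreover have "gal \<iota> \<noteq> \<iota>"
  proof
    assume "gal \<iota> = \<iota>"
    then have "gal x = x" for x
      using iota_gen[of x] by (auto simp: gal.hom_add gal.hom_mult gal_emb)
    then show False using gal_nontrivial by auto
  qed
  ultimately show ?thesis by (auto simp: power2_eq_iff)
qed

lemma gal_gal: "gal (gal x) = x"
proof -
  obtain a b where "x = emb a + emb b * \<iota>" using iota_gen by blast
  then show ?thesis by (simp add: gal.hom_add gal.hom_mult gal_emb gal_iota gal.hom_uminus gal.hom_minus)
qed

lemma gal_fixed: "gal x = x \<Longrightarrow> x \<in> range emb"
proof -
  assume *: "gal x = x"
  obtain a b where x: "x = emb a + emb b * \<iota>" using iota_gen by blast
  have "emb a - emb b * \<iota> = emb a + emb b * \<iota>"
    using * by (simp add: x gal.hom_add gal.hom_mult gal_emb gal_iota)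
  then have "2 * (emb b * \<iota>) = 0" by (simp add: algebra_simps)
  then have "b = 0" using iota_nonzero by simp
  then show ?thesis using x by simp
qed

text \<open>Multiplication by \<open>\<iota>\<close> exchanges antifixed and fixed elements.\<close>

lemma gal_antifixed: "gal x = - x \<Longrightarrow> \<exists>b. x = \<iota> * emb b"
proof -
  assume *: "gal x = - x"
  have "gal (x * \<iota>) = x * \<iota>" by (simp add: gal.hom_mult gal_iota *)
  then obtain a where "x * \<iota> = emb a" using gal_fixed by blast
  then have "x * (\<iota> * \<iota>) = \<iota> * emb a" by (simp add: mult_ac)
  then have "x * emb d = \<iota> * emb a" by (simp add: iota_sq[symmetric] power2_eq_square)
  moreover have "emb d \<noteq> 0" using iota_nonzero iota_sq by (metis power_not_zero)
  ultimately have "x = \<iota> * emb (a / d)" by (simp add: emb.hom_div field_simps)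
  then show ?thesis ..
qed

lemma d_nonsquare: "d \<noteq> z\<^sup>2"
proof
  assume "d = z\<^sup>2"
  then have "\<iota>\<^sup>2 = (emb z)\<^sup>2" by (simp add: iota_sq emb.hom_power)
  then have "\<iota> = emb z \<or> \<iota> = emb (- z)" by (simp add: power2_eq_iff emb.hom_uminus)
  then show False using iota_notin by blast
qed

lemma d_nonzero: "d \<noteq> 0"
  using d_nonsquare[of 0] by simp

text \<open>
  The ternary form with coefficients c, a, -ac represents d over the base field, so the norm form
  of the quaternion algebra (a, c) becomes isotropic over the extension.
\<close>

lemma hil_emb:
  assumes "a \<noteq> 0" "c \<noteq> 0" shows "hil (emb c) (emb a)"
proof -
  \<comment> \<open>With these coefficients the tested element is \<open>d (a c)^2\<close>, so the
    ternary criterion reduces to \<open>d\<close> not being a square.\<close>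
  have "\<nexists>z. - (c * a * (- (a * c)) * d) = z\<^sup>2"
  proof
    assume "\<exists>z. - (c * a * (- (a * c)) * d) = z\<^sup>2"
    then obtain z where "d * (a * c)\<^sup>2 = z\<^sup>2" by (auto simp: power2_eq_square mult_ac)
    then have "d = (z / (a * c))\<^sup>2" using assms by (simp add: power_divide field_simps)
    then show False using d_nonsquare by blast
  qed
  then obtain x y z where xyz: "c * x\<^sup>2 + a * y\<^sup>2 + (- (a * c)) * z\<^sup>2 = d"
    using ternary_represents[of c a "- (a * c)" d] assms d_nonzero by auto
  have "\<iota>\<^sup>2 = emb c * (emb x)\<^sup>2 + emb a * (emb y)\<^sup>2 - emb a * emb c * (emb z)\<^sup>2"
    by (simp add: iota_sq xyz[symmetric] emb.hom_add emb.hom_mult emb.hom_power emb.hom_uminus emb.hom_minus)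
  then have *: "\<iota>\<^sup>2 - emb c * (emb x)\<^sup>2 = emb a * ((emb y)\<^sup>2 - emb c * (emb z)\<^sup>2)"
    by (simp add: algebra_simps)
  have h1: "hil (emb c) (\<iota>\<^sup>2 - emb c * (emb x)\<^sup>2)" by (rule hilI) (rule refl)
  have h2: "hil (emb c) ((emb y)\<^sup>2 - emb c * (emb z)\<^sup>2)" by (rule hilI) (rule refl)
  show ?thesis
  proof (cases "(emb y)\<^sup>2 - emb c * (emb z)\<^sup>2 = 0")
    case False
    then show ?thesis using h1 hil_mult_iff[OF h2 False, of "emb a"] * by (simp add: mult.commute)
  next
    \<comment> \<open>If the second norm vanishes, so does the first, and then \<open>emb c\<close>
      is a square in the extension.\<close>
    case True
    then have "\<iota>\<^sup>2 = emb c * (emb x)\<^sup>2" using * by simp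
    moreover from this have "emb x \<noteq> 0" using iota_nonzero by auto
    ultimately have "emb c = (\<iota> / emb x)\<^sup>2" by (simp add: power_divide)
    moreover have "\<iota> / emb x \<noteq> 0" using iota_nonzero \<open>emb x \<noteq> 0\<close> by simp
    ultimately show ?thesis using hil_of_square by metis
  qed
qed

section \<open>Matrices over the extension\<close>

lemma embm_star:
  assumes "g \<in> carrier_mat n m" "y \<in> carrier_mat n n"
  shows "map_mat emb (star g y) = star (map_mat emb g) (map_mat emb y)"
proof -
  have "map_mat emb (star g y) = map_mat emb (transpose_mat g * y) * map_mat emb g"
    unfolding star_def using assms by (intro emb.mat_hom_mult) auto
  also have "map_mat emb (transpose_mat g * y) = map_mat emb (transpose_mat g) * map_mat emb y"
    using assms by (intro emb.mat_hom_mult) auto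
  finally show ?thesis by (simp add: star_def map_mat_transpose)
qed

lemma galm_star:
  assumes "g \<in> carrier_mat n m" "y \<in> carrier_mat n n"
  shows "map_mat gal (star g y) = star (map_mat gal g) (map_mat gal y)"
proof -
  have "map_mat gal (star g y) = map_mat gal (transpose_mat g * y) * map_mat gal g"
    unfolding star_def using assms by (intro gal.mat_hom_mult) auto
  also have "map_mat gal (transpose_mat g * y) = map_mat gal (transpose_mat g) * map_mat gal y"
    using assms by (intro gal.mat_hom_mult) auto
  finally show ?thesis by (simp add: star_def map_mat_transpose)
qed

lemma galm_mult:
  "A \<in> carrier_mat n n \<Longrightarrow> B \<in> carrier_mat n n \<Longrightarrow> map_mat gal (A * B) = map_mat gal A * map_mat gal B"
  by (rule gal.mat_hom_mult)

lemma galm_galm [simp]: "map_mat gal (map_mat gal A) = A"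
  by (rule eq_matI) (auto simp: gal_gal)

lemma galm_embm [simp]: "map_mat gal (map_mat emb A) = map_mat emb A"
  by (rule eq_matI) (auto simp: gal_emb)

lemma galm_fixed:
  assumes "map_mat gal A = A" shows "\<exists>B. A = map_mat emb B \<and> dim_row B = dim_row A \<and> dim_col B = dim_col A"
proof -
  have "\<exists>b. A $$ (i, j) = emb b" if "i < dim_row A" "j < dim_col A" for i j
  proof -
    have "gal (A $$ (i, j)) = map_mat gal A $$ (i, j)" using that by simp
    then show ?thesis using assms gal_fixed by fastforce
  qed
  then obtain f where f: "\<And>i j. i < dim_row A \<Longrightarrow> j < dim_col A \<Longrightarrow> A $$ (i, j) = emb (f i j)" by metis
  have "A = map_mat emb (mat (dim_row A) (dim_col A) (\<lambda>(i, j). f i j))" by (rule eq_matI) (auto simp: f)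
  then show ?thesis by (intro exI[of _ "mat (dim_row A) (dim_col A) (\<lambda>(i, j). f i j)"]) simp
qed

lemma embm_inject: "map_mat emb A = map_mat emb B \<Longrightarrow> A = B"
  by (rule emb.mat_hom_inj)

lemma embm_sym_space: "map_mat emb y \<in> sym_space n \<longleftrightarrow> y \<in> sym_space n"
proof -
  have "transpose_mat (map_mat emb y) = map_mat emb y \<longleftrightarrow> transpose_mat y = y"
    using embm_inject[of "transpose_mat y" y] by (auto simp: map_mat_transpose)
  then show ?thesis by (auto simp: sym_space_iff)
qed

lemma embm_cong_mat:
  assumes "y \<in> carrier_mat n n" "cong_mat n y z" shows "cong_mat n (map_mat emb y) (map_mat emb z)"
proof -
  obtain g where g: "g \<in> carrier (GL n)" "z = star g y" using assms(2) unfolding cong_mat_def by blast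
  then have "map_mat emb z = star (map_mat emb g) (map_mat emb y)" using assms(1) by (simp add: embm_star[of _ n n] GL_iff)
  moreover have "map_mat emb g \<in> carrier (GL n)" using g(1) by (simp add: GL_iff)
  ultimately show ?thesis unfolding cong_mat_def by blast
qed

lemma embm_ext: "map_mat emb (ext a y) = ext (emb a) (map_mat emb y)"
  by (rule map_mat_ext) simp

text \<open>Two diagonal entries \<open>a, b\<close> may be replaced by \<open>1, a b\<close>,
  because \<open>hil_emb\<close> makes the binary form represent \<open>1\<close>. The complement
  stays defined over the base field, so the splitting can be iterated.\<close>

lemma split_one_over_extension:
  assumes y: "y \<in> sym_space (Suc (Suc n))"
  shows "\<exists>w \<in> sym_space (Suc n). cong_mat (Suc (Suc n)) (map_mat emb y) (ext 1 (map_mat emb w))"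
proof -
  obtain a y1 where 1: "a \<noteq> 0" "y1 \<in> sym_space (Suc n)" "cong_mat (Suc (Suc n)) y (ext a y1)"
    using sym_space_split[OF y] by blast
  obtain b y2 where 2: "b \<noteq> 0" "y2 \<in> sym_space n" "cong_mat (Suc n) y1 (ext b y2)"
    using sym_space_split[OF 1(2)] by blast
  let ?N = "Suc (Suc n)"
  have car: "y \<in> carrier_mat ?N ?N" "y1 \<in> carrier_mat (Suc n) (Suc n)" "y2 \<in> carrier_mat n n"
    using y 1 2 by (auto simp: sym_space_iff)
  have "cong_mat ?N y (ext a (ext b y2))"
    using cong_mat_trans[OF car(1) 1(3) cong_mat_ext[OF car(2) 2(3)]] .
  then have c1: "cong_mat ?N (map_mat emb y) (ext (emb a) (ext (emb b) (map_mat emb y2)))"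
    using embm_cong_mat[OF car(1)] by (fastforce simp: embm_ext)
  let ?P = "ext (emb a) (sing (emb b))" and ?Q = "ext 1 (sing (emb (a * b)))"
  have PQ: "?P \<in> carrier_mat 2 2" "?Q \<in> carrier_mat 2 2"
    using ext_carrier[OF sing_carrier(1), of "emb a" "emb b"]
      ext_carrier[OF sing_carrier(1), of 1 "emb (a * b)"] by (simp_all add: numeral_2_eq_2)
  have "cong_mat 2 ?P ?Q"
  proof (rule cong_mat_rank_two[where t = 1 and D = "emb (a * b)"])
    have "?P \<in> sym_space 2" "?Q \<in> sym_space 2"
      using 1(1) 2(1) by (simp_all add: numeral_2_eq_2 ext_sym_space sing_sym_space)
    moreover have "det ?P = emb (a * b) * 1\<^sup>2" "det ?Q = emb (a * b) * 1\<^sup>2"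
      by (simp_all add: det_ext[of _ 1] emb.hom_mult)
    ultimately show "?P \<in> sym_with_disc 2 (emb (a * b))" "?Q \<in> sym_with_disc 2 (emb (a * b))"
      unfolding sym_with_disc_def mem_Collect_eq by (metis one_neq_zero)+
    have "hil (emb (- (a * b))) (emb a)" using 1(1) 2(1) by (intro hil_emb) auto
    then show "represents ?P 1"
      using binary_represents[of "emb a" "emb b" 1] 1(1)
      by (simp add: represents_diag2 emb.hom_mult emb.hom_uminus)
    have "1 * 1\<^sup>2 + emb (a * b) * 0\<^sup>2 = 1" by simp
    then show "represents ?Q 1" unfolding represents_diag2 by blast
  qed simp
  then have "cong_mat (2 + n) (bsum ?P (map_mat emb y2)) (bsum ?Q (map_mat emb y2))"
    using PQ car by (intro cong_mat_bsum cong_mat_refl) auto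
  then have "cong_mat ?N (ext (emb a) (ext (emb b) (map_mat emb y2))) (ext 1 (ext (emb (a * b)) (map_mat emb y2)))"
    by (simp add: bsum_assoc)
  moreover have "ext (emb (a * b)) (map_mat emb y2) = map_mat emb (ext (a * b) y2)" by (simp add: embm_ext)
  ultimately have "cong_mat ?N (map_mat emb y) (ext 1 (map_mat emb (ext (a * b) y2)))"
    using cong_mat_trans[OF _ c1] car(1) by simp
  moreover have "ext (a * b) y2 \<in> sym_space (Suc n)" using 1(1) 2 by (intro ext_sym_space) auto
  ultimately show ?thesis by blast
qed

text \<open>Splitting off \<open>1\<close> from both forms lowers the rank without changing the
  discriminant; in rank one the discriminant decides.\<close>

lemma cong_mat_over_extension:
  assumes "y \<in> sym_space (Suc n)" "z \<in> sym_space (Suc n)"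
    "map_mat emb y \<in> sym_with_disc (Suc n) D" "map_mat emb z \<in> sym_with_disc (Suc n) D"
  shows "cong_mat (Suc n) (map_mat emb y) (map_mat emb z)"
  using assms
proof (induction n arbitrary: y z)
  case 0
  then show ?case using cong_mat_rank_one by simp
next
  case (Suc n)
  let ?N = "Suc (Suc n)"
  obtain u where u: "u \<in> sym_space (Suc n)" "cong_mat ?N (map_mat emb y) (ext 1 (map_mat emb u))"
    using split_one_over_extension[OF Suc.prems(1)] by blast
  obtain w where w: "w \<in> sym_space (Suc n)" "cong_mat ?N (map_mat emb z) (ext 1 (map_mat emb w))"
    using split_one_over_extension[OF Suc.prems(2)] by blast
  have car: "map_mat emb u \<in> carrier_mat (Suc n) (Suc n)" "map_mat emb w \<in> carrier_mat (Suc n) (Suc n)"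
    "map_mat emb y \<in> carrier_mat ?N ?N" "map_mat emb z \<in> carrier_mat ?N ?N"
    using u w Suc.prems by (auto simp: sym_space_iff)
  have disc: "map_mat emb u \<in> sym_with_disc (Suc n) D"
    if "u \<in> sym_space (Suc n)" "ext 1 (map_mat emb u) \<in> sym_with_disc ?N D" for u
  proof -
    have "map_mat emb u \<in> sym_space (Suc n)" using that(1) embm_sym_space by blast
    moreover from this have "det (ext 1 (map_mat emb u)) = det (map_mat emb u)"
      using det_ext[of "map_mat emb u" "Suc n" 1] by (simp add: sym_space_iff)
    ultimately show ?thesis using that(2) by (simp add: sym_with_disc_def)
  qed
  have "cong_mat (Suc n) (map_mat emb u) (map_mat emb w)"
    using Suc.IH[OF u(1) w(1)] disc u w sym_with_disc_cong Suc.prems(3,4) by blast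
  from cong_mat_ext[OF car(1) this, of 1] show ?case
    using cong_mat_trans[OF car(3)] u(2) cong_mat_sym[OF car(4) w(2)] by blast
qed

text \<open>Hilbert 90: a scalar multiple of \<open>x + k\<close> works unless \<open>-k\<close> is an eigenvalue of \<open>x\<close>.\<close>

lemma hilbert_90:
  assumes x: "x \<in> carrier_mat n n" "x * map_mat gal x = 1\<^sub>m n"
  shows "\<exists>h \<in> carrier (GL n). h = x * map_mat gal h"
proof -
  \<comment> \<open>With \<open>l = emb a + \<iota>\<close>, the matrix
    \<open>h = gal l x + l\<close> satisfies \<open>x * map_mat gal h = h\<close> and is a multiple
    of \<open>x - f a\<close>. Injectivity of \<open>f\<close> leaves some \<open>f a\<close> that
    is not an eigenvalue.\<close>
  define f where "f a = - ((emb a + \<iota>) / (emb a - \<iota>))" for a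
  have nz: "emb a - \<iota> \<noteq> 0" for a using iota_notin by (metis eq_iff_diff_eq_0 rangeI)
  have "inj f"
  proof (rule injI)
    fix a b assume "f a = f b"
    then have "(emb a + \<iota>) * (emb b - \<iota>) = (emb b + \<iota>) * (emb a - \<iota>)"
      using nz by (simp add: f_def frac_eq_eq)
    then have "\<iota> = 0 \<or> b = a" by (simp add: algebra_simps)
    then show "a = b" using iota_nonzero by auto
  qed
  then have "infinite (range f)" using infinite_UNIV_char_0 by (simp add: finite_image_iff)
  moreover have "finite {k. poly (char_poly x) k = 0}"
  proof (rule poly_roots_finite)
    show "char_poly x \<noteq> 0" using degree_monic_char_poly[OF x(1)] by auto
  qed
  ultimately obtain a where a: "poly (char_poly x) (f a) \<noteq> 0"
    by (metis (mono_tags, lifting) finite_subset image_subsetI mem_Collect_eq)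
  define l where "l = emb a + \<iota>"
  have gl: "gal l = emb a - \<iota>" by (simp add: l_def gal.hom_add gal_emb gal_iota)
  define h where "h = gal l \<cdot>\<^sub>m char_matrix x (f a)"
  have hc: "h \<in> carrier_mat n n" using x(1) by (simp add: h_def)
  have "det (char_matrix x (f a)) \<noteq> 0"
    using a eigenvalue_root_char_poly[OF x(1)] eigenvalue_det[OF x(1)] by blast
  then have "det h \<noteq> 0" using nz by (simp add: h_def gl)
  have h: "h = gal l \<cdot>\<^sub>m x + l \<cdot>\<^sub>m 1\<^sub>m n"
  proof -
    have "gal l * f a = - (emb a + \<iota>)" unfolding gl f_def using nz[of a] by simp
    then have "gal l * f a = - l" by (simp only: l_def)
    then show ?thesis unfolding h_def char_matrix_def using x(1)
      by (intro eq_matI) (auto simp: right_diff_distrib)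
  qed
  have "map_mat gal h = l \<cdot>\<^sub>m map_mat gal x + gal l \<cdot>\<^sub>m 1\<^sub>m n"
    unfolding h using x(1) by (intro eq_matI) (auto simp: gal.hom_add gal.hom_mult gal_gal)
  then have "x * map_mat gal h = x * (l \<cdot>\<^sub>m map_mat gal x) + x * (gal l \<cdot>\<^sub>m 1\<^sub>m n)"
    using x(1) by (simp add: mult_add_distrib_mat[of _ n n _ n])
  also have "x * (l \<cdot>\<^sub>m map_mat gal x) = l \<cdot>\<^sub>m 1\<^sub>m n"
    using x by (simp add: mult_smult_distrib[of _ n n _ n])
  also have "x * (gal l \<cdot>\<^sub>m 1\<^sub>m n) = gal l \<cdot>\<^sub>m x"
    using x(1) by (simp add: mult_smult_distrib[of _ n n _ n])
  also have "l \<cdot>\<^sub>m 1\<^sub>m n + gal l \<cdot>\<^sub>m x = h"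
    unfolding h using x(1) by (intro comm_add_mat[of _ n n]) auto
  finally show ?thesis using hc \<open>det h \<noteq> 0\<close> by (intro bexI[of _ h]) (auto simp: GL_iff)
qed


text \<open>Encodes \<open>x = h (gal h)^-1\<close> without inverses; another choice of
  \<open>h\<close> replaces \<open>y\<close> by a matrix congruent to it over the base
  field.\<close>

definition descends :: "nat \<Rightarrow> 'f mat \<Rightarrow> 'e mat \<Rightarrow> 'f mat \<Rightarrow> bool" where
  "descends n j x y \<longleftrightarrow>
     (\<exists>h \<in> carrier (GL n). x * map_mat gal h = h \<and> star h (map_mat emb j) = map_mat emb y)"

section \<open>Orbits and descended forms\<close>

lemma ortho_iff:
  "x \<in> ortho n J \<longleftrightarrow> x \<in> carrier (GL n) \<and> star x J = J"
  by (auto simp: ortho_def star_def)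

lemma map_mat_gal_GL: "h \<in> carrier (GL n) \<Longrightarrow> map_mat gal h \<in> carrier (GL n)"
  by (simp add: GL_iff)

lemma det_ortho:
  assumes "J \<in> sym_space n" "x \<in> ortho n J" shows "det x = 1 \<or> det x = - 1"
proof -
  have "x \<in> carrier_mat n n" "J \<in> carrier_mat n n" "det J \<noteq> 0" "star x J = J"
    using assms by (auto simp: ortho_iff GL_iff sym_space_iff)
  then have "(det x)\<^sup>2 * det J = det J" using det_star[of x n J] by simp
  then have "(det x)\<^sup>2 = 1\<^sup>2" using \<open>det J \<noteq> 0\<close> by simp
  then show ?thesis by (simp only: power2_eq_iff)
qed

lemma SXsp_iff: "x \<in> SXsp gal n J \<longleftrightarrow> x \<in> Xsp gal n J \<and> det x = 1"
  by (auto simp: SXsp_def sortho_def Xsp_def)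

text \<open>As \<open>x\<close> preserves the form, its transform by \<open>h\<close> equals its own
  conjugate and so comes from the base field. From \<open>det x * gal (det h) = det h\<close>,
  \<open>det h\<close> lies in the base field or in \<open>\<iota>\<close> times it, which gives the
  two discriminants.\<close>

lemma descends_exists:
  assumes j: "j \<in> sym_space n" and x: "x \<in> Xsp gal n (map_mat emb j)"
  shows "\<exists>y. descends n j x y \<and> y \<in> sym_with_disc n (if det x = 1 then det j else d * det j)"
proof -
  let ?J = "map_mat emb j"
  have J: "?J \<in> sym_space n" using j embm_sym_space by blast
  have Jc: "?J \<in> carrier_mat n n" "j \<in> carrier_mat n n" "det j \<noteq> 0" using j by (auto simp: sym_space_iff)
  have x': "x \<in> ortho n ?J" "x * map_mat gal x = 1\<^sub>m n" using x by (auto simp: Xsp_def)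
  have xc: "x \<in> carrier_mat n n" "star x ?J = ?J" using x' by (auto simp: ortho_iff GL_iff)
  obtain h where h: "h \<in> carrier (GL n)" "h = x * map_mat gal h" using hilbert_90[OF xc(1) x'(2)] by blast
  have hc: "h \<in> carrier_mat n n" "det h \<noteq> 0" using h by (auto simp: GL_iff)
  have "star h ?J = star (x * map_mat gal h) ?J" using h(2) by simp
  also have "\<dots> = star (map_mat gal h) ?J" using xc hc Jc by (simp add: star_mult[of _ n n _ n])
  also have "\<dots> = map_mat gal (star h ?J)" using hc Jc by (simp add: galm_star[of _ n n])
  finally obtain y where y: "star h ?J = map_mat emb y" using galm_fixed by metis
  have "map_mat emb y \<in> sym_space n" using star_in_sym_space[OF h(1) J] y by simp
  then have ys: "y \<in> sym_space n" using embm_sym_space by blast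
  have "emb (det y) = (det h)\<^sup>2 * emb (det j)"
    using det_star[OF hc(1) Jc(1)] by (simp add: y)
  have det_h: "det x * gal (det h) = det h"
    using arg_cong[OF h(2), of det] xc hc by (simp add: det_mult[of _ n])
  have "\<exists>c. c \<noteq> 0 \<and> det y = (if det x = 1 then det j else d * det j) * c\<^sup>2"
  proof (cases "det x = 1")
    case True
    then obtain c where c: "det h = emb c" using gal_fixed det_h by fastforce
    then have "emb (det y) = emb (det j * c\<^sup>2)"
      using \<open>emb (det y) = _\<close> by (simp add: emb.hom_mult emb.hom_power)
    then have "det y = det j * c\<^sup>2" by (simp only: emb_eq_iff)
    moreover have "c \<noteq> 0" using c hc by auto
    ultimately show ?thesis using True by auto
  next
    case False
    then have "det x = - 1" using det_ortho[OF J x'(1)] by blast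
    then have "gal (det h) = - det h" using det_h by (simp add: minus_equation_iff)
    then obtain c where c: "det h = \<iota> * emb c" using gal_antifixed by blast
    then have "emb (det y) = emb (d * det j * c\<^sup>2)"
      using \<open>emb (det y) = _\<close> by (simp add: emb.hom_mult emb.hom_power power_mult_distrib iota_sq)
    then have "det y = d * det j * c\<^sup>2" by (simp only: emb_eq_iff)
    moreover have "c \<noteq> 0" using c hc by auto
    ultimately show ?thesis using False by auto
  qed
  then have "y \<in> sym_with_disc n (if det x = 1 then det j else d * det j)"
    using ys by (simp add: sym_with_disc_def)
  moreover have "descends n j x y" unfolding descends_def using h(1) h(2)[symmetric] y by blast
  ultimately show ?thesis by blast
qed

text \<open>Over the extension \<open>d\<close> becomes the square \<open>\<iota>^2\<close>, so both
  admissible discriminants agree there with \<open>det j\<close>, and a congruence \<open>h\<close>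
  exists. Then \<open>h (gal h)^-1\<close> is the sought element.\<close>

lemma ex_descends:
  assumes j: "j \<in> sym_space n" and n: "n \<ge> 1" and D: "D = det j \<or> D = d * det j"
    and y: "y \<in> sym_with_disc n D"
  shows "\<exists>x \<in> Xsp gal n (map_mat emb j). descends n j x y \<and> (det x = 1 \<longleftrightarrow> D = det j)"
proof -
  let ?J = "map_mat emb j"
  have J: "?J \<in> sym_space n" using j embm_sym_space by blast
  have Jc: "?J \<in> carrier_mat n n" "j \<in> carrier_mat n n" "det j \<noteq> 0" using j by (auto simp: sym_space_iff)
  have ys: "y \<in> sym_space n" using y by (simp add: sym_with_disc_def)
  obtain c where c: "c \<noteq> 0" "det y = D * c\<^sup>2" using y by (auto simp: sym_with_disc_def)
  \<comment> \<open>\<open>r^2\<close> is the ratio of the determinants, so \<open>det h\<close> is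
    \<open>r\<close> up to sign; whether \<open>gal\<close> fixes or negates \<open>r\<close>
    decides \<open>det x\<close>.\<close>
  define r where "r = (if D = det j then emb c else \<iota> * emb c)"
  have r: "r \<noteq> 0" "emb (det y) = emb (det j) * r\<^sup>2"
    using c D iota_nonzero
    by (auto simp: r_def emb.hom_mult emb.hom_power power_mult_distrib iota_sq)
  obtain m where m: "n = Suc m" using n by (cases n) auto
  have "?J \<in> sym_with_disc n (emb (det j))"
    using J by (auto simp: sym_with_disc_def intro: exI[of _ 1])
  moreover have "map_mat emb y \<in> sym_with_disc n (emb (det j))"
    using ys r embm_sym_space by (auto simp: sym_with_disc_def)
  ultimately have "cong_mat n ?J (map_mat emb y)"
    using cong_mat_over_extension[of j m y] j ys unfolding m by blast
  then obtain h where h: "h \<in> carrier (GL n)" "star h ?J = map_mat emb y"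
    unfolding cong_mat_def by metis
  have gh: "map_mat gal h \<in> carrier (GL n)" using h by (simp add: map_mat_gal_GL)
  obtain k where k: "k \<in> carrier (GL n)" "k * map_mat gal h = 1\<^sub>m n" using GL_inverse[OF gh] by metis
  define x where "x = h * k"
  have car: "h \<in> carrier_mat n n" "k \<in> carrier_mat n n" "map_mat gal h \<in> carrier_mat n n"
    "x \<in> carrier_mat n n" "map_mat gal x \<in> carrier_mat n n" "det h \<noteq> 0"
    using h k by (auto simp: GL_iff x_def)
  have xh: "x * map_mat gal h = h" using car k by (simp add: x_def mat_assoc[of _ n])
  have gxh: "map_mat gal x * h = map_mat gal h"
    using arg_cong[OF xh, of "map_mat gal"] car by (simp add: galm_mult[of _ n])
  have xx: "x * map_mat gal x = 1\<^sub>m n"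
  proof (rule GL_cancel_right[OF _ _ h(1)])
    show "x * map_mat gal x * h = 1\<^sub>m n * h" using car by (simp add: mat_assoc[of _ n] gxh xh)
  qed (use car in auto)
  have "star x ?J = ?J"
  proof (rule star_inject[OF _ _ gh])
    have "star (map_mat gal h) (star x ?J) = star h ?J"
      using star_mult[of x n n "map_mat gal h" n ?J] car Jc xh by simp
    also have "\<dots> = map_mat gal (map_mat emb y)" by (simp add: h(2))
    also have "\<dots> = star (map_mat gal h) ?J"
      using galm_star[of h n n ?J] car Jc by (simp add: h(2)[symmetric])
    finally show "star (map_mat gal h) (star x ?J) = star (map_mat gal h) ?J" .
  qed (use car Jc in auto)
  moreover have "x \<in> carrier (GL n)" unfolding x_def using h(1) k(1) by (rule GL_mult)
  ultimately have X: "x \<in> Xsp gal n ?J" using xx by (simp add: Xsp_def ortho_iff)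
  have det_x: "det x * gal (det h) = det h"
    using arg_cong[OF xh, of det] car by (simp add: det_mult[of _ n])
  have "emb (det y) = (det h)\<^sup>2 * emb (det j)"
    using det_star[OF car(1) Jc(1)] by (simp add: h(2))
  then have "emb (det j) * (det h)\<^sup>2 = emb (det j) * r\<^sup>2" unfolding r(2) by (simp only: mult.commute)
  then have "(det h)\<^sup>2 = r\<^sup>2" using Jc(3) by simp
  then have dh: "det h = r \<or> det h = - r" by (simp add: power2_eq_iff)
  have "det x = 1 \<longleftrightarrow> D = det j"
  proof (cases "D = det j")
    case True
    then have "gal (det h) = det h" using dh by (auto simp: r_def gal_emb gal.hom_uminus)
    then show ?thesis using det_x car(6) True by simp
  next
    case False
    then have "gal (det h) = - det h"
      using dh by (auto simp: r_def gal_emb gal_iota gal.hom_mult gal.hom_uminus)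
    then have "det x \<noteq> 1" using det_x car(6) by auto
    then show ?thesis using False by simp
  qed
  then show ?thesis using X xh h unfolding descends_def by blast
qed

lemma twisted_conj_iff:
  assumes g: "g \<in> carrier (GL n)" and x: "x \<in> carrier_mat n n" "x' \<in> carrier_mat n n"
  shows "x' = twisted_conj gal n g x \<longleftrightarrow> x' * map_mat gal g = g * x"
proof -
  have gg: "map_mat gal g \<in> carrier (GL n)" using g by (rule map_mat_gal_GL)
  define i where "i = inv\<^bsub>GL n\<^esub> (map_mat gal g)"
  have i: "i \<in> carrier (GL n)" "i * map_mat gal g = 1\<^sub>m n" using GL_inv[OF gg] by (auto simp: i_def)
  have car: "g \<in> carrier_mat n n" "map_mat gal g \<in> carrier_mat n n" "i \<in> carrier_mat n n"
    using g i by (auto simp: GL_iff)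
  have "x' = g * x * i \<longleftrightarrow> x' * map_mat gal g = g * x * i * map_mat gal g"
    using GL_cancel_right[of x' n "g * x * i" "map_mat gal g"] car x gg by auto
  also have "g * x * i * map_mat gal g = g * x" using car x i(2) by (simp add: mat_assoc[of _ n])
  finally show ?thesis by (simp add: twisted_conj_def i_def)
qed

text \<open>Conjugating \<open>x\<close> by \<open>g\<close> replaces \<open>h\<close> by
  \<open>g * h\<close>, and \<open>g\<close> preserves the form.\<close>

lemma descends_twisted_conj:
  assumes j: "j \<in> carrier_mat n n" and g: "g \<in> ortho n (map_mat emb j)"
    and x: "x \<in> carrier_mat n n" "x' \<in> carrier_mat n n" "x' * map_mat gal g = g * x"
    and y: "descends n j x y"
  shows "descends n j x' y"
proof -
  let ?J = "map_mat emb j"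
  obtain h where h: "h \<in> carrier (GL n)" "x * map_mat gal h = h" "star h ?J = map_mat emb y"
    using y unfolding descends_def by blast
  have gG: "g \<in> carrier (GL n)" "star g ?J = ?J" using g by (auto simp: ortho_iff)
  have car: "g \<in> carrier_mat n n" "h \<in> carrier_mat n n" "map_mat gal g \<in> carrier_mat n n"
    "map_mat gal h \<in> carrier_mat n n" "?J \<in> carrier_mat n n"
    using gG h j by (auto simp: GL_iff)
  have "x' * map_mat gal (g * h) = x' * map_mat gal g * map_mat gal h"
    using car x(1,2) by (simp add: galm_mult[of _ n] mat_assoc[of _ n])
  also have "\<dots> = g * h" unfolding x(3) using car x(1) h(2) by (simp add: mat_assoc[of _ n])
  finally have "x' * map_mat gal (g * h) = g * h" .
  moreover have "star (g * h) ?J = map_mat emb y"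
    using car by (simp add: star_mult[of _ n n _ n] gG(2) h(3))
  ultimately show ?thesis unfolding descends_def using GL_mult[OF gG(1) h(1)] by blast
qed

text \<open>Two choices of \<open>h\<close> differ by a matrix \<open>k\<close> fixed by
  \<open>gal\<close>, which therefore comes from the base field and provides the congruence.\<close>

lemma descends_unique:
  assumes x: "x \<in> carrier_mat n n" and y: "descends n j x y" "descends n j x y'"
    and car: "j \<in> carrier_mat n n" "y \<in> carrier_mat n n"
  shows "cong_mat n y y'"
proof -
  let ?J = "map_mat emb j"
  obtain h where h: "h \<in> carrier (GL n)" "x * map_mat gal h = h" "star h ?J = map_mat emb y"
    using y unfolding descends_def by blast
  obtain h' where h': "h' \<in> carrier (GL n)" "x * map_mat gal h' = h'" "star h' ?J = map_mat emb y'"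
    using y unfolding descends_def by blast
  obtain i where i: "i \<in> carrier (GL n)" "h * i = 1\<^sub>m n" using GL_inverse[OF h(1)] by metis
  define k where "k = i * h'"
  have c: "h \<in> carrier_mat n n" "h' \<in> carrier_mat n n" "i \<in> carrier_mat n n" "k \<in> carrier_mat n n"
    "map_mat gal h \<in> carrier_mat n n" "map_mat gal k \<in> carrier_mat n n"
    using h h' i by (auto simp: GL_iff k_def)
  have hk: "h * k = h'" using c i(2) by (simp add: k_def mat_assoc[of _ n, symmetric])
  have "h * map_mat gal k = x * map_mat gal h * map_mat gal k" by (simp add: h(2))
  also have "\<dots> = x * map_mat gal (h * k)" using c x by (simp add: galm_mult[of _ n] mat_assoc[of _ n])
  also have "\<dots> = h * k" by (simp add: hk h'(2))
  finally have "map_mat gal k = k" using GL_cancel_left[OF c(6,4) h(1)] by blast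
  then obtain k0 where k0: "k = map_mat emb k0" "dim_row k0 = dim_row k" "dim_col k0 = dim_col k"
    using galm_fixed by blast
  have k0c: "k0 \<in> carrier_mat n n" using k0 c by auto
  have "k \<in> carrier (GL n)" unfolding k_def using i(1) h'(1) by (rule GL_mult)
  then have k0G: "k0 \<in> carrier (GL n)" using k0c by (simp add: GL_iff k0(1))
  have "map_mat emb y' = star k (star h ?J)"
    using c car by (simp add: star_mult[of _ n n _ n, symmetric] hk h'(3))
  also have "\<dots> = map_mat emb (star k0 y)"
    using k0c car by (simp add: h(3) k0(1) embm_star[of _ n n])
  finally have "y' = star k0 y" by (rule embm_inject)
  then show ?thesis unfolding cong_mat_def using k0G by blast
qed

text \<open>If \<open>k\<close> carries \<open>y\<close> to \<open>y'\<close>, then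
  \<open>g = h' (h k)^-1\<close> preserves the form and moves \<open>x\<close> to \<open>x'\<close>.
  Its determinant is \<open>1\<close> or \<open>- 1\<close>; a reflection of \<open>y\<close>
  corrects the sign of \<open>det k\<close>.\<close>

lemma descends_cong_imp:
  assumes n: "n \<ge> 1" and j: "j \<in> sym_space n" and y: "y \<in> sym_space n" "cong_mat n y y'"
    and x: "x \<in> carrier_mat n n" "x' \<in> carrier_mat n n"
    and xy: "descends n j x y" "descends n j x' y'"
  shows "\<exists>g \<in> sortho n (map_mat emb j). x' * map_mat gal g = g * x"
proof -
  let ?J = "map_mat emb j"
  obtain h where h: "h \<in> carrier (GL n)" "x * map_mat gal h = h" "star h ?J = map_mat emb y"
    using xy unfolding descends_def by blast
  obtain h' where h': "h' \<in> carrier (GL n)" "x' * map_mat gal h' = h'" "star h' ?J = map_mat emb y'"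
    using xy unfolding descends_def by blast
  have jc: "?J \<in> carrier_mat n n" "det ?J \<noteq> 0" "y \<in> carrier_mat n n" using j y by (auto simp: sym_space_iff)
  have hc: "h \<in> carrier_mat n n" "h' \<in> carrier_mat n n" "det h \<noteq> 0" "det h' \<noteq> 0"
    using h h' by (auto simp: GL_iff)
  have det_eq: "det h' = emb (det k) * det h \<or> det h' = - (emb (det k) * det h)"
    if "k \<in> carrier_mat n n" "y' = star k y" for k
  proof -
    have "emb (det y') = (det h')\<^sup>2 * det ?J" using det_star[OF hc(2) jc(1)] by (simp add: h'(3))
    moreover have "emb (det y) = (det h)\<^sup>2 * det ?J" using det_star[OF hc(1) jc(1)] by (simp add: h(3))
    moreover have "emb (det y') = (emb (det k))\<^sup>2 * emb (det y)"
      using det_star[OF that(1) jc(3)] by (simp add: that(2) emb.hom_mult emb.hom_power)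
    ultimately have "(det h')\<^sup>2 * det ?J = (emb (det k) * det h)\<^sup>2 * det ?J"
      unfolding power_mult_distrib mult.assoc by (simp only:)
    then have "(det h')\<^sup>2 = (emb (det k) * det h)\<^sup>2" using jc(2) by simp
    then show ?thesis by (simp only: power2_eq_iff)
  qed
  obtain m where m: "n = Suc m" using n by (cases n) auto
  have "\<exists>k \<in> carrier (GL n). y' = star k y \<and> det h' = emb (det k) * det h"
  proof -
    obtain k where k: "k \<in> carrier (GL n)" "y' = star k y" using y(2) unfolding cong_mat_def by blast
    have kc: "k \<in> carrier_mat n n" using k(1) by (simp add: GL_iff)
    show ?thesis
    proof (cases "det h' = emb (det k) * det h")
      case False
      then have neg: "det h' = - (emb (det k) * det h)" using det_eq[OF kc k(2)] by blast
      obtain s where s: "s \<in> carrier_mat n n" "star s y = y" "det s = - 1"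
        using ex_reflection y(1) unfolding m by blast
      have "star (s * k) y = y'" using s kc jc by (simp add: star_mult[of _ n n _ n] k(2))
      moreover have "det (s * k) = - det k" using s kc by (simp add: det_mult[of _ n])
      moreover have "s * k \<in> carrier (GL n)" using s k(1) by (intro GL_mult) (simp_all add: GL_iff)
      ultimately show ?thesis using neg by (intro bexI[of _ "s * k"]) (simp_all add: emb.hom_uminus)
    qed (use k in blast)
  qed
  then obtain k0 where k0: "k0 \<in> carrier (GL n)" "y' = star k0 y" "det h' = emb (det k0) * det h" by blast
  define k where "k = map_mat emb k0"
  have k0c: "k0 \<in> carrier_mat n n" "det k0 \<noteq> 0" using k0 by (auto simp: GL_iff)
  have kG: "k \<in> carrier (GL n)" using k0c by (simp add: k_def GL_iff)
  have gk: "map_mat gal k = k" by (simp add: k_def)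
  have hkG: "h * k \<in> carrier (GL n)" using h(1) kG by (rule GL_mult)
  obtain i where i: "i \<in> carrier (GL n)" "i * (h * k) = 1\<^sub>m n" using GL_inverse[OF hkG] by metis
  define g where "g = h' * i"
  have gG: "g \<in> carrier (GL n)" unfolding g_def using h'(1) i(1) by (rule GL_mult)
  have c: "k \<in> carrier_mat n n" "i \<in> carrier_mat n n" "g \<in> carrier_mat n n" "h * k \<in> carrier_mat n n"
    "map_mat gal g \<in> carrier_mat n n" "map_mat gal h \<in> carrier_mat n n"
    using kG i gG hkG h by (auto simp: GL_iff)
  have ghk: "g * (h * k) = h'" using c i(2) hc by (simp add: g_def mat_assoc[of _ n])
  have star_hk: "star (h * k) ?J = star h' ?J"
    using hc c jc k0c by (simp add: star_mult[of _ n n _ n] h(3) h'(3) k_def k0(2) embm_star[of _ n n])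
  have "star g ?J = ?J"
  proof (rule star_inject[OF _ _ hkG])
    show "star (h * k) (star g ?J) = star (h * k) ?J"
      using star_mult[of g n n "h * k" n ?J] c jc by (simp add: ghk star_hk)
  qed (use c jc in auto)
  moreover have "det g = 1"
  proof -
    have "det h' = det g * (det h * emb (det k0))"
      using arg_cong[OF ghk, of det] c hc by (simp add: det_mult[of _ n] k_def)
    then have "det g * (det h * emb (det k0)) = 1 * (det h * emb (det k0))" using k0(3) by (simp add: mult.commute)
    moreover have "det h * emb (det k0) \<noteq> 0" using hc k0c by simp
    ultimately show ?thesis using mult_right_cancel by blast
  qed
  ultimately have "g \<in> sortho n ?J" using gG by (simp add: sortho_def ortho_iff)
  moreover have "x' * map_mat gal g = g * x"
  proof (rule GL_cancel_right[OF _ _ map_mat_gal_GL[OF hkG]])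
    have "x' * map_mat gal g * map_mat gal (h * k) = x' * map_mat gal (g * (h * k))"
      using x c hc by (simp add: galm_mult[of _ n] mat_assoc[of _ n])
    also have "\<dots> = h'" by (simp add: ghk h'(2))
    also have "\<dots> = g * (x * map_mat gal h * k)" by (simp add: h(2) ghk)
    also have "\<dots> = g * x * map_mat gal (h * k)"
      using x c hc by (simp add: galm_mult[of _ n] mat_assoc[of _ n] gk)
    finally show "x' * map_mat gal g * map_mat gal (h * k) = g * x * map_mat gal (h * k)" .
  qed (use x c in auto)
  ultimately show ?thesis by blast
qed

section \<open>Counting twisted orbits\<close>

lemma sortho_orbit:
  assumes x: "x \<in> carrier_mat n n"
  shows "orbit (GL n\<lparr>carrier := sortho n J\<rparr>) (twisted_conj gal n) x =
    {x' \<in> carrier_mat n n. \<exists>g \<in> sortho n J. x' * map_mat gal g = g * x}"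
proof -
  have G: "g \<in> carrier (GL n)" if "g \<in> sortho n J" for g
    using that by (simp add: sortho_def ortho_iff)
  have "twisted_conj gal n g x \<in> carrier_mat n n" if "g \<in> sortho n J" for g
    using GL_inv(1)[OF map_mat_gal_GL[OF G[OF that]]] G[OF that] x
    by (auto simp: twisted_conj_def GL_iff)
  then show ?thesis unfolding orbit_def using twisted_conj_iff[OF G x] by auto
qed

lemma sortho_orbit_eq_iff:
  assumes n: "n \<ge> 1" and j: "j \<in> sym_space n" and y: "y \<in> sym_space n" "y' \<in> sym_space n"
    and x: "x \<in> carrier_mat n n" "x' \<in> carrier_mat n n"
    and xy: "descends n j x y" "descends n j x' y'"
  shows "orbit (GL n\<lparr>carrier := sortho n (map_mat emb j)\<rparr>) (twisted_conj gal n) x =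
    orbit (GL n\<lparr>carrier := sortho n (map_mat emb j)\<rparr>) (twisted_conj gal n) x' \<longleftrightarrow> cong_mat n y y'"
    (is "?O x = ?O x' \<longleftrightarrow> _")
proof -
  have car: "j \<in> carrier_mat n n" "y \<in> carrier_mat n n" "y' \<in> carrier_mat n n"
    using j y by (auto simp: sym_space_iff)
  have so: "g \<in> ortho n J" if "g \<in> sortho n J" for g and J :: "'e mat" using that by (simp add: sortho_def)
  \<comment> \<open>An orbit is exactly the set of matrices that descend to the chosen
    \<open>y\<close>.\<close>
  have orb: "z \<in> ?O x \<longleftrightarrow> z \<in> carrier_mat n n \<and> descends n j z y"
    if x: "x \<in> carrier_mat n n" and y: "y \<in> sym_space n" and xy: "descends n j x y" for x y z
  proof -
    have "y \<in> carrier_mat n n" using y by (simp add: sym_space_iff)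
    then have refl: "cong_mat n y y" by (rule cong_mat_refl)
    show ?thesis
      unfolding sortho_orbit[OF x]
      using descends_twisted_conj[OF car(1) so x _ _ xy] descends_cong_imp[OF n j y refl x _ xy] by blast
  qed
  show ?thesis
  proof
    assume "?O x = ?O x'"
    then have "descends n j x y'" using orb[OF x(1) y(1) xy(1)] orb[OF x(2) y(2) xy(2)] x xy by blast
    then show "cong_mat n y y'" using descends_unique[OF x(1) xy(1)] car by blast
  next
    assume c: "cong_mat n y y'"
    \<comment> \<open>Descent is insensitive to congruence of \<open>y\<close> over the base field:
      \<open>h\<close> is multiplied on the right by the congruence.\<close>
    have tr: "descends n j z y'"
      if c: "cong_mat n y y'" and z: "z \<in> carrier_mat n n" "descends n j z y" and y: "y \<in> carrier_mat n n"
      for y y' z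
    proof -
      obtain h where h: "h \<in> carrier (GL n)" "z * map_mat gal h = h" "star h (map_mat emb j) = map_mat emb y"
        using z unfolding descends_def by blast
      obtain k where k: "k \<in> carrier (GL n)" "y' = star k y" using c unfolding cong_mat_def by blast
      have hk: "h \<in> carrier_mat n n" "k \<in> carrier_mat n n" using h k by (auto simp: GL_iff)
      have "z * map_mat gal (h * map_mat emb k) = z * map_mat gal h * map_mat emb k"
        using z hk by (simp add: galm_mult[of _ n] mat_assoc[of _ n])
      then have "z * map_mat gal (h * map_mat emb k) = h * map_mat emb k" by (simp add: h(2))
      moreover have "star (h * map_mat emb k) (map_mat emb j) = map_mat emb y'"
        using hk car y by (simp add: star_mult[of _ n n _ n] h(3) k(2) embm_star[of _ n n])
      moreover have "h * map_mat emb k \<in> carrier (GL n)"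
        using h(1) k(1) by (intro GL_mult) (simp_all add: GL_iff)
      ultimately show ?thesis unfolding descends_def by blast
    qed
    have "descends n j z y \<longleftrightarrow> descends n j z y'" if "z \<in> carrier_mat n n" for z
      using tr[OF c that _ car(2)] tr[OF cong_mat_sym[OF car(2) c] that _ car(3)] by blast
    then show "?O x = ?O x'" using orb[OF x(1) y(1) xy(1)] orb[OF x(2) y(2) xy(2)] by blast
  qed
qed

text \<open>One statement for both halves: the condition on \<open>det x\<close> selects the
  determinant-one part when \<open>D = det j\<close> and its complement when
  \<open>D = d * det j\<close>; these cases differ because \<open>d \<noteq> 1\<close>.\<close>

lemma card_sortho_orbits:
  assumes n: "n \<ge> 1" and j: "j \<in> sym_space n" and D: "D = det j \<or> D = d * det j"
  shows "card (sortho_orbits gal n (map_mat emb j)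
      {x \<in> Xsp gal n (map_mat emb j). det x = 1 \<longleftrightarrow> D = det j}) =
    card (sym_orbits_disc n (sq_class D))"
proof -
  let ?O = "orbit (GL n\<lparr>carrier := sortho n (map_mat emb j)\<rparr>) (twisted_conj gal n)"
  let ?A = "{x \<in> Xsp gal n (map_mat emb j). det x = 1 \<longleftrightarrow> D = det j}"
  have "det j \<noteq> 0" using j by (simp add: sym_space_iff)
  then have ne: "d * det j \<noteq> det j" using d_nonsquare[of 1] by simp
  have xc: "x \<in> carrier_mat n n" if "x \<in> ?A" for x
    using that by (simp add: Xsp_def ortho_iff GL_iff)
  have "card (?O ` ?A) = card (orbit (GL n) star ` sym_with_disc n D)"
  proof (rule card_image_correspondence[where R = "descends n j"])
    fix x assume x: "x \<in> ?A"
    then obtain y where "descends n j x y" "y \<in> sym_with_disc n (if det x = 1 then det j else d * det j)"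
      using descends_exists[OF j] by blast
    moreover have "(if det x = 1 then det j else d * det j) = D" using x D ne by auto
    ultimately show "\<exists>y \<in> sym_with_disc n D. descends n j x y" by auto
  next
    fix y assume "y \<in> sym_with_disc n D"
    then show "\<exists>x \<in> ?A. descends n j x y" using ex_descends[OF j n D] by blast
  next
    fix x x' y y'
    assume "x \<in> ?A" "x' \<in> ?A" "y \<in> sym_with_disc n D" "y' \<in> sym_with_disc n D"
      "descends n j x y" "descends n j x' y'"
    then show "?O x = ?O x' \<longleftrightarrow> orbit (GL n) star y = orbit (GL n) star y'"
      using sortho_orbit_eq_iff[OF n j, of y y' x x'] orbit_star_eq_iff[of y n y'] xc
      by (simp add: sym_with_disc_def sym_space_iff)
  qed
  moreover have "sortho_orbits gal n (map_mat emb j) ?A = ?O ` ?A"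
    unfolding sortho_orbits_def orbits_def by auto
  ultimately show ?thesis by (simp add: sym_orbits_disc_eq)
qed

lemma Xsp_twisted_conj:
  assumes J: "J \<in> carrier_mat n n" "map_mat gal J = J" and x: "x \<in> Xsp gal n J"
    and g: "g \<in> sortho n J" and x': "x' \<in> carrier_mat n n" "x' * map_mat gal g = g * x"
  shows "x' \<in> Xsp gal n J" "det x' = det x"
proof -
  have xG: "x \<in> carrier (GL n)" "star x J = J" "x * map_mat gal x = 1\<^sub>m n"
    using x by (auto simp: Xsp_def ortho_iff)
  have gG: "g \<in> carrier (GL n)" "star g J = J" "det g = 1" using g by (auto simp: sortho_def ortho_iff)
  have car: "x \<in> carrier_mat n n" "g \<in> carrier_mat n n" "map_mat gal g \<in> carrier_mat n n"
    "map_mat gal x \<in> carrier_mat n n" "map_mat gal x' \<in> carrier_mat n n"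
    using xG gG x' by (auto simp: GL_iff)
  show det: "det x' = det x"
    using arg_cong[OF x'(2), of det] car x'(1) by (simp add: det_mult[of _ n] gG(3))
  have "star x' J = J"
  proof (rule star_inject[OF _ _ map_mat_gal_GL[OF gG(1)]])
    have "star (map_mat gal g) (star x' J) = star (g * x) J"
      using star_mult[of x' n n "map_mat gal g" n J] car x' J by simp
    also have "\<dots> = J" using car J by (simp add: star_mult[of _ n n _ n] gG(2) xG(2))
    also have "\<dots> = star (map_mat gal g) J"
      using galm_star[of g n n J] car J gG(2) by simp
    finally show "star (map_mat gal g) (star x' J) = star (map_mat gal g) J" .
  qed (use J x' in auto)
  moreover have "x' * map_mat gal x' = 1\<^sub>m n"
  proof (rule GL_cancel_right[OF _ _ gG(1)])
    have "map_mat gal x' * g = map_mat gal g * map_mat gal x"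
      using arg_cong[OF x'(2), of "map_mat gal"] car x'(1) by (simp add: galm_mult[of _ n])
    then have "x' * map_mat gal x' * g = x' * map_mat gal g * map_mat gal x"
      using car x'(1) by (simp add: mat_assoc[of _ n])
    also have "\<dots> = g * (x * map_mat gal x)" unfolding x'(2) using car by (simp add: mat_assoc[of _ n])
    also have "\<dots> = 1\<^sub>m n * g" using car by (simp add: xG(3))
    finally show "x' * map_mat gal x' * g = 1\<^sub>m n * g" .
  qed (use car x' in auto)
  moreover have "x' \<in> carrier (GL n)" using x'(1) det xG(1) by (simp add: GL_iff)
  ultimately show "x' \<in> Xsp gal n J" by (simp add: Xsp_def ortho_iff)
qed

text \<open>Twisting preserves the symmetric space and the determinant, so orbits lie in
  \<open>A\<close>; each point lies in its own orbit, so they cover \<open>A\<close>. A single orbit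
  is thus \<open>A\<close> itself.\<close>

lemma sortho_orbits_singleton_iff:
  assumes j: "j \<in> sym_space n"
    and A: "A = {x \<in> Xsp gal n (map_mat emb j). P (det x)}"
  shows "sortho_orbits gal n (map_mat emb j) A = {A} \<longleftrightarrow>
    card (sortho_orbits gal n (map_mat emb j) A) = 1"
proof
  let ?J = "map_mat emb j"
  let ?O = "orbit (GL n\<lparr>carrier := sortho n ?J\<rparr>) (twisted_conj gal n)"
  have J: "?J \<in> carrier_mat n n" "map_mat gal ?J = ?J" using j by (auto simp: sym_space_iff)
  have xc: "x \<in> carrier_mat n n" if "x \<in> A" for x using that by (simp add: A Xsp_def ortho_iff GL_iff)
  have eq: "sortho_orbits gal n ?J A = ?O ` A" unfolding sortho_orbits_def orbits_def by auto
  have sub: "?O x \<subseteq> A" if "x \<in> A" for x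
    using Xsp_twisted_conj[OF J, of x] that unfolding sortho_orbit[OF xc[OF that]] by (auto simp: A)
  have one: "1\<^sub>m n \<in> sortho n ?J" using J by (simp add: sortho_def ortho_iff GL_one star_one)
  have self: "x \<in> ?O x" if "x \<in> A" for x
  proof -
    have "x * map_mat gal (1\<^sub>m n) = 1\<^sub>m n * x" using xc[OF that] by (simp add: gal.mat_hom_one)
    with one have "\<exists>g \<in> sortho n ?J. x * map_mat gal g = g * x" by (rule bexI[rotated])
    then show ?thesis unfolding sortho_orbit[OF xc[OF that]] using xc[OF that] by simp
  qed
  assume "card (sortho_orbits gal n ?J A) = 1"
  then obtain C where C: "?O ` A = {C}" by (auto simp: eq card_1_singleton_iff)
  then have "C \<in> ?O ` A" by simp
  then obtain x0 where "C = ?O x0" "x0 \<in> A" by (rule imageE)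
  then have "C \<subseteq> A" using sub by simp
  moreover have "A \<subseteq> C"
  proof
    fix x assume x: "x \<in> A"
    have "?O x = C" using imageI[OF x, of ?O] unfolding C by simp
    then show "x \<in> C" using self[OF x] by simp
  qed
  ultimately show "sortho_orbits gal n ?J A = {A}" using C eq by simp
qed simp

end

theorem proposition5:
  fixes vF :: "'f::field_char_0 \<Rightarrow> int" and vE :: "'e::field_char_0 \<Rightarrow> int"
    and emb :: "'f \<Rightarrow> 'e" and gal :: "'e \<Rightarrow> 'e"
    and \<iota> :: 'e and d :: 'f and n :: nat and j :: "'f mat"
  defines "J \<equiv> map_mat emb j"
  defines "SX \<equiv> SXsp gal n J"
    and "CX \<equiv> Xsp gal n J - SXsp gal n J"
  assumes local_F: "nonarch_local_field vF"
    and local_E: "nonarch_local_field vE"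
    and quadratic: "quadratic_extension emb gal"
    and iota_gen: "\<And>x. \<exists>a b. x = emb a + emb b * \<iota>"
    and iota_notin: "\<iota> \<notin> range emb"
    and iota_sq: "\<iota>\<^sup>2 = emb d"
    and n: "n \<ge> 1"
    and j: "j \<in> sym_space n"
  shows "(sortho_orbits gal n J SX = {SX} \<longleftrightarrow>
            (\<exists>!Y. Y \<in> sym_orbits_disc n (sq_class (det j)))) \<and>
         ((\<exists>!Y. Y \<in> sym_orbits_disc n (sq_class (det j))) \<longleftrightarrow>
            n = 1 \<or> n = 2 \<and> det j \<in> sq_class (- 1)) \<and>
         (sortho_orbits gal n J CX = {CX} \<longleftrightarrow>
            (\<exists>!Y. Y \<in> sym_orbits_disc n (sq_class (d * det j)))) \<and>
         ((\<exists>!Y. Y \<in> sym_orbits_disc n (sq_class (d * det j))) \<longleftrightarrow>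
            n = 1 \<or> n = 2 \<and> det j \<in> sq_class (- d)) \<and>
         (n \<ge> 3 \<or> n = 2 \<and> det j \<notin> sq_class (- 1) \<longrightarrow> card (sortho_orbits gal n J SX) = 2) \<and>
         (n \<ge> 3 \<or> n = 2 \<and> det j \<notin> sq_class (- d) \<longrightarrow> card (sortho_orbits gal n J CX) = 2)"
proof -
  interpret nonarch_local_field vF by (rule local_F)
  interpret quadratic_extension emb gal by (rule quadratic)
  interpret local_quadratic vF emb gal \<iota> d
    by unfold_locales (use iota_gen iota_notin iota_sq in auto)
  have dj: "det j \<noteq> 0" "d * det j \<noteq> 0" using j d_nonzero by (auto simp: sym_space_iff)
  have ne: "d * det j \<noteq> det j" using dj d_nonsquare[of 1] by simp
  have SX: "SX = {x \<in> Xsp gal n J. det x = 1}" unfolding SX_def using SXsp_iff by auto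
  have CX: "CX = {x \<in> Xsp gal n J. det x \<noteq> 1}" unfolding CX_def using SXsp_iff by auto
  \<comment> \<open>As infinite sets have \<open>card\<close> equal to \<open>0\<close>, unique
    existence amounts to \<open>card K = 1\<close>.\<close>
  have ex1: "(\<exists>!Y. Y \<in> K) \<longleftrightarrow> card K = 1" for K :: "'f mat set set"
    by (auto simp: card_1_singleton_iff)
  have sq1: "(\<exists>z. - det j = z\<^sup>2) \<longleftrightarrow> det j \<in> sq_class (- 1)"
  proof
    assume "\<exists>z. - det j = z\<^sup>2"
    then obtain z where z: "- det j = z\<^sup>2" by blast
    then have "z \<noteq> 0" using dj by auto
    moreover have "det j = (- 1) * z\<^sup>2" unfolding z[symmetric] by simp
    ultimately have "det j = (- 1) * z\<^sup>2 \<and> z \<noteq> 0" by blast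
    then show "det j \<in> sq_class (- 1)" unfolding sq_class_def by blast
  qed (auto simp: sq_class_def)
  \<comment> \<open>\<open>- d\<close> and \<open>- 1 / d\<close> lie in the same square class,
    hence the witness \<open>z / d\<close>.\<close>
  have sqd: "(\<exists>z. - (d * det j) = z\<^sup>2) \<longleftrightarrow> det j \<in> sq_class (- d)"
  proof
    assume "\<exists>z. - (d * det j) = z\<^sup>2"
    then obtain z where z: "- (d * det j) = z\<^sup>2" by blast
    have "(- d) * (z / d)\<^sup>2 = (- d) * (- (d * det j) / d\<^sup>2)" unfolding power_divide z ..
    also have "\<dots> = det j" using d_nonzero by (simp add: power2_eq_square)
    finally have "det j = (- d) * (z / d)\<^sup>2" ..
    moreover have "z / d \<noteq> 0" using z dj by auto
    ultimately show "det j \<in> sq_class (- d)" unfolding sq_class_def by blast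
  next
    assume "det j \<in> sq_class (- d)"
    then obtain c where "det j = - d * c\<^sup>2" by (auto simp: sq_class_def)
    then have "- (d * det j) = (d * c)\<^sup>2" by (simp add: power2_eq_square)
    then show "\<exists>z. - (d * det j) = z\<^sup>2" by blast
  qed
  have cS: "card (sortho_orbits gal n J SX) = card (sym_orbits_disc n (sq_class (det j)))"
    using card_sortho_orbits[OF n j, of "det j"] by (simp add: SX J_def)
  have cC: "card (sortho_orbits gal n J CX) = card (sym_orbits_disc n (sq_class (d * det j)))"
    using card_sortho_orbits[OF n j, of "d * det j"] ne by (simp add: CX J_def)
  have kS: "card (sym_orbits_disc n (sq_class (det j))) =
      (if n = 1 \<or> n = 2 \<and> det j \<in> sq_class (- 1) then 1 else 2)"
    using card_sym_orbits_disc[OF dj(1) n] by (simp add: sq1)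
  have kC: "card (sym_orbits_disc n (sq_class (d * det j))) =
      (if n = 1 \<or> n = 2 \<and> det j \<in> sq_class (- d) then 1 else 2)"
    using card_sym_orbits_disc[OF dj(2) n] by (simp add: sqd)
  have oS: "sortho_orbits gal n J SX = {SX} \<longleftrightarrow> card (sortho_orbits gal n J SX) = 1"
    unfolding J_def by (rule sortho_orbits_singleton_iff[OF j SX[unfolded J_def]])
  have oC: "sortho_orbits gal n J CX = {CX} \<longleftrightarrow> card (sortho_orbits gal n J CX) = 1"
    unfolding J_def by (rule sortho_orbits_singleton_iff[OF j CX[unfolded J_def]])
  show ?thesis unfolding ex1 oS oC cS cC kS kC by auto
qed

end
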